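(* Let $C$ be a diamond category with at most countably many isomorphism classes. For each isomorphism class $G$ of objects of $C$, let $M_G$ be a real number so that $(M_G)_G$ is well-behaved. If $\nu^t$ ($t=1,2,\dots$) is a sequence of measures on $\mathcal{P}$ such that for all $G\in C$ $$\lim_{t\to\infty}\int_{X\in\mathcal{P}}|\mathrm{Epi}(X,G)|\,d\nu^t=M_G,$$ then a measure $\nu$ on $\mathcal{P}$ with $G$-moment $M_G$ for all $G\in C$ exists (it is then the unique measure with these moments, with $\nu(U_{\mathcal{L},F})=\sum_{G\in\mathcal{L}}\frac{\hat{\mu}(F,G)}{|\mathrm{Aut}(G)|}M_G$ for every level $\mathcal{L}$ and $F\in\mathcal{L}$), and as $t\to\infty$ the $\nu^t$ weakly converge to $\nu$.
   Context: Category notions. Let $C$ be a small category. A quotient of an object $G$ is a pair $(F,\pi)$ of an object $F$ and an epimorphism $\pi:G\to F$; quotients $(F,\pi),(F',\pi')$ are isomorphic if there is an isomorphism $\rho:F\to F'$ with $\pi'=\rho\pi$. Isomorphism classes of quotients of $G$ form a poset, where $H\ge F$ if there is $h:H\to F$ compatible with the morphisms from $G$; joins $\vee$ and meets $\wedge$ of quotients of $G$ are taken in this poset. A lattice (poset in which any two elements have a join and a meet) is modular if $a\le b$ implies $a\vee(x\wedge b)=(a\vee x)\wedge b$ for all $x$. For $F$ a quotient of $G$, $[F,G]$ is the poset of isomorphism classes of quotients of $G$ that are $\ge F$. An object is minimal if it has only one quotient (itself). A set $\mathcal{S}$ of objects, stable under isomorphism (equivalently a set of isomorphism classes), is downward-closed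 if every quotient of an object of $\mathcal{S}$ is in $\mathcal{S}$; it is join-closed if whenever $H,F\in\mathcal{S}$ are quotients of some object $G$ and $H\vee F$ exists, $H\vee F\in\mathcal{S}$. A formation is a downward-closed join-closed set of isomorphism classes containing every minimal object. A level is a set of isomorphism classes generated by a finite set $B$ of isomorphism classes, i.e. the smallest downward-closed join-closed set containing $B$ and every minimal object. An epimorphism $G\to F$ is simple if it is not an isomorphism and $[F,G]$ contains only $F$ and $G$. A diamond category is a small category $C$ such that: (1) for each object $G$, the set of isomorphism classes of quotients of $G$ is a finite modular lattice; (2) each object has finite automorphism group; (3) for each level $\mathcal{L}$ and each $G\in\mathcal{L}$, there are finitely many elements of $\mathcal{L}$ with a simple epimorphism to $G$; (4) $C$ has at most countably many isomorphism classes of minimal objects. Moment notions. $\mathrm{Epi}(G,F)$ is the set of epimorphisms $G\to F$. Sums over objects are over isomorphism classes; a sum being finite includes the claim that only countably many terms are non-zero. For an epimorphism $\pi:G\to F$, $\mu(\pi)=\mu(F,G)$ is the M\"obius function of the poset of quotients of $G$, evaluated at the quotients $(F,\pi)$ and $G$; $\hat{\mu}(F,G)=\sum_{\pi\in\mathrm{Epi}(G,F)/\mathrm{Aut}(F)}\mu(\pi)$; and $Z(\pi)$ is the number of $H\in[F,G]$ with $H\vee(K_1\wedge K_2)=(H\vee K_1)\wedge(H\vee K_2)$ for all $K_1,K_2\in[F,G]$. A tuple $(M_G)_G$ of reals is well-behaved if for every level $\mathcal{L}$ and all $F\in\mathcal{L}$, $\sum_{G\in\mathcal{L}}\sum_{\pi\in\mathrm{Epi}(G,F)}\frac{|\mu(\pi)|}{|\mathrm{Aut}(G)|}Z(\pi)^3|M_G|<\infty$.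 Pro-isomorphism classes. For a level $\mathcal{L}$, $G^{\mathcal{L}}$ is the maximal quotient of $G$ that is in $\mathcal{L}$ (the join of all quotients of $G$ in $\mathcal{L}$). A pro-isomorphism class $X$ of $C$ is, for each level $\mathcal{L}$, an isomorphism class $X^{\mathcal{L}}\in\mathcal{L}$ such that whenever $\mathcal{L}\subset\mathcal{L}'$ we have $(X^{\mathcal{L}'})^{\mathcal{L}}\cong X^{\mathcal{L}}$. $\mathcal{P}$ is the set of pro-isomorphism classes, and $U_{\mathcal{L},F}=\{X\in\mathcal{P}\mid X^{\mathcal{L}}\cong F\}$ for a level $\mathcal{L}$ and $F\in\mathcal{L}$. $\mathcal{P}$ has the topology generated by the $U_{\mathcal{L},F}$, and measures on $\mathcal{P}$ are for the $\sigma$-algebra generated by all the $U_{\mathcal{L},F}$ (when $C$ has countably many isomorphism classes this is the Borel $\sigma$-algebra of the topology). For $X\in\mathcal{P}$ and $G\in C$, $|\mathrm{Epi}(X,G)|:=|\mathrm{Epi}(X^{\mathcal{L}},G)|$ for any level $\mathcal{L}$ containing $G$ (independent of $\mathcal{L}$). The $G$-moment of a measure $\nu$ on $\mathcal{P}$ is $\int_{X\in\mathcal{P}}|\mathrm{Epi}(X,G)|\,d\nu$.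
   Formalization: Weak convergence is tested on bounded continuous functions vanishing off a finite union of sets U_{L,F}, and on all of them if total masses converge to a finite ν(P); with infinitely many minimal objects the usual notion fails (discrete category on N, ν^t = δ_t, M = 0). *)

theory Defs
  imports "HOL-Algebra.Lattice" "HOL-Analysis.Analysis"
begin

section \<open>Finite posets\<close>

text \<open>The Moebius function by its usual recursion, with the junk value \<open>0\<close> unless \<open>L\<close> is a
  finite poset and \<open>x \<sqsubseteq> y\<close> are elements of it.\<close>

function mobius :: "('a, 'b) gorder_scheme \<Rightarrow> 'a \<Rightarrow> 'a \<Rightarrow> int" where
  "mobius L x y =
     (if partial_order L \<and> finite (carrier L) \<and> x \<in> carrier L \<and> y \<in> carrier L \<and> x \<sqsubseteq>\<^bsub>L\<^esub> y
      then if x = y then 1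
           else - (\<Sum>z \<in> {z \<in> carrier L. x \<sqsubseteq>\<^bsub>L\<^esub> z \<and> z \<sqsubseteq>\<^bsub>L\<^esub> y \<and> z \<noteq> y}. mobius L x z)
      else 0)"
  by pat_completeness auto
termination
proof (relation "Wellfounded.measure (\<lambda>(L, x, y). card {z \<in> carrier L. z \<sqsubseteq>\<^bsub>L\<^esub> y})", goal_cases)
  case 1
  show ?case by simp
next
  case (2 L x y z)
  then interpret partial_order L by simp
  have z: "z \<in> carrier L" "z \<sqsubseteq>\<^bsub>L\<^esub> y" "z \<noteq> y" and y: "y \<in> carrier L" and fin: "finite (carrier L)"
    using 2 by auto
  have "{u \<in> carrier L. u \<sqsubseteq>\<^bsub>L\<^esub> z} \<subset> {u \<in> carrier L. u \<sqsubseteq>\<^bsub>L\<^esub> y}"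
  proof
    show "{u \<in> carrier L. u \<sqsubseteq>\<^bsub>L\<^esub> z} \<subseteq> {u \<in> carrier L. u \<sqsubseteq>\<^bsub>L\<^esub> y}"
      using z y by (auto intro: le_trans)
    have "\<not> y \<sqsubseteq>\<^bsub>L\<^esub> z"
      using z y le_antisym by blast
    then show "{u \<in> carrier L. u \<sqsubseteq>\<^bsub>L\<^esub> z} \<noteq> {u \<in> carrier L. u \<sqsubseteq>\<^bsub>L\<^esub> y}"
      using y le_refl by blast
  qed
  then have "card {u \<in> carrier L. u \<sqsubseteq>\<^bsub>L\<^esub> z} < card {u \<in> carrier L. u \<sqsubseteq>\<^bsub>L\<^esub> y}"
    using fin by (intro psubset_card_mono) auto
  then show ?case by simp
qed

declare mobius.simps [simp del]

locale modular_lattice = lattice +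
  assumes modular: "\<lbrakk>a \<in> carrier L; b \<in> carrier L; x \<in> carrier L; a \<sqsubseteq> b\<rbrakk>
    \<Longrightarrow> a \<squnion> (x \<sqinter> b) = (a \<squnion> x) \<sqinter> b"


section \<open>Small categories\<close>

text \<open>\<open>Comp C g f\<close> is the composite of \<open>f\<close> followed by \<open>g\<close>.\<close>

record ('o, 'm) cat =
  Obj :: "'o set"
  Arr :: "'m set"
  Dom :: "'m \<Rightarrow> 'o"
  Cod :: "'m \<Rightarrow> 'o"
  Ident :: "'o \<Rightarrow> 'm"
  Comp :: "'m \<Rightarrow> 'm \<Rightarrow> 'm"

definition Hom :: "('o, 'm) cat \<Rightarrow> 'o \<Rightarrow> 'o \<Rightarrow> 'm set" where
  "Hom C A B = {f \<in> Arr C. Dom C f = A \<and> Cod C f = B}"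

locale category =
  fixes C :: "('o, 'm) cat"
  assumes Dom_in_Obj: "f \<in> Arr C \<Longrightarrow> Dom C f \<in> Obj C"
    and Cod_in_Obj: "f \<in> Arr C \<Longrightarrow> Cod C f \<in> Obj C"
    and Ident_in_Hom: "A \<in> Obj C \<Longrightarrow> Ident C A \<in> Hom C A A"
    and Comp_in_Hom: "\<lbrakk>f \<in> Hom C A B; g \<in> Hom C B D\<rbrakk> \<Longrightarrow> Comp C g f \<in> Hom C A D"
    and Comp_Ident_right: "f \<in> Hom C A B \<Longrightarrow> Comp C f (Ident C A) = f"
    and Comp_Ident_left: "f \<in> Hom C A B \<Longrightarrow> Comp C (Ident C B) f = f"
    and Comp_assoc: "\<lbrakk>f \<in> Hom C A B; g \<in> Hom C B D; h \<in> Hom C D E\<rbrakk>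
      \<Longrightarrow> Comp C h (Comp C g f) = Comp C (Comp C h g) f"

definition epi :: "('o, 'm) cat \<Rightarrow> 'm \<Rightarrow> bool" where
  "epi C f \<longleftrightarrow> f \<in> Arr C \<and>
     (\<forall>T \<in> Obj C. \<forall>g \<in> Hom C (Cod C f) T. \<forall>h \<in> Hom C (Cod C f) T.
        Comp C g f = Comp C h f \<longrightarrow> g = h)"

definition iso :: "('o, 'm) cat \<Rightarrow> 'm \<Rightarrow> bool" where
  "iso C f \<longleftrightarrow> f \<in> Arr C \<and>
     (\<exists>g \<in> Hom C (Cod C f) (Dom C f).
        Comp C g f = Ident C (Dom C f) \<and> Comp C f g = Ident C (Cod C f))"

definition Epi :: "('o, 'm) cat \<Rightarrow> 'o \<Rightarrow> 'o \<Rightarrow> 'm set" where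
  "Epi C G F = {f \<in> Hom C G F. epi C f}"

definition Aut :: "('o, 'm) cat \<Rightarrow> 'o \<Rightarrow> 'm set" where
  "Aut C F = {f \<in> Hom C F F. iso C f}"

definition iso_rel :: "('o, 'm) cat \<Rightarrow> 'o rel" where
  "iso_rel C = {(A, B). A \<in> Obj C \<and> B \<in> Obj C \<and> (\<exists>f \<in> Hom C A B. iso C f)}"

definition iso_class :: "('o, 'm) cat \<Rightarrow> 'o \<Rightarrow> 'o set" where
  "iso_class C A = iso_rel C `` {A}"

definition rep :: "'o set \<Rightarrow> 'o" where
  "rep c = (SOME A. A \<in> c)"


section \<open>Quotients\<close>

text \<open>A quotient \<open>(F, \<pi>)\<close> of \<open>G\<close> is given by its epimorphism \<open>\<pi>\<close>, since \<open>F = Cod C \<pi>\<close>.\<close>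

definition quots :: "('o, 'm) cat \<Rightarrow> 'o \<Rightarrow> 'm set" where
  "quots C G = {\<pi>. epi C \<pi> \<and> Dom C \<pi> = G}"

definition quot_iso :: "('o, 'm) cat \<Rightarrow> 'o \<Rightarrow> 'm rel" where
  "quot_iso C G = {(\<pi>, \<pi>'). \<pi> \<in> quots C G \<and> \<pi>' \<in> quots C G \<and>
     (\<exists>\<rho> \<in> Hom C (Cod C \<pi>) (Cod C \<pi>'). iso C \<rho> \<and> \<pi>' = Comp C \<rho> \<pi>)}"

definition qclass :: "('o, 'm) cat \<Rightarrow> 'm \<Rightarrow> 'm set" where
  "qclass C \<pi> = quot_iso C (Dom C \<pi>) `` {\<pi>}"

text \<open>The poset of isomorphism classes of quotients of \<open>G\<close>; its greatest element is the class of
  the identity of \<open>G\<close>.\<close>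

definition quot_poset :: "('o, 'm) cat \<Rightarrow> 'o \<Rightarrow> 'm set gorder" where
  "quot_poset C G =
     \<lparr>carrier = quots C G // quot_iso C G,
      eq = (=),
      le = (\<lambda>q q'. \<exists>\<pi> \<in> q. \<exists>\<pi>' \<in> q'. \<exists>h \<in> Hom C (Cod C \<pi>') (Cod C \<pi>). Comp C h \<pi>' = \<pi>)\<rparr>"

text \<open>The interval \<open>[F, G]\<close> for the quotient \<open>\<pi> : G \<rightarrow> F\<close>.\<close>

definition quot_interval :: "('o, 'm) cat \<Rightarrow> 'm \<Rightarrow> 'm set set" where
  "quot_interval C \<pi> =
     {q \<in> carrier (quot_poset C (Dom C \<pi>)). qclass C \<pi> \<sqsubseteq>\<^bsub>quot_poset C (Dom C \<pi>)\<^esub> q}"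

definition simple_epi :: "('o, 'm) cat \<Rightarrow> 'm \<Rightarrow> bool" where
  "simple_epi C \<pi> \<longleftrightarrow> epi C \<pi> \<and> \<not> iso C \<pi> \<and>
     quot_interval C \<pi> = {qclass C \<pi>, qclass C (Ident C (Dom C \<pi>))}"

definition minimal :: "('o, 'm) cat \<Rightarrow> 'o \<Rightarrow> bool" where
  "minimal C G \<longleftrightarrow> G \<in> Obj C \<and> carrier (quot_poset C G) = {qclass C (Ident C G)}"


section \<open>Formations and levels\<close>

text \<open>Sets of isomorphism classes of objects are represented by sets of objects stable under
  isomorphism; for such \<open>S\<close>, the isomorphism classes themselves form the set \<open>S // iso_rel C\<close>.\<close>

definition iso_stable :: "('o, 'm) cat \<Rightarrow> 'o set \<Rightarrow> bool" where
  "iso_stable C S \<longleftrightarrow> S \<subseteq> Obj C \<and> iso_rel C `` S \<subseteq> S"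

definition downward_closed :: "('o, 'm) cat \<Rightarrow> 'o set \<Rightarrow> bool" where
  "downward_closed C S \<longleftrightarrow> (\<forall>G \<in> S. \<forall>\<pi> \<in> quots C G. Cod C \<pi> \<in> S)"

definition join_closed :: "('o, 'm) cat \<Rightarrow> 'o set \<Rightarrow> bool" where
  "join_closed C S \<longleftrightarrow>
     (\<forall>G \<in> Obj C. \<forall>\<pi>\<^sub>1 \<in> quots C G. \<forall>\<pi>\<^sub>2 \<in> quots C G. \<forall>\<pi> \<in> quots C G.
        Cod C \<pi>\<^sub>1 \<in> S \<and> Cod C \<pi>\<^sub>2 \<in> S \<and>
        least (quot_poset C G) (qclass C \<pi>) (Upper (quot_poset C G) {qclass C \<pi>\<^sub>1, qclass C \<pi>\<^sub>2})
        \<longrightarrow> Cod C \<pi> \<in> S)"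

definition formation :: "('o, 'm) cat \<Rightarrow> 'o set \<Rightarrow> bool" where
  "formation C S \<longleftrightarrow> iso_stable C S \<and> downward_closed C S \<and> join_closed C S \<and>
     (\<forall>G. minimal C G \<longrightarrow> G \<in> S)"

definition gen_level :: "('o, 'm) cat \<Rightarrow> 'o set set \<Rightarrow> 'o set" where
  "gen_level C B = \<Inter>{S. formation C S \<and> \<Union>B \<subseteq> S}"

definition level :: "('o, 'm) cat \<Rightarrow> 'o set \<Rightarrow> bool" where
  "level C L \<longleftrightarrow> (\<exists>B. finite B \<and> B \<subseteq> Obj C // iso_rel C \<and> L = gen_level C B)"


section \<open>Diamond categories\<close>

locale diamond_category = category +
  assumes quot_modular_lattice: "G \<in> Obj C \<Longrightarrow> modular_lattice (quot_poset C G)"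
    and quot_finite: "G \<in> Obj C \<Longrightarrow> finite (carrier (quot_poset C G))"
    and Aut_finite: "G \<in> Obj C \<Longrightarrow> finite (Aut C G)"
    and simple_finite: "\<lbrakk>level C L; G \<in> L\<rbrakk>
      \<Longrightarrow> finite {c \<in> L // iso_rel C. \<exists>H \<in> c. \<exists>\<pi> \<in> Epi C H G. simple_epi C \<pi>}"
    and minimal_countable: "countable ({G. minimal C G} // iso_rel C)"


section \<open>Moebius functions and well-behaved tuples\<close>

definition mu :: "('o, 'm) cat \<Rightarrow> 'm \<Rightarrow> real" where
  "mu C \<pi> = of_int
     (mobius (quot_poset C (Dom C \<pi>)) (qclass C \<pi>) (qclass C (Ident C (Dom C \<pi>))))"

text \<open>The sum is over the orbits of \<open>Aut C F\<close>, acting on \<open>Epi C G F\<close> by postcomposition;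
  \<open>mu C\<close> is constant on each orbit, as an orbit lies in a single class of quotients.\<close>

definition mu_hat :: "('o, 'm) cat \<Rightarrow> 'o \<Rightarrow> 'o \<Rightarrow> real" where
  "mu_hat C F G =
     (\<Sum>orb \<in> (\<lambda>\<pi>. (\<lambda>\<rho>. Comp C \<rho> \<pi>) ` Aut C F) ` Epi C G F. mu C (SOME \<pi>. \<pi> \<in> orb))"

definition Z_num :: "('o, 'm) cat \<Rightarrow> 'm \<Rightarrow> nat" where
  "Z_num C \<pi> = (let Q = quot_poset C (Dom C \<pi>) in
     card {H \<in> quot_interval C \<pi>. \<forall>K\<^sub>1 \<in> quot_interval C \<pi>. \<forall>K\<^sub>2 \<in> quot_interval C \<pi>.
       H \<squnion>\<^bsub>Q\<^esub> (K\<^sub>1 \<sqinter>\<^bsub>Q\<^esub> K\<^sub>2) = (H \<squnion>\<^bsub>Q\<^esub> K\<^sub>1) \<sqinter>\<^bsub>Q\<^esub> (H \<squnion>\<^bsub>Q\<^esub> K\<^sub>2)})"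

text \<open>Tuples of reals indexed by isomorphism classes are functions \<open>M\<close> on \<open>Obj C // iso_rel C\<close>.
  The inner sum is finite in a diamond category, and the terms of the outer one are nonnegative.\<close>

definition well_behaved :: "('o, 'm) cat \<Rightarrow> ('o set \<Rightarrow> real) \<Rightarrow> bool" where
  "well_behaved C M \<longleftrightarrow>
     (\<forall>L F. level C L \<and> F \<in> L \<longrightarrow>
        (\<lambda>c. \<Sum>\<pi> \<in> Epi C (rep c) F.
           \<bar>mu C \<pi>\<bar> / real (card (Aut C (rep c))) * real (Z_num C \<pi>) ^ 3 * \<bar>M c\<bar>)
        summable_on (L // iso_rel C))"


section \<open>Pro-isomorphism classes\<close>

text \<open>The isomorphism class of \<open>G\<^sup>L\<close>. The members of a class of quotients of \<open>G\<close> are the composites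
  of one of them with all the isomorphisms out of its codomain, so their codomains form a full
  isomorphism class of objects.\<close>

definition level_quot :: "('o, 'm) cat \<Rightarrow> 'o set \<Rightarrow> 'o \<Rightarrow> 'o set" where
  "level_quot C L G =
     Cod C ` (\<Squnion>\<^bsub>quot_poset C G\<^esub> {q \<in> carrier (quot_poset C G). Cod C ` q \<subseteq> L})"

definition pro_classes :: "('o, 'm) cat \<Rightarrow> ('o set \<Rightarrow> 'o set) set" where
  "pro_classes C =
     {X \<in> Pi\<^sub>E {L. level C L} (\<lambda>L. L // iso_rel C).
        \<forall>L L'. level C L \<and> level C L' \<and> L \<subseteq> L' \<longrightarrow> level_quot C L (rep (X L')) = X L}"

definition pro_nbhd :: "('o, 'm) cat \<Rightarrow> 'o set \<Rightarrow> 'o \<Rightarrow> ('o set \<Rightarrow> 'o set) set" where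
  "pro_nbhd C L F = {X \<in> pro_classes C. X L = iso_class C F}"

definition pro_nbhds :: "('o, 'm) cat \<Rightarrow> ('o set \<Rightarrow> 'o set) set set" where
  "pro_nbhds C = {pro_nbhd C L F | L F. level C L \<and> F \<in> L}"

definition pro_topology :: "('o, 'm) cat \<Rightarrow> ('o set \<Rightarrow> 'o set) topology" where
  "pro_topology C = topology_generated_by (pro_nbhds C)"

definition pro_measure :: "('o, 'm) cat \<Rightarrow> ('o set \<Rightarrow> 'o set) measure \<Rightarrow> bool" where
  "pro_measure C \<nu> \<longleftrightarrow> space \<nu> = pro_classes C \<and> sets \<nu> = sigma_sets (pro_classes C) (pro_nbhds C)"

text \<open>\<open>|Epi(X, G)|\<close>, computed at the smallest level containing \<open>G\<close>; any other level containing \<open>G\<close>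
  gives the same number.\<close>

definition pro_epi_count :: "('o, 'm) cat \<Rightarrow> ('o set \<Rightarrow> 'o set) \<Rightarrow> 'o \<Rightarrow> nat" where
  "pro_epi_count C X G = card (Epi C (rep (X (gen_level C {iso_class C G}))) G)"

definition moment :: "('o, 'm) cat \<Rightarrow> ('o set \<Rightarrow> 'o set) measure \<Rightarrow> 'o \<Rightarrow> ennreal" where
  "moment C \<nu> G = (\<integral>\<^sup>+ X. of_nat (pro_epi_count C X G) \<partial>\<nu>)"


section \<open>Weak convergence\<close>

text \<open>\<open>\<nu> t\<close> eventually integrates \<open>f\<close>, so that no Bochner integral below is a junk value.\<close>

definition integrals_converge ::
  "(nat \<Rightarrow> 'a measure) \<Rightarrow> 'a measure \<Rightarrow> ('a \<Rightarrow> real) \<Rightarrow> bool" where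
  "integrals_converge \<nu> \<nu>' f \<longleftrightarrow>
     integrable \<nu>' f \<and> (\<forall>\<^sub>F t in sequentially. integrable (\<nu> t) f) \<and>
     (\<lambda>t. integral\<^sup>L (\<nu> t) f) \<longlonglongrightarrow> integral\<^sup>L \<nu>' f"

text \<open>Measures with finite moments can have infinite total mass when there are infinitely many
  minimal objects, and then mass can also escape along these: in the discrete category on the
  natural numbers the space is the set of natural numbers, \<open>M\<^sub>n\<close> is the mass of \<open>n\<close>, and the point
  masses at \<open>t\<close> have moments converging to those of the zero measure. So bounded continuous test
  functions are required to vanish off a finite union of basic open sets, unless the total masses
  converge to a finite limit. With finitely many minimal objects up to isomorphism the whole space
  is such a union, and this is convergence against all bounded continuous functions.\<close>

definition weakly_converges ::
  "('o, 'm) cat \<Rightarrow> (nat \<Rightarrow> ('o set \<Rightarrow> 'o set) measure) \<Rightarrow> ('o set \<Rightarrow> 'o set) measure \<Rightarrow> bool" where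
  "weakly_converges C \<nu> \<nu>' \<longleftrightarrow>
     (\<forall>f. continuous_map (pro_topology C) euclideanreal f \<and> bounded (f ` pro_classes C) \<and>
        ((\<exists>A. finite A \<and> A \<subseteq> pro_nbhds C \<and> (\<forall>X \<in> pro_classes C - \<Union>A. f X = 0)) \<or>
         (emeasure \<nu>' (pro_classes C) < \<infinity> \<and>
          (\<lambda>t. emeasure (\<nu> t) (pro_classes C)) \<longlonglongrightarrow> emeasure \<nu>' (pro_classes C)))
        \<longrightarrow> integrals_converge \<nu> \<nu>' f)"

end

theory Submission
  imports Defs
begin

text \<open>For a level \<open>L\<close>, the \<open>G\<close>-moment divided by \<open>|Aut G|\<close> is the sum over \<open>c \<in> L\<close> of the mass of
  \<open>{X. X L = c}\<close> times the number of quotients of \<open>c\<close> of type \<open>G\<close>. The key point is that these sums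
  are tight as \<open>t \<rightarrow> \<infinity>\<close>. If the interval \<open>[G, H]\<close> is atomistic and \<open>H\<close> lies outside a finite set \<open>S\<close>
  of types, then \<open>H\<close> has a quotient over \<open>G\<close>, again atomistic, which is a simple extension outside
  \<open>S\<close> of a member of \<open>S\<close>. There are finitely many types of these, and the expected number of such
  quotients is a finite sum of moments, whose limit is part of the tail of a convergent series: by
  Weisner's theorem \<open>|\<mu>| \<ge> 1\<close> on atomistic intervals, so the moments are summable over them.
  Chains of at most \<open>n\<close> atomistic steps are treated by induction on \<open>n\<close>, and the objects of depth
  at most \<open>n\<close> form a formation, so that every level has bounded depth.

  Tightness allows the limit to be taken in Moebius inversion, so the masses converge to the
  stated sums, no mass is lost between levels, and the moments of the limit masses are the given
  ones. The limit masses are realised by Lebesgue measure on nested partitions of a subset of the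
  line into half-open intervals. Uniqueness is the convergence statement for a constant sequence.\<close>

section \<open>Modular lattices of finite length\<close>

text \<open>Summability is assumed for the limit moments only, and no bound uniform in
  \<open>t\<close> is at hand, so inversion cannot be passed to the limit by dominated convergence.
  What converges is each single moment, hence any tail has to be bounded by finitely many moments.
  This is the role of the boundary of a finite set of types: leaving the set is witnessed by a type
  from a finite list disjoint from it.

  The weights in the assumed series are |\<mu>|, which can vanish on a general interval, and then
  the series for the lower end says nothing about the upper end. Hence the cutting into atomistic
  steps, each charged to the series of its own lower end.

  Bounded depth has to survive both joins and passage to quotients. Joins are visible on atoms,
  passage to quotients on complements; in a finite modular lattice the two descriptions agree.

  Levels may be infinite, so the space of pro-isomorphism classes need not be compact, and
  compatible masses of cylinders are not countably additive for a topological reason. Transport from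
  Lebesgue measure supplies countable additivity.\<close>

definition covers :: "('a, 'b) gorder_scheme \<Rightarrow> 'a \<Rightarrow> 'a \<Rightarrow> bool" where
  "covers L x y \<longleftrightarrow> x \<in> carrier L \<and> y \<in> carrier L \<and> x \<sqsubseteq>\<^bsub>L\<^esub> y \<and> x \<noteq> y \<and>
     (\<forall>z \<in> carrier L. x \<sqsubseteq>\<^bsub>L\<^esub> z \<and> z \<sqsubseteq>\<^bsub>L\<^esub> y \<longrightarrow> z = x \<or> z = y)"

text \<open>The interval's top is the join of its atoms, phrased without joins: \<open>y\<close> is
  the only upper bound of the atoms inside the interval. In this form the notion makes sense in any
  partial order and transfers along order embeddings. A one-point interval counts as
  atomistic.\<close>

definition atomistic :: "('a, 'b) gorder_scheme \<Rightarrow> 'a \<Rightarrow> 'a \<Rightarrow> bool" where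
  "atomistic L x y \<longleftrightarrow> x \<in> carrier L \<and> y \<in> carrier L \<and> x \<sqsubseteq>\<^bsub>L\<^esub> y \<and>
     (\<forall>s \<in> carrier L. x \<sqsubseteq>\<^bsub>L\<^esub> s \<and> s \<sqsubseteq>\<^bsub>L\<^esub> y \<and> (\<forall>a. covers L x a \<and> a \<sqsubseteq>\<^bsub>L\<^esub> y \<longrightarrow> a \<sqsubseteq>\<^bsub>L\<^esub> s) \<longrightarrow> s = y)"

text \<open>The complement \<open>c\<close> lies in the interval by itself, as its meet and join
  with \<open>w\<close> are the two ends. The notion serves to cut an atomistic interval down by a
  meet: the atoms change, but complements can be intersected.\<close>

definition complemented :: "('a, 'b) gorder_scheme \<Rightarrow> 'a \<Rightarrow> 'a \<Rightarrow> bool" where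
  "complemented L x y \<longleftrightarrow> x \<in> carrier L \<and> y \<in> carrier L \<and> x \<sqsubseteq>\<^bsub>L\<^esub> y \<and>
     (\<forall>w \<in> carrier L. x \<sqsubseteq>\<^bsub>L\<^esub> w \<and> w \<sqsubseteq>\<^bsub>L\<^esub> y \<longrightarrow>
        (\<exists>c \<in> carrier L. c \<sqinter>\<^bsub>L\<^esub> w = x \<and> c \<squnion>\<^bsub>L\<^esub> w = y))"

text \<open>Atomistic steps may be trivial, so \<open>n\<close> bounds the length of the chain
  rather than fixing it.\<close>

fun depth_le :: "('a, 'b) gorder_scheme \<Rightarrow> nat \<Rightarrow> 'a \<Rightarrow> 'a \<Rightarrow> bool" where
  "depth_le L 0 x y \<longleftrightarrow> x \<in> carrier L \<and> x = y"
| "depth_le L (Suc n) x y \<longleftrightarrow> (\<exists>z. atomistic L x z \<and> depth_le L n z y)"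

lemma covers_dual: "covers (inv_gorder L) x y \<longleftrightarrow> covers L y x"
  by (auto simp: covers_def)

lemma (in partial_order) card_below_less:
  assumes fin: "finite (carrier L)" and c: "z \<in> carrier L" "y \<in> carrier L" "z \<sqsubseteq> y" "z \<noteq> y"
  shows "card {u \<in> carrier L. u \<sqsubseteq> z} < card {u \<in> carrier L. u \<sqsubseteq> y}"
proof (rule psubset_card_mono)
  have "y \<notin> {u \<in> carrier L. u \<sqsubseteq> z}" using c le_antisym by blast
  then show "{u \<in> carrier L. u \<sqsubseteq> z} \<subset> {u \<in> carrier L. u \<sqsubseteq> y}"
    using c by (auto intro: le_trans)
qed (use fin in auto)

context lattice
begin

declare le_antisym [rule del] weak_le_antisym [rule del] le_cong_l [rule del] le_cong_r [rule del]

lemma join_le_iff: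
  "\<lbrakk>x \<in> carrier L; y \<in> carrier L; z \<in> carrier L\<rbrakk> \<Longrightarrow> x \<squnion> y \<sqsubseteq> z \<longleftrightarrow> x \<sqsubseteq> z \<and> y \<sqsubseteq> z"
  by (meson join_closed join_le join_left join_right le_trans)

lemma le_meet_iff:
  "\<lbrakk>x \<in> carrier L; y \<in> carrier L; z \<in> carrier L\<rbrakk> \<Longrightarrow> z \<sqsubseteq> x \<sqinter> y \<longleftrightarrow> z \<sqsubseteq> x \<and> z \<sqsubseteq> y"
  by (meson meet_closed meet_le meet_left meet_right le_trans)

lemma meet_mono:
  assumes "x \<sqsubseteq> x'" "y \<sqsubseteq> y'"
    and c: "x \<in> carrier L" "x' \<in> carrier L" "y \<in> carrier L" "y' \<in> carrier L"
  shows "x \<sqinter> y \<sqsubseteq> x' \<sqinter> y'"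
proof -
  have m: "x \<sqinter> y \<in> carrier L" "x \<sqinter> y \<sqsubseteq> x" "x \<sqinter> y \<sqsubseteq> y"
    using c by (auto intro: meet_left meet_right)
  have "x \<sqinter> y \<sqsubseteq> x'" "x \<sqinter> y \<sqsubseteq> y'"
    using le_trans[OF m(2) assms(1)] le_trans[OF m(3) assms(2)] m c by auto
  then show ?thesis using c m by (simp add: le_meet_iff)
qed

lemma join_mono:
  assumes "x \<sqsubseteq> x'" "y \<sqsubseteq> y'"
    and c: "x \<in> carrier L" "x' \<in> carrier L" "y \<in> carrier L" "y' \<in> carrier L"
  shows "x \<squnion> y \<sqsubseteq> x' \<squnion> y'"
proof -
  have m: "x' \<squnion> y' \<in> carrier L" "x' \<sqsubseteq> x' \<squnion> y'" "y' \<sqsubseteq> x' \<squnion> y'"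
    using c by (auto intro: join_left join_right)
  have "x \<sqsubseteq> x' \<squnion> y'" "y \<sqsubseteq> x' \<squnion> y'"
    using le_trans[OF assms(1) m(2)] le_trans[OF assms(2) m(3)] m c by auto
  then show ?thesis using c m by (simp add: join_le_iff)
qed

lemma join_absorb: "\<lbrakk>x \<in> carrier L; y \<in> carrier L; x \<sqsubseteq> y\<rbrakk> \<Longrightarrow> x \<squnion> y = y \<and> y \<squnion> x = y"
  by (metis join_comm le_iff_meet)

lemma meet_absorb: "\<lbrakk>x \<in> carrier L; y \<in> carrier L; x \<sqsubseteq> y\<rbrakk> \<Longrightarrow> x \<sqinter> y = x \<and> y \<sqinter> x = x"
  by (metis meet_comm le_iff_join)

lemma joins_assoc:
  "\<lbrakk>x \<in> carrier L; y \<in> carrier L; z \<in> carrier L\<rbrakk> \<Longrightarrow> (x \<squnion> y) \<squnion> z = x \<squnion> (y \<squnion> z)"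
  using weak_join_assoc eq_is_equal by simp

lemma exists_minimal:
  assumes "finite A" "A \<noteq> {}" "A \<subseteq> carrier L"
  shows "\<exists>x \<in> A. \<forall>y \<in> A. y \<sqsubseteq> x \<longrightarrow> y = x"
  using assms
proof (induction A rule: finite_ne_induct)
  case (singleton x)
  then show ?case by auto
next
  case (insert b A)
  then obtain x where x: "x \<in> A" "\<forall>y \<in> A. y \<sqsubseteq> x \<longrightarrow> y = x" by auto
  show ?case
  proof (cases "b \<sqsubseteq> x")
    case True
    have c: "b \<in> carrier L" "x \<in> carrier L" "A \<subseteq> carrier L" using insert.prems x by auto
    have "y = b" if y: "y \<in> A" "y \<sqsubseteq> b" for y
    proof -
      have yc: "y \<in> carrier L" using c y by auto
      have "y \<sqsubseteq> x" using le_trans[OF y(2) True yc c(1,2)] .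
      then have "y = x" using x y by blast
      then show "y = b" using True y(2) c by (intro le_antisym) auto
    qed
    then have "\<forall>y \<in> insert b A. y \<sqsubseteq> b \<longrightarrow> y = b" by auto
    then show ?thesis by blast
  next
    case False
    then show ?thesis using x by auto
  qed
qed

lemma exists_maximal:
  "\<lbrakk>finite A; A \<noteq> {}; A \<subseteq> carrier L\<rbrakk> \<Longrightarrow> \<exists>x \<in> A. \<forall>y \<in> A. x \<sqsubseteq> y \<longrightarrow> y = x"
  using lattice.exists_minimal[OF dual_lattice, of A] by simp

lemma exists_cover_above:
  assumes fin: "finite (carrier L)" and xy: "x \<in> carrier L" "y \<in> carrier L" "x \<sqsubseteq> y" "x \<noteq> y"
  shows "\<exists>a. covers L x a \<and> a \<sqsubseteq> y"
proof -
  let ?A = "{a \<in> carrier L. x \<sqsubseteq> a \<and> a \<sqsubseteq> y \<and> a \<noteq> x}"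
  have "finite ?A" "?A \<noteq> {}" "?A \<subseteq> carrier L" using fin xy by auto
  then obtain a where a: "a \<in> ?A" "\<forall>z \<in> ?A. z \<sqsubseteq> a \<longrightarrow> z = a"
    using exists_minimal by meson
  have "covers L x a"
    unfolding covers_def using a xy le_trans by blast
  then show ?thesis using a by blast
qed

lemma exists_cover_below:
  assumes "finite (carrier L)" "x \<in> carrier L" "y \<in> carrier L" "x \<sqsubseteq> y" "x \<noteq> y"
  shows "\<exists>a. covers L a y \<and> x \<sqsubseteq> a"
  using lattice.exists_cover_above[OF dual_lattice, of y x] assms by (simp add: covers_dual)

lemma atomistic_refl: "x \<in> carrier L \<Longrightarrow> atomistic L x x"
  unfolding atomistic_def using le_antisym by blast

lemma covers_atomistic: "covers L x y \<Longrightarrow> atomistic L x y"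
  unfolding atomistic_def covers_def using le_antisym le_refl by metis

text \<open>Here \<open>s\<close> need not lie below \<open>y\<close>: the definition is applied to
  \<open>s \<sqinter> y\<close>.\<close>

lemma atomistic_le:
  assumes "atomistic L x y" "s \<in> carrier L" "x \<sqsubseteq> s" "\<And>a. \<lbrakk>covers L x a; a \<sqsubseteq> y\<rbrakk> \<Longrightarrow> a \<sqsubseteq> s"
  shows "y \<sqsubseteq> s"
proof -
  have c: "x \<in> carrier L" "y \<in> carrier L" "x \<sqsubseteq> y" using assms(1) by (auto simp: atomistic_def)
  have sy: "s \<sqinter> y \<in> carrier L" "x \<sqsubseteq> s \<sqinter> y" "s \<sqinter> y \<sqsubseteq> y"
    using assms(2,3) c by (auto simp: le_meet_iff intro: meet_right)
  have "a \<sqsubseteq> s \<sqinter> y" if "covers L x a" "a \<sqsubseteq> y" for a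
    using assms(2) assms(4)[OF that] that c by (auto simp: le_meet_iff covers_def)
  then have "s \<sqinter> y = y"
    using assms(1) sy unfolding atomistic_def by blast
  then show ?thesis using c assms(2) by (metis meet_left)
qed

lemma depth_le_refl: "x \<in> carrier L \<Longrightarrow> depth_le L n x x"
  by (induction n) (auto intro: atomistic_refl)

lemma depth_le_mono: "\<lbrakk>depth_le L n x y; n \<le> m\<rbrakk> \<Longrightarrow> depth_le L m x y"
proof (induction n arbitrary: x m)
  case 0
  then show ?case by (auto intro: depth_le_refl)
next
  case (Suc n)
  then obtain z where z: "atomistic L x z" "depth_le L n z y" by auto
  obtain k where "m = Suc k" "n \<le> k" using Suc.prems by (cases m) auto
  then show ?case using z Suc.IH by auto
qed

text \<open>Any maximal chain serves, a cover being an interval with a single atom.\<close>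

lemma exists_depth:
  assumes fin: "finite (carrier L)" and x: "x \<in> carrier L" and y: "y \<in> carrier L" and xy: "x \<sqsubseteq> y"
  shows "\<exists>n. depth_le L n x y"
  using x xy
proof (induction "card {z \<in> carrier L. x \<sqsubseteq> z}" arbitrary: x rule: less_induct)
  case less
  show ?case
  proof (cases "x = y")
    case True
    then show ?thesis using depth_le_refl y by blast
  next
    case False
    then obtain a where a: "covers L x a" "a \<sqsubseteq> y"
      using exists_cover_above[OF fin less.prems(1) y less.prems(2)] by blast
    then have ac: "a \<in> carrier L" "x \<sqsubseteq> a" "x \<noteq> a" by (auto simp: covers_def)
    have "{z \<in> carrier L. a \<sqsubseteq> z} \<subseteq> {z \<in> carrier L. x \<sqsubseteq> z}"
      using ac less.prems by (auto intro: le_trans)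
    moreover have "x \<notin> {z \<in> carrier L. a \<sqsubseteq> z}" "x \<in> {z \<in> carrier L. x \<sqsubseteq> z}"
      using ac less.prems le_antisym by blast+
    ultimately have "card {z \<in> carrier L. a \<sqsubseteq> z} < card {z \<in> carrier L. x \<sqsubseteq> z}"
      using fin by (intro psubset_card_mono) auto
    then obtain n where "depth_le L n a y" using less.hyps[of a] ac a by blast
    then show ?thesis using covers_atomistic[OF a(1)] by (meson depth_le.simps(2))
  qed
qed

end

context modular_lattice
begin

text \<open>The diamond isomorphism for an atom: modularity recovers every \<open>z\<close> between
  \<open>y\<close> and \<open>a \<squnion> y\<close> as
  \<open>y \<squnion> (a \<sqinter> z)\<close>, and \<open>a \<sqinter> z\<close> has only two
  possible values.\<close>

lemma covers_join:
  assumes "covers L x a" and y: "y \<in> carrier L" "x \<sqsubseteq> y" and nle: "\<not> a \<sqsubseteq> y"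
  shows "covers L y (a \<squnion> y)" "a \<sqinter> y = x"
proof -
  have c: "x \<in> carrier L" "a \<in> carrier L" "x \<sqsubseteq> a" "x \<noteq> a"
    and cov: "\<And>z. \<lbrakk>z \<in> carrier L; x \<sqsubseteq> z; z \<sqsubseteq> a\<rbrakk> \<Longrightarrow> z = x \<or> z = a"
    using assms(1) by (auto simp: covers_def)
  show m: "a \<sqinter> y = x"
    using cov[of "a \<sqinter> y"] c y nle by (metis le_meet_iff meet_closed meet_left meet_right)
  show "covers L y (a \<squnion> y)"
    unfolding covers_def
  proof (intro conjI ballI impI)
    show "y \<noteq> a \<squnion> y" using nle c y by (metis join_left)
    fix z assume z: "z \<in> carrier L" "y \<sqsubseteq> z \<and> z \<sqsubseteq> a \<squnion> y"
    have eq: "y \<squnion> (a \<sqinter> z) = z"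
      using modular[of y z a] z c y by (metis join_comm meet_absorb join_closed)
    have "a \<sqinter> z = x \<or> a \<sqinter> z = a"
      using cov[of "a \<sqinter> z"] c y z by (metis le_meet_iff le_trans meet_closed meet_left)
    then show "z = y \<or> z = a \<squnion> y"
      using eq c y by (metis join_absorb join_comm)
  qed (use c y in \<open>auto intro: join_right\<close>)
qed

text \<open>A complement of \<open>w\<close> is found as a maximal \<open>d\<close> with
  \<open>d \<sqinter> w = x\<close>. An atom not below \<open>d \<squnion> w\<close> could be joined
  to \<open>d\<close> without changing the meet with \<open>w\<close>, so
  \<open>d \<squnion> w\<close> is above every atom.\<close>

lemma atomistic_imp_complemented:
  assumes at: "atomistic L x y" and fin: "finite (carrier L)"
  shows "complemented L x y"
  unfolding complemented_def
proof (intro conjI ballI impI)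
  show c: "x \<in> carrier L" "y \<in> carrier L" "x \<sqsubseteq> y"
    using at by (auto simp: atomistic_def)
  fix w assume w: "w \<in> carrier L" "x \<sqsubseteq> w \<and> w \<sqsubseteq> y"
  let ?A = "{c \<in> carrier L. x \<sqsubseteq> c \<and> c \<sqsubseteq> y \<and> c \<sqinter> w = x}"
  have "x \<in> ?A" using c w meet_absorb by auto
  then obtain d where d: "d \<in> ?A" "\<forall>z \<in> ?A. d \<sqsubseteq> z \<longrightarrow> z = d"
    using exists_maximal[of ?A] fin by auto
  have dc: "d \<in> carrier L" "x \<sqsubseteq> d" "d \<sqsubseteq> y" "d \<sqinter> w = x" using d by auto
  have "y \<sqsubseteq> d \<squnion> w"
  proof (rule atomistic_le[OF at])
    show "d \<squnion> w \<in> carrier L" "x \<sqsubseteq> d \<squnion> w"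
      using dc w c by (auto intro: le_trans[OF _ join_left])
    fix a assume a: "covers L x a" "a \<sqsubseteq> y"
    show "a \<sqsubseteq> d \<squnion> w"
    proof (rule ccontr)
      assume n: "\<not> a \<sqsubseteq> d \<squnion> w"
      have ac: "a \<in> carrier L" "x \<sqsubseteq> a" using a by (auto simp: covers_def)
      \<comment> \<open>As \<open>a\<close> is an atom outside \<open>d \<squnion> w\<close>,
        modularity gives \<open>d\<close> for the meet of \<open>d \<squnion> a\<close> with
        \<open>d \<squnion> w\<close>. What lies below both \<open>d \<squnion> a\<close> and
        \<open>w\<close> is therefore below \<open>d\<close> and \<open>w\<close>, hence below
        \<open>x\<close>.\<close>
      have m: "a \<sqinter> (d \<squnion> w) = x"
        using covers_join(2)[OF a(1) _ _ n] \<open>x \<sqsubseteq> d \<squnion> w\<close> dc w by auto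
      have e: "(d \<squnion> a) \<sqinter> (d \<squnion> w) = d"
        using modular[of d "d \<squnion> w" a] m dc w ac c by (metis join_absorb join_closed join_left)
      have "(d \<squnion> a) \<sqinter> w \<sqsubseteq> d"
      proof -
        have "(d \<squnion> a) \<sqinter> w \<sqsubseteq> (d \<squnion> a) \<sqinter> (d \<squnion> w)"
          using dc ac w by (intro meet_mono join_right) auto
        then show ?thesis using e by simp
      qed
      then have "(d \<squnion> a) \<sqinter> w \<sqsubseteq> x"
        using le_meet_iff[of d w "(d \<squnion> a) \<sqinter> w"] dc ac w by (simp add: meet_right)
      moreover have "x \<sqsubseteq> (d \<squnion> a) \<sqinter> w"
        using meet_mono[of d "d \<squnion> a" w w] dc ac w c by (simp add: join_left)
      ultimately have "(d \<squnion> a) \<sqinter> w = x"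
        using c dc ac w by (simp add: le_antisym)
      then have "d \<squnion> a \<in> ?A"
        using dc ac a c by (auto simp: join_le_iff intro: le_trans[OF _ join_left])
      then have "d \<squnion> a = d" using d(2) dc ac join_left by blast
      then have "a \<sqsubseteq> d" using dc ac by (metis join_right)
      then have "a \<sqsubseteq> d \<squnion> w" using dc ac w by (meson join_closed join_left le_trans)
      then show False using n by simp
    qed
  qed
  moreover have "d \<squnion> w \<sqsubseteq> y" using dc w c by (simp add: join_le_iff)
  ultimately have "d \<squnion> w = y" using dc w c by (simp add: le_antisym)
  then show "\<exists>c \<in> carrier L. c \<sqinter> w = x \<and> c \<squnion> w = y"
    using dc by (intro bexI[of _ d] conjI)
qed

text \<open>A complement of an upper bound \<open>s\<close> of the atoms must be \<open>x\<close>: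
  an atom below it would be below \<open>s\<close> as well, hence below their meet
  \<open>x\<close>.\<close>

lemma complemented_imp_atomistic:
  assumes co: "complemented L x y" and fin: "finite (carrier L)"
  shows "atomistic L x y"
  unfolding atomistic_def
proof (intro conjI ballI impI)
  show c: "x \<in> carrier L" "y \<in> carrier L" "x \<sqsubseteq> y"
    using co by (auto simp: complemented_def)
  fix s assume s: "s \<in> carrier L" "x \<sqsubseteq> s \<and> s \<sqsubseteq> y \<and> (\<forall>a. covers L x a \<and> a \<sqsubseteq> y \<longrightarrow> a \<sqsubseteq> s)"
  then obtain d where d: "d \<in> carrier L" "d \<sqinter> s = x" "d \<squnion> s = y"
    using co by (auto simp: complemented_def)
  have xd: "x \<sqsubseteq> d" "d \<sqsubseteq> y" using d s by (metis meet_left, metis join_left)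
  have "x = d"
  proof (rule ccontr)
    assume "x \<noteq> d"
    then obtain a where a: "covers L x a" "a \<sqsubseteq> d"
      using exists_cover_above[OF fin c(1) d(1) xd(1)] by auto
    then have ac: "a \<in> carrier L" "x \<sqsubseteq> a" "x \<noteq> a" by (auto simp: covers_def)
    have "a \<sqsubseteq> s" using s a ac xd c d by (meson le_trans)
    then have "a \<sqsubseteq> x" using a ac d s by (metis le_meet_iff)
    then show False using ac c le_antisym by blast
  qed
  then show "s = y" using d s join_absorb by auto
qed

lemma atomistic_iff_complemented:
  "finite (carrier L) \<Longrightarrow> atomistic L x y \<longleftrightarrow> complemented L x y"
  using atomistic_imp_complemented complemented_imp_atomistic by blast

text \<open>For \<open>w\<close> in the smaller interval, a complement \<open>d\<close> of
  \<open>x \<squnion> w\<close> in the larger one yields the complement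
  \<open>d \<sqinter> z\<close>; since \<open>w \<sqsubseteq> z\<close>, the modular law moves
  \<open>z\<close> out of the join with \<open>w\<close>.\<close>

lemma complemented_meet:
  assumes "complemented L x y" and z: "z \<in> carrier L"
  shows "complemented L (x \<sqinter> z) (y \<sqinter> z)"
  unfolding complemented_def
proof (intro conjI ballI impI)
  have c: "x \<in> carrier L" "y \<in> carrier L" "x \<sqsubseteq> y"
    using assms by (auto simp: complemented_def)
  show "x \<sqinter> z \<in> carrier L" "y \<sqinter> z \<in> carrier L" using c z by auto
  show "x \<sqinter> z \<sqsubseteq> y \<sqinter> z"
    using c z by (intro meet_mono) auto
  fix w assume w: "w \<in> carrier L" "x \<sqinter> z \<sqsubseteq> w \<and> w \<sqsubseteq> y \<sqinter> z"
  have wz: "w \<sqsubseteq> y" "w \<sqsubseteq> z" using w c z by (auto simp: le_meet_iff)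
  have "x \<squnion> w \<in> carrier L" "x \<sqsubseteq> x \<squnion> w \<and> x \<squnion> w \<sqsubseteq> y"
    using c w wz by (auto simp: join_le_iff intro: join_left)
  then obtain d where d: "d \<in> carrier L" "d \<sqinter> (x \<squnion> w) = x" "d \<squnion> (x \<squnion> w) = y"
    using assms by (auto simp: complemented_def)
  have xd: "x \<sqsubseteq> d" using d c w by (metis join_closed meet_left)
  have dw: "d \<squnion> w = y"
    using d c w xd join_absorb[of x d] joins_assoc[of d x w] by simp
  have "(d \<sqinter> z) \<sqinter> w = x \<sqinter> z"
  proof (rule le_antisym)
    have "(d \<sqinter> z) \<sqinter> w \<sqsubseteq> d \<sqinter> (x \<squnion> w)"
      using d z w c by (intro meet_mono join_right meet_left) auto
    moreover have "(d \<sqinter> z) \<sqinter> w \<sqsubseteq> z"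
      using le_trans[OF meet_left[of "d \<sqinter> z" w] meet_right[of d z]] d z w by auto
    ultimately show "(d \<sqinter> z) \<sqinter> w \<sqsubseteq> x \<sqinter> z"
      using d z w c by (simp add: le_meet_iff)
    have "x \<sqinter> z \<sqsubseteq> d \<sqinter> z" using d z c xd by (intro meet_mono) auto
    then show "x \<sqinter> z \<sqsubseteq> (d \<sqinter> z) \<sqinter> w"
      using d z w c by (simp add: le_meet_iff)
  qed (use d z w c in auto)
  moreover have "(d \<sqinter> z) \<squnion> w = y \<sqinter> z"
    using modular[of w z d] d z w wz dw by (metis join_comm meet_closed)
  ultimately show "\<exists>c \<in> carrier L. c \<sqinter> w = x \<sqinter> z \<and> c \<squnion> w = y \<sqinter> z"
    using d z by (meson meet_closed)
qed

lemma atomistic_meet: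
  "\<lbrakk>finite (carrier L); atomistic L x y; z \<in> carrier L\<rbrakk> \<Longrightarrow> atomistic L (x \<sqinter> z) (y \<sqinter> z)"
  using complemented_meet atomistic_iff_complemented by blast

lemma atomistic_lower:
  assumes "finite (carrier L)" "atomistic L x y" "z \<in> carrier L" "x \<sqsubseteq> z" "z \<sqsubseteq> y"
  shows "atomistic L x z"
  using atomistic_meet[OF assms(1-3)] meet_absorb assms by (auto simp: atomistic_def)

text \<open>An atom over \<open>x\<close> is either below \<open>x \<squnion> x'\<close> or, by the
  diamond isomorphism, becomes an atom over it after joining. So an upper bound of the atoms over
  \<open>x \<squnion> x'\<close> bounds those over \<open>x\<close> and over \<open>x'\<close>,
  hence \<open>y\<close> and \<open>y'\<close>.\<close>

lemma atomistic_join: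
  assumes 1: "atomistic L x y" and 2: "atomistic L x' y'"
  shows "atomistic L (x \<squnion> x') (y \<squnion> y')"
  unfolding atomistic_def
proof (intro conjI ballI impI)
  have c: "x \<in> carrier L" "y \<in> carrier L" "x \<sqsubseteq> y" "x' \<in> carrier L" "y' \<in> carrier L" "x' \<sqsubseteq> y'"
    using assms by (auto simp: atomistic_def)
  show xx: "x \<squnion> x' \<in> carrier L" "y \<squnion> y' \<in> carrier L" using c by auto
  show "x \<squnion> x' \<sqsubseteq> y \<squnion> y'"
    using c by (intro join_mono) auto
  fix s assume s: "s \<in> carrier L" "x \<squnion> x' \<sqsubseteq> s \<and> s \<sqsubseteq> y \<squnion> y' \<and>
     (\<forall>a. covers L (x \<squnion> x') a \<and> a \<sqsubseteq> y \<squnion> y' \<longrightarrow> a \<sqsubseteq> s)"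
  have sx: "x \<sqsubseteq> s" "x' \<sqsubseteq> s" using s c by (auto simp: join_le_iff)
  have key: "a \<sqsubseteq> s" if "covers L u a" "u \<sqsubseteq> x \<squnion> x'" "a \<sqsubseteq> y \<squnion> y'" for u a
  proof (cases "a \<sqsubseteq> x \<squnion> x'")
    case True
    then show ?thesis using s xx that by (meson covers_def le_trans)
  next
    case False
    have a: "a \<in> carrier L" using that by (auto simp: covers_def)
    have "covers L (x \<squnion> x') (a \<squnion> (x \<squnion> x'))"
      using covers_join(1)[OF that(1) xx(1) that(2) False] .
    moreover have "a \<squnion> (x \<squnion> x') \<sqsubseteq> y \<squnion> y'"
      using a xx that(3) \<open>x \<squnion> x' \<sqsubseteq> y \<squnion> y'\<close> by (simp add: join_le_iff)
    ultimately have "a \<squnion> (x \<squnion> x') \<sqsubseteq> s" using s by blast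
    then show ?thesis using a xx s by (simp add: join_le_iff)
  qed
  have "y \<sqsubseteq> s"
  proof (rule atomistic_le[OF 1 s(1) sx(1)])
    fix a assume a: "covers L x a" "a \<sqsubseteq> y"
    have "a \<sqsubseteq> y \<squnion> y'"
      using le_trans[OF a(2) join_left[of y y']] a c by (auto simp: covers_def)
    then show "a \<sqsubseteq> s" using key[OF a(1) join_left] c by simp
  qed
  moreover have "y' \<sqsubseteq> s"
  proof (rule atomistic_le[OF 2 s(1) sx(2)])
    fix a assume a: "covers L x' a" "a \<sqsubseteq> y'"
    have "a \<sqsubseteq> y \<squnion> y'"
      using le_trans[OF a(2) join_right[of y y']] a c by (auto simp: covers_def)
    then show "a \<sqsubseteq> s" using key[OF a(1) join_right] c by simp
  qed
  ultimately show "s = y \<squnion> y'"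
    using c s by (simp add: join_le_iff le_antisym)
qed

text \<open>Step by step from the atomistic case. This closure lets bounded depth pass to quotients;
  the one for joins below lets it pass to joins of quotients.\<close>

lemma depth_le_meet:
  "\<lbrakk>finite (carrier L); depth_le L n x y; z \<in> carrier L\<rbrakk> \<Longrightarrow> depth_le L n (x \<sqinter> z) (y \<sqinter> z)"
  by (induction n arbitrary: x) (auto intro: atomistic_meet)

lemma depth_le_join:
  "\<lbrakk>depth_le L n x y; depth_le L n x' y'\<rbrakk> \<Longrightarrow> depth_le L n (x \<squnion> x') (y \<squnion> y')"
proof (induction n arbitrary: x x')
  case 0
  then show ?case by auto
next
  case (Suc n)
  then show ?case by simp (meson atomistic_join)
qed

end

section \<open>The Moebius function\<close>

context partial_order
begin

lemma mobius_refl: "\<lbrakk>finite (carrier L); x \<in> carrier L\<rbrakk> \<Longrightarrow> mobius L x x = 1"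
  by (subst mobius.simps) (simp add: partial_order_axioms)

lemma sum_mobius:
  assumes fin: "finite (carrier L)" and xy: "x \<in> carrier L" "y \<in> carrier L" "x \<sqsubseteq> y"
  shows "(\<Sum>z \<in> {z \<in> carrier L. x \<sqsubseteq> z \<and> z \<sqsubseteq> y}. mobius L x z) = (if x = y then 1 else 0)"
proof (cases "x = y")
  case True
  then have "{z \<in> carrier L. x \<sqsubseteq> z \<and> z \<sqsubseteq> y} = {x}"
    using xy le_antisym by auto
  then show ?thesis using True mobius_refl[OF fin xy(1)] by simp
next
  case False
  have "{z \<in> carrier L. x \<sqsubseteq> z \<and> z \<sqsubseteq> y} =
      insert y {z \<in> carrier L. x \<sqsubseteq> z \<and> z \<sqsubseteq> y \<and> z \<noteq> y}"
    using xy by auto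
  then have "(\<Sum>z \<in> {z \<in> carrier L. x \<sqsubseteq> z \<and> z \<sqsubseteq> y}. mobius L x z) =
      mobius L x y + (\<Sum>z \<in> {z \<in> carrier L. x \<sqsubseteq> z \<and> z \<sqsubseteq> y \<and> z \<noteq> y}. mobius L x z)"
    using fin by simp
  also have "mobius L x y = - (\<Sum>z \<in> {z \<in> carrier L. x \<sqsubseteq> z \<and> z \<sqsubseteq> y \<and> z \<noteq> y}. mobius L x z)"
    by (subst mobius.simps) (simp add: partial_order_axioms fin xy False)
  finally show ?thesis using False by simp
qed

end

section \<open>Transport along an embedding onto a principal ideal\<close>

locale down_embedding = dom: partial_order L + cod: partial_order L'
  for L :: "('a, 'b) gorder_scheme" and L' :: "('c, 'd) gorder_scheme" +
  fixes f :: "'a \<Rightarrow> 'c" and t :: 'c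
  assumes t_carrier: "t \<in> carrier L'"
    and bij: "bij_betw f (carrier L) {z \<in> carrier L'. z \<sqsubseteq>\<^bsub>L'\<^esub> t}"
    and le_iff: "\<lbrakk>x \<in> carrier L; y \<in> carrier L\<rbrakk> \<Longrightarrow> f x \<sqsubseteq>\<^bsub>L'\<^esub> f y \<longleftrightarrow> x \<sqsubseteq>\<^bsub>L\<^esub> y"
begin

lemma f_carrier: "x \<in> carrier L \<Longrightarrow> f x \<in> carrier L' \<and> f x \<sqsubseteq>\<^bsub>L'\<^esub> t"
  using bij by (auto simp: bij_betw_def)

lemma f_eq_iff: "\<lbrakk>x \<in> carrier L; y \<in> carrier L\<rbrakk> \<Longrightarrow> f x = f y \<longleftrightarrow> x = y"
  using bij by (auto simp: bij_betw_def inj_on_eq_iff)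

lemma f_preimage:
  assumes "z \<in> carrier L'" "z \<sqsubseteq>\<^bsub>L'\<^esub> t"
  obtains x where "x \<in> carrier L" "z = f x"
  using assms bij unfolding bij_betw_def by blast

lemma f_preimage_below:
  assumes "z \<in> carrier L'" "y \<in> carrier L" "z \<sqsubseteq>\<^bsub>L'\<^esub> f y"
  obtains x where "x \<in> carrier L" "z = f x"
  using assms f_preimage cod.le_trans[OF assms(3), of t] f_carrier t_carrier by blast

lemma f_top:
  assumes "s \<in> carrier L" "\<And>x. x \<in> carrier L \<Longrightarrow> x \<sqsubseteq>\<^bsub>L\<^esub> s"
  shows "f s = t"
proof -
  obtain x where "x \<in> carrier L" "t = f x"
    using f_preimage[OF t_carrier] t_carrier by auto
  then show ?thesis
    using assms f_carrier[of s] le_iff[of x s] t_carrier by (auto intro!: cod.le_antisym)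
qed

lemma covers_iff:
  assumes "x \<in> carrier L" "y \<in> carrier L"
  shows "covers L' (f x) (f y) \<longleftrightarrow> covers L x y"
proof
  assume "covers L' (f x) (f y)"
  then show "covers L x y"
    using assms f_carrier le_iff f_eq_iff unfolding covers_def by metis
next
  assume *: "covers L x y"
  show "covers L' (f x) (f y)"
    unfolding covers_def
  proof (intro conjI ballI impI)
    show "f x \<in> carrier L'" "f y \<in> carrier L'" "f x \<sqsubseteq>\<^bsub>L'\<^esub> f y" "f x \<noteq> f y"
      using * assms f_carrier le_iff f_eq_iff by (auto simp: covers_def)
    fix z assume z: "z \<in> carrier L'" "f x \<sqsubseteq>\<^bsub>L'\<^esub> z \<and> z \<sqsubseteq>\<^bsub>L'\<^esub> f y"
    then obtain u where "u \<in> carrier L" "z = f u"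
      using f_preimage_below assms by blast
    then show "z = f x \<or> z = f y"
      using z * assms by (auto simp: covers_def le_iff)
  qed
qed

text \<open>The image is closed downwards, so the elements of the two intervals correspond; nothing
  above \<open>f y\<close> is consulted.\<close>

lemma atomistic_iff:
  assumes xy: "x \<in> carrier L" "y \<in> carrier L"
  shows "atomistic L' (f x) (f y) \<longleftrightarrow> atomistic L x y"
proof -
  have atoms: "(\<forall>a. covers L' (f x) a \<and> a \<sqsubseteq>\<^bsub>L'\<^esub> f y \<longrightarrow> a \<sqsubseteq>\<^bsub>L'\<^esub> f s) \<longleftrightarrow>
      (\<forall>a. covers L x a \<and> a \<sqsubseteq>\<^bsub>L\<^esub> y \<longrightarrow> a \<sqsubseteq>\<^bsub>L\<^esub> s)" if s: "s \<in> carrier L" for s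
  proof (intro iffI allI impI)
    fix a assume *: "\<forall>a. covers L' (f x) a \<and> a \<sqsubseteq>\<^bsub>L'\<^esub> f y \<longrightarrow> a \<sqsubseteq>\<^bsub>L'\<^esub> f s" "covers L x a \<and> a \<sqsubseteq>\<^bsub>L\<^esub> y"
    then have "a \<in> carrier L" by (auto simp: covers_def)
    then show "a \<sqsubseteq>\<^bsub>L\<^esub> s" using * covers_iff[of x a] le_iff xy s by auto
  next
    fix a assume *: "\<forall>a. covers L x a \<and> a \<sqsubseteq>\<^bsub>L\<^esub> y \<longrightarrow> a \<sqsubseteq>\<^bsub>L\<^esub> s" "covers L' (f x) a \<and> a \<sqsubseteq>\<^bsub>L'\<^esub> f y"
    then obtain u where "u \<in> carrier L" "a = f u"
      using f_preimage_below[of a y] xy by (auto simp: covers_def)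
    then show "a \<sqsubseteq>\<^bsub>L'\<^esub> f s" using * covers_iff[of x u] le_iff xy s by auto
  qed
  show ?thesis
  proof
    assume *: "atomistic L' (f x) (f y)"
    show "atomistic L x y"
      unfolding atomistic_def
    proof (intro conjI ballI impI)
      show "x \<sqsubseteq>\<^bsub>L\<^esub> y" using * xy le_iff by (auto simp: atomistic_def)
      fix s assume s: "s \<in> carrier L" "x \<sqsubseteq>\<^bsub>L\<^esub> s \<and> s \<sqsubseteq>\<^bsub>L\<^esub> y \<and> (\<forall>a. covers L x a \<and> a \<sqsubseteq>\<^bsub>L\<^esub> y \<longrightarrow> a \<sqsubseteq>\<^bsub>L\<^esub> s)"
      then have "f s = f y"
        using * atoms[OF s(1)] f_carrier[of s] le_iff xy unfolding atomistic_def by blast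
      then show "s = y" using f_eq_iff s xy by blast
    qed (use xy in auto)
  next
    assume *: "atomistic L x y"
    show "atomistic L' (f x) (f y)"
      unfolding atomistic_def
    proof (intro conjI ballI impI)
      show "f x \<sqsubseteq>\<^bsub>L'\<^esub> f y" using * xy le_iff by (auto simp: atomistic_def)
      fix s assume s: "s \<in> carrier L'" "f x \<sqsubseteq>\<^bsub>L'\<^esub> s \<and> s \<sqsubseteq>\<^bsub>L'\<^esub> f y \<and>
        (\<forall>a. covers L' (f x) a \<and> a \<sqsubseteq>\<^bsub>L'\<^esub> f y \<longrightarrow> a \<sqsubseteq>\<^bsub>L'\<^esub> s)"
      then obtain u where u: "u \<in> carrier L" "s = f u"
        using f_preimage_below xy by blast
      have "x \<sqsubseteq>\<^bsub>L\<^esub> u" "u \<sqsubseteq>\<^bsub>L\<^esub> y" using s u le_iff xy by auto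
      moreover have "\<forall>a. covers L x a \<and> a \<sqsubseteq>\<^bsub>L\<^esub> y \<longrightarrow> a \<sqsubseteq>\<^bsub>L\<^esub> u"
        using atoms[OF u(1), THEN iffD1] s u(2) by blast
      ultimately have "u = y"
        using * u(1) unfolding atomistic_def by blast
      then show "s = f y" using u by simp
    qed (use xy f_carrier in auto)
  qed
qed

lemma depth_le_iff:
  assumes "x \<in> carrier L" "y \<in> carrier L"
  shows "depth_le L' n (f x) (f y) \<longleftrightarrow> depth_le L n x y"
  using assms
proof (induction n arbitrary: x)
  case 0
  then show ?case using f_carrier f_eq_iff by auto
next
  case (Suc n)
  \<comment> \<open>A chain ending in the image stays in the image, as all its members are below its
    end.\<close>
  have sub: "z \<in> carrier L' \<and> z \<sqsubseteq>\<^bsub>L'\<^esub> y'" if "depth_le L' n z y'" for z y'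
    using that
  proof (induction n arbitrary: z)
    case (Suc n)
    then obtain w where w: "atomistic L' z w" "depth_le L' n w y'" by auto
    moreover have "y' \<in> carrier L'"
      using w(2) by (induction n arbitrary: w) auto
    ultimately show ?case
      using Suc.IH[OF w(2)] cod.le_trans[of z w y'] w(1) by (simp add: atomistic_def)
  qed auto
  show ?case
  proof
    assume "depth_le L' (Suc n) (f x) (f y)"
    then obtain z where z: "atomistic L' (f x) z" "depth_le L' n z (f y)" by auto
    then obtain u where "u \<in> carrier L" "z = f u"
      using sub[OF z(2)] f_preimage_below Suc.prems by blast
    then show "depth_le L (Suc n) x y"
      using z Suc atomistic_iff by auto
  next
    assume "depth_le L (Suc n) x y"
    then obtain z where z: "atomistic L x z" "depth_le L n z y" by auto
    moreover have "z \<in> carrier L" using z by (auto simp: atomistic_def)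
    ultimately show "depth_le L' (Suc n) (f x) (f y)"
      using Suc atomistic_iff by auto
  qed
qed

lemma mobius_eq:
  assumes fin: "finite (carrier L)" "finite (carrier L')"
    and x: "x \<in> carrier L" and y: "y \<in> carrier L" and xy: "x \<sqsubseteq>\<^bsub>L\<^esub> y"
  shows "mobius L' (f x) (f y) = mobius L x y"
  using y xy
proof (induction "card {z \<in> carrier L. z \<sqsubseteq>\<^bsub>L\<^esub> y}" arbitrary: y rule: less_induct)
  case less
  show ?case
  proof (cases "x = y")
    case True
    then show ?thesis using dom.mobius_refl cod.mobius_refl fin f_carrier x by auto
  next
    case False
    let ?A = "{z \<in> carrier L. x \<sqsubseteq>\<^bsub>L\<^esub> z \<and> z \<sqsubseteq>\<^bsub>L\<^esub> y \<and> z \<noteq> y}"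
    let ?B = "{z \<in> carrier L'. f x \<sqsubseteq>\<^bsub>L'\<^esub> z \<and> z \<sqsubseteq>\<^bsub>L'\<^esub> f y \<and> z \<noteq> f y}"
    have B: "?B = f ` ?A"
    proof
      show "f ` ?A \<subseteq> ?B"
        using less.prems x f_carrier le_iff f_eq_iff by auto
      show "?B \<subseteq> f ` ?A"
      proof
        fix z assume z: "z \<in> ?B"
        then obtain u where "u \<in> carrier L" "z = f u"
          using f_preimage_below less.prems by blast
        then show "z \<in> f ` ?A" using z le_iff x less.prems by auto
      qed
    qed
    have IH: "mobius L' (f x) (f z) = mobius L x z" if "z \<in> ?A" for z
    proof (rule less.hyps)
      show "card {u \<in> carrier L. u \<sqsubseteq>\<^bsub>L\<^esub> z} < card {u \<in> carrier L. u \<sqsubseteq>\<^bsub>L\<^esub> y}"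
        using dom.card_below_less[of z y] fin that less.prems by auto
    qed (use that in auto)
    have "f x \<noteq> f y" using False f_eq_iff x less.prems by auto
    then have "mobius L' (f x) (f y) = - (\<Sum>z \<in> ?B. mobius L' (f x) z)"
      by (subst mobius.simps)
        (use fin f_carrier x less.prems le_iff cod.partial_order_axioms in simp)
    also have "(\<Sum>z \<in> ?B. mobius L' (f x) z) = (\<Sum>z \<in> ?A. mobius L' (f x) (f z))"
      unfolding B by (rule sum.reindex_cong[of f ?A]) (auto simp: inj_on_def f_eq_iff)
    also have "\<dots> = (\<Sum>z \<in> ?A. mobius L x z)"
      using IH by (intro sum.cong) auto
    also have "- \<dots> = mobius L x y"
      by (subst (2) mobius.simps) (use fin x less.prems False dom.partial_order_axioms in simp)
    finally show ?thesis .
  qed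
qed

end

section \<open>Weisner's theorem and the sign of the Moebius function\<close>

context lattice
begin

text \<open>The elements \<open>z\<close> between \<open>x\<close> and \<open>y\<close> are grouped
  by \<open>w = z \<squnion> a\<close>. The whole sum vanishes because \<open>x \<noteq> y\<close>,
  and the groups with \<open>w \<noteq> y\<close> vanish by induction.\<close>

lemma weisner:
  assumes fin: "finite (carrier L)" and x: "x \<in> carrier L" and a: "a \<in> carrier L" "x \<sqsubseteq> a" "a \<noteq> x"
    and y: "y \<in> carrier L" "a \<sqsubseteq> y"
  shows "(\<Sum>z \<in> {z \<in> carrier L. x \<sqsubseteq> z \<and> z \<squnion> a = y}. mobius L x z) = 0"
  using y
proof (induction "card {z \<in> carrier L. z \<sqsubseteq> y}" arbitrary: y rule: less_induct)
  case less
  define S where "S w = {z \<in> carrier L. x \<sqsubseteq> z \<and> z \<squnion> a = w}" for w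
  let ?W = "{w \<in> carrier L. a \<sqsubseteq> w \<and> w \<sqsubseteq> y}"
  have "(\<Sum>z \<in> {z \<in> carrier L. x \<sqsubseteq> z \<and> z \<sqsubseteq> y}. mobius L x z) = 0"
    using sum_mobius[OF fin x less.prems(1)] less.prems x a le_trans le_antisym by (metis (no_types, lifting))
  moreover have "{z \<in> carrier L. x \<sqsubseteq> z \<and> z \<sqsubseteq> y} = (\<Union>w \<in> ?W. S w)"
    using less.prems a by (auto simp: S_def join_le_iff intro: join_right)
  moreover have "sum (mobius L x) (\<Union>w \<in> ?W. S w) = (\<Sum>w \<in> ?W. sum (mobius L x) (S w))"
    using fin by (intro sum.UNION_disjoint) (auto simp: S_def)
  ultimately have "0 = (\<Sum>w \<in> ?W. sum (mobius L x) (S w))" by simp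
  also have "\<dots> = sum (mobius L x) (S y) + (\<Sum>w \<in> ?W - {y}. sum (mobius L x) (S w))"
    using fin less.prems by (subst sum.remove[of _ y]) auto
  also have "(\<Sum>w \<in> ?W - {y}. sum (mobius L x) (S w)) = 0"
  proof (rule sum.neutral, rule ballI)
    fix w assume w: "w \<in> ?W - {y}"
    have "card {u \<in> carrier L. u \<sqsubseteq> w} < card {u \<in> carrier L. u \<sqsubseteq> y}"
      using card_below_less[OF fin, of w y] w less.prems by auto
    then show "sum (mobius L x) (S w) = 0"
      using less.hyps[of w] w by (simp add: S_def)
  qed
  finally show ?case by (simp add: S_def)
qed

end

context modular_lattice
begin

text \<open>By Weisner's theorem at an atom, \<open>\<mu>(x, y)\<close> is minus a nonempty sum over coatoms, and by the
  diamond on two coatoms the summands have equal signs.\<close>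

lemma mobius_atomistic_sign:
  assumes fin: "finite (carrier L)" and at: "atomistic L x y"
  shows "mobius L x y \<noteq> 0 \<and> (\<forall>z. covers L z y \<and> x \<sqsubseteq> z \<longrightarrow> mobius L x z * mobius L x y < 0)"
  using at
proof (induction "card {z \<in> carrier L. z \<sqsubseteq> y}" arbitrary: y rule: less_induct)
  case less
  have c: "x \<in> carrier L" "y \<in> carrier L" "x \<sqsubseteq> y" using less.prems by (auto simp: atomistic_def)
  have IH: "mobius L x z \<noteq> 0 \<and> (\<forall>w. covers L w z \<and> x \<sqsubseteq> w \<longrightarrow> mobius L x w * mobius L x z < 0)"
    if z: "z \<in> carrier L" "x \<sqsubseteq> z" "z \<sqsubseteq> y" "z \<noteq> y" for z
  proof (rule less.hyps)
    show "card {u \<in> carrier L. u \<sqsubseteq> z} < card {u \<in> carrier L. u \<sqsubseteq> y}"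
      using card_below_less[OF fin, of z y] z c by auto
    show "atomistic L x z" using atomistic_lower[OF fin less.prems] z by auto
  qed
  show ?case
  proof (cases "x = y")
    case True
    have "\<not> (covers L z y \<and> x \<sqsubseteq> z)" for z
      using True le_antisym by (auto simp: covers_def)
    then show ?thesis using True mobius_refl[OF fin c(1)] by auto
  next
    case False
    obtain a where a: "covers L x a" "a \<sqsubseteq> y"
      using exists_cover_above[OF fin c False] by blast
    have ac: "a \<in> carrier L" "x \<sqsubseteq> a" "a \<noteq> x" using a by (auto simp: covers_def)
    \<comment> \<open>A complement of the atom provides a term other than \<open>y\<close> itself in
      Weisner's sum, so that the sum over coatoms below is not empty.\<close>
    obtain d where d: "d \<in> carrier L" "d \<sqinter> a = x" "d \<squnion> a = y"
      using atomistic_imp_complemented[OF less.prems fin] ac a by (auto simp: complemented_def)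
    let ?Z = "{z \<in> carrier L. x \<sqsubseteq> z \<and> z \<squnion> a = y}"
    \<comment> \<open>Such a \<open>z\<close> is not above the atom \<open>a\<close>, so the diamond
      with \<open>a\<close> makes it a coatom.\<close>
    have cov: "covers L z y" if "z \<in> ?Z - {y}" for z
    proof -
      have z: "z \<in> carrier L" "x \<sqsubseteq> z" "z \<squnion> a = y" "z \<noteq> y" using that by auto
      then have "\<not> a \<sqsubseteq> z" using ac by (metis join_absorb)
      then show ?thesis using covers_join(1)[OF a(1) z(1,2)] z ac by (metis join_comm)
    qed
    have same: "mobius L x z * mobius L x z' > 0"
      if z: "covers L z y" "x \<sqsubseteq> z" and z': "covers L z' y" "x \<sqsubseteq> z'" for z z'
    proof (cases "z = z'")
      case True
      have "mobius L x z \<noteq> 0" using IH[of z] z by (auto simp: covers_def)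
      then show ?thesis using True by (metis not_real_square_gt_zero zero_less_mult_iff linorder_neqE)
    next
      case zz: False
      have zc: "z \<in> carrier L" "z \<sqsubseteq> y" "z \<noteq> y" "z' \<in> carrier L" "z' \<sqsubseteq> y" "z' \<noteq> y"
        using z z' by (auto simp: covers_def)
      \<comment> \<open>The dual of the diamond: two distinct coatoms both cover their meet.\<close>
      have cm: "covers L (u \<sqinter> u') u"
        if u: "covers L u y" and u': "covers L u' y" and uu: "u \<noteq> u'" for u u'
        unfolding covers_def
      proof (intro conjI ballI impI)
        have uc: "u \<in> carrier L" "u' \<in> carrier L" "u \<sqsubseteq> y" "u' \<sqsubseteq> y" "u \<noteq> y" "u' \<noteq> y"
          using u u' by (auto simp: covers_def)
        show "u \<sqinter> u' \<in> carrier L" "u \<in> carrier L" "u \<sqinter> u' \<sqsubseteq> u"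
          using uc by (auto intro: meet_left)
        show "u \<sqinter> u' \<noteq> u"
          using u uc uu unfolding covers_def by (metis meet_right)
        fix w assume w: "w \<in> carrier L" "u \<sqinter> u' \<sqsubseteq> w \<and> w \<sqsubseteq> u"
        have "w \<squnion> u' = u' \<or> w \<squnion> u' = y"
        proof -
          have "w \<sqsubseteq> y" using le_trans[of w u y] w uc c by auto
          then have "w \<squnion> u' \<in> carrier L" "u' \<sqsubseteq> w \<squnion> u'" "w \<squnion> u' \<sqsubseteq> y"
            using w uc c by (auto simp: join_le_iff intro: join_right)
          then show ?thesis using u' unfolding covers_def by blast
        qed
        then show "w = u \<sqinter> u' \<or> w = u"
        proof
          assume "w \<squnion> u' = u'"
          then have "w \<sqsubseteq> u'" using w uc by (metis join_left)
          then have "w \<sqsubseteq> u \<sqinter> u'" using w uc by (simp add: le_meet_iff)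
          then show ?thesis using w uc by (simp add: le_antisym)
        next
          assume "w \<squnion> u' = y"
          moreover have "w \<squnion> (u' \<sqinter> u) = (w \<squnion> u') \<sqinter> u"
            using modular[of w u u'] w uc by simp
          moreover have "w \<squnion> (u' \<sqinter> u) = w"
            using w uc join_absorb[of "u \<sqinter> u'" w] by (simp add: meet_comm[of L u' u])
          ultimately show ?thesis using meet_absorb[of u y] uc c by simp
        qed
      qed
      \<comment> \<open>By induction the values at \<open>z\<close> and at \<open>z'\<close> both
        have the sign opposite to the value at their meet.\<close>
      let ?m = "z \<sqinter> z'"
      have "x \<sqsubseteq> ?m" using c zc z z' by (simp add: le_meet_iff)
      moreover have "covers L ?m z" "covers L ?m z'"
        using cm[OF z(1) z'(1) zz] cm[OF z'(1) z(1)] zz zc by (auto simp: meet_comm)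
      ultimately have "mobius L x ?m * mobius L x z < 0" "mobius L x ?m * mobius L x z' < 0"
        using IH[of z] IH[of z'] zc z z' by auto
      then show ?thesis by (auto simp: mult_less_0_iff zero_less_mult_iff)
    qed
    have "0 = (\<Sum>z \<in> ?Z. mobius L x z)"
      using weisner[OF fin c(1) ac c(2) a(2)] by simp
    also have "\<dots> = mobius L x y + (\<Sum>z \<in> ?Z - {y}. mobius L x z)"
      using fin c a(2) ac join_absorb by (subst sum.remove[of _ y]) auto
    finally have eq: "mobius L x y = - (\<Sum>z \<in> ?Z - {y}. mobius L x z)" by simp
    have "d \<in> ?Z - {y}"
    proof -
      have "x \<sqsubseteq> d" using d ac by (metis meet_left)
      moreover have "d \<noteq> y" using d ac a c by (metis meet_absorb)
      ultimately show ?thesis using d by auto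
    qed
    have neg: "mobius L x z * mobius L x y < 0" if z: "covers L z y" "x \<sqsubseteq> z" for z
    proof -
      have "mobius L x z * (\<Sum>z \<in> ?Z - {y}. mobius L x z) =
          (\<Sum>w \<in> ?Z - {y}. mobius L x z * mobius L x w)"
        by (simp add: sum_distrib_left)
      also have "\<dots> > 0"
      proof (rule sum_pos)
        fix w assume "w \<in> ?Z - {y}"
        then show "0 < mobius L x z * mobius L x w" using same[OF z] cov by auto
      qed (use fin \<open>d \<in> ?Z - {y}\<close> in auto)
      finally show ?thesis unfolding eq by simp
    qed
    have "mobius L x d * mobius L x y < 0"
      using neg[of d] cov[OF \<open>d \<in> ?Z - {y}\<close>] \<open>d \<in> ?Z - {y}\<close> by auto
    then have "mobius L x y \<noteq> 0" by auto
    then show ?thesis using neg by blast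
  qed
qed

lemma mobius_atomistic_abs_ge_1:
  "\<lbrakk>finite (carrier L); atomistic L x y\<rbrakk> \<Longrightarrow> \<bar>mobius L x y\<bar> \<ge> 1"
  using mobius_atomistic_sign[of x y] by linarith

end

section \<open>Counting quotients by type\<close>

text \<open>\<open>c\<close> is an isomorphism class of objects, \<open>Q c\<close> its lattice of quotients with greatest element
  \<open>tp c\<close>, and \<open>ty q\<close> the isomorphism class of the quotient \<open>q\<close>.\<close>

locale typed_lattices =
  fixes I :: "'c set" and Q :: "'c \<Rightarrow> ('q, 'z) gorder_scheme" and tp :: "'c \<Rightarrow> 'q" and ty :: "'q \<Rightarrow> 'c"
  assumes modular_lattice: "c \<in> I \<Longrightarrow> modular_lattice (Q c)"
    and finite_carrier: "c \<in> I \<Longrightarrow> finite (carrier (Q c))"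
    and tp_carrier: "c \<in> I \<Longrightarrow> tp c \<in> carrier (Q c)"
    and le_tp: "\<lbrakk>c \<in> I; q \<in> carrier (Q c)\<rbrakk> \<Longrightarrow> q \<sqsubseteq>\<^bsub>Q c\<^esub> tp c"
    and ty_tp: "c \<in> I \<Longrightarrow> ty (tp c) = c"
    and ty_in: "\<lbrakk>c \<in> I; q \<in> carrier (Q c)\<rbrakk> \<Longrightarrow> ty q \<in> I"
    and ex_embedding: "\<lbrakk>c \<in> I; q \<in> carrier (Q c)\<rbrakk> \<Longrightarrow>
      \<exists>f. down_embedding (Q (ty q)) (Q c) f q \<and> (\<forall>x \<in> carrier (Q (ty q)). ty (f x) = ty x)"
begin

definition cnt :: "'c \<Rightarrow> 'c \<Rightarrow> nat" where
  "cnt c g = card {q \<in> carrier (Q c). ty q = g}"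

definition acnt :: "'c \<Rightarrow> 'c \<Rightarrow> nat" where
  "acnt c g = card {q \<in> carrier (Q c). ty q = g \<and> atomistic (Q c) q (tp c)}"

definition dcnt :: "nat \<Rightarrow> 'c \<Rightarrow> 'c \<Rightarrow> nat" where
  "dcnt k c g = card {q \<in> carrier (Q c). ty q = g \<and> depth_le (Q c) k q (tp c)}"

text \<open>For the isomorphism classes of two objects this becomes \<open>mu_hat\<close>, because
  the orbits of epimorphisms under automorphisms of the target are the quotients of that
  type.\<close>

definition mobius_sum :: "'c \<Rightarrow> 'c \<Rightarrow> real" where
  "mobius_sum f h = (\<Sum>p \<in> {p \<in> carrier (Q h). ty p = f}. real_of_int (mobius (Q h) p (tp h)))"

definition mobius_abs_sum :: "'c \<Rightarrow> 'c \<Rightarrow> real" where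
  "mobius_abs_sum f h = (\<Sum>p \<in> {p \<in> carrier (Q h). ty p = f}. \<bar>real_of_int (mobius (Q h) p (tp h))\<bar>)"

text \<open>The outer boundary of \<open>S\<close> in the graph of simple extensions: the types at
  which an upward path of covers can leave \<open>S\<close>. Condition (3) of a diamond category
  makes it finite for finite \<open>S\<close>.\<close>

definition boundary :: "'c set \<Rightarrow> 'c set \<Rightarrow> 'c set" where
  "boundary L S = {h \<in> L - S. \<exists>q \<in> carrier (Q h). ty q \<in> S \<and> covers (Q h) q (tp h)}"

lemma abs_mobius_sum_le: "\<bar>mobius_sum f h\<bar> \<le> mobius_abs_sum f h"
  unfolding mobius_sum_def mobius_abs_sum_def by (rule sum_abs)

lemma mobius_abs_sum_nonneg: "0 \<le> mobius_abs_sum f h"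
  unfolding mobius_abs_sum_def by (rule sum_nonneg) auto

lemma cnt_self_pos: "c \<in> I \<Longrightarrow> 1 \<le> cnt c c"
proof -
  assume c: "c \<in> I"
  have "tp c \<in> {q \<in> carrier (Q c). ty q = c}" using c tp_carrier ty_tp by auto
  then have "card {tp c} \<le> card {q \<in> carrier (Q c). ty q = c}"
    using finite_carrier[OF c] by (intro card_mono) auto
  then show ?thesis by (simp add: cnt_def)
qed

text \<open>Every atomistic interval contributes at least 1 to the right side. Through this bound,
  summability of the Moebius series becomes summability of plain counts.\<close>

lemma acnt_le_mobius_abs_sum:
  assumes h: "h \<in> I"
  shows "real (acnt h g) \<le> mobius_abs_sum g h"
proof -
  interpret modular_lattice "Q h" using modular_lattice h .
  let ?A = "{q \<in> carrier (Q h). ty q = g \<and> atomistic (Q h) q (tp h)}"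
  have "real (acnt h g) = (\<Sum>p \<in> ?A. 1)" by (simp add: acnt_def)
  also have "\<dots> \<le> (\<Sum>p \<in> ?A. \<bar>real_of_int (mobius (Q h) p (tp h))\<bar>)"
  proof (rule sum_mono)
    fix p assume "p \<in> ?A"
    then have "1 \<le> \<bar>mobius (Q h) p (tp h)\<bar>"
      using mobius_atomistic_abs_ge_1[OF finite_carrier[OF h]] by auto
    then show "1 \<le> \<bar>real_of_int (mobius (Q h) p (tp h))\<bar>" by linarith
  qed
  also have "\<dots> \<le> mobius_abs_sum g h"
    unfolding mobius_abs_sum_def using finite_carrier[OF h] by (intro sum_mono2) auto
  finally show ?thesis .
qed

lemma embedding_tp:
  assumes c: "c \<in> I" and q: "q \<in> carrier (Q c)" and f: "down_embedding (Q (ty q)) (Q c) f q"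
  shows "f (tp (ty q)) = q"
  using down_embedding.f_top[OF f] tp_carrier le_tp ty_in[OF c q] by blast

text \<open>The quotients of \<open>c\<close> below \<open>q\<close> are the quotients of
  \<open>ty q\<close>, so whatever is computed below \<open>q\<close> depends only on its
  type.\<close>

lemma card_below:
  assumes c: "c \<in> I" and q: "q \<in> carrier (Q c)"
  shows "card {p \<in> carrier (Q c). p \<sqsubseteq>\<^bsub>Q c\<^esub> q \<and> ty p = g} = cnt (ty q) g"
    and "card {p \<in> carrier (Q c). p \<sqsubseteq>\<^bsub>Q c\<^esub> q \<and> ty p = g \<and> atomistic (Q c) p q} = acnt (ty q) g"
    and "mobius_sum g (ty q) = (\<Sum>p \<in> {p \<in> carrier (Q c). p \<sqsubseteq>\<^bsub>Q c\<^esub> q \<and> ty p = g}. real_of_int (mobius (Q c) p q))"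
proof -
  obtain f where f: "down_embedding (Q (ty q)) (Q c) f q"
    and tf: "\<And>x. x \<in> carrier (Q (ty q)) \<Longrightarrow> ty (f x) = ty x"
    using ex_embedding[OF c q] by blast
  interpret f: down_embedding "Q (ty q)" "Q c" f q by fact
  have h: "ty q \<in> I" using ty_in[OF c q] .
  have ft: "f (tp (ty q)) = q" using embedding_tp[OF c q f] .
  have inj: "inj_on f A" if "A \<subseteq> carrier (Q (ty q))" for A
    using that f.f_eq_iff unfolding inj_on_def by blast
  have eq1: "{p \<in> carrier (Q c). p \<sqsubseteq>\<^bsub>Q c\<^esub> q \<and> ty p = g} = f ` {p \<in> carrier (Q (ty q)). ty p = g}" (is "?A = _")
    using f.f_carrier tf f.f_preimage by (auto simp: image_iff) metis
  show "card ?A = cnt (ty q) g"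
    unfolding eq1 cnt_def by (rule card_image, rule inj) auto
  have "atomistic (Q c) (f p) q \<longleftrightarrow> atomistic (Q (ty q)) p (tp (ty q))" if "p \<in> carrier (Q (ty q))" for p
    using f.atomistic_iff[OF that tp_carrier[OF h]] ft by simp
  note at = this
  have "{p \<in> carrier (Q c). p \<sqsubseteq>\<^bsub>Q c\<^esub> q \<and> ty p = g \<and> atomistic (Q c) p q} =
      {p \<in> f ` {p \<in> carrier (Q (ty q)). ty p = g}. atomistic (Q c) p q}"
    unfolding eq1[symmetric] by auto
  then have eq2: "{p \<in> carrier (Q c). p \<sqsubseteq>\<^bsub>Q c\<^esub> q \<and> ty p = g \<and> atomistic (Q c) p q} =
      f ` {p \<in> carrier (Q (ty q)). ty p = g \<and> atomistic (Q (ty q)) p (tp (ty q))}"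
    using at by auto
  show "card {p \<in> carrier (Q c). p \<sqsubseteq>\<^bsub>Q c\<^esub> q \<and> ty p = g \<and> atomistic (Q c) p q} = acnt (ty q) g"
    unfolding eq2 acnt_def by (rule card_image, rule inj) auto
  have "(\<Sum>p \<in> ?A. real_of_int (mobius (Q c) p q)) =
      (\<Sum>p \<in> {p \<in> carrier (Q (ty q)). ty p = g}. real_of_int (mobius (Q c) (f p) q))"
    unfolding eq1 by (subst sum.reindex) (auto intro: inj)
  also have "\<dots> = mobius_sum g (ty q)"
    unfolding mobius_sum_def
  proof (intro sum.cong HOL.refl)
    fix p assume "p \<in> {p \<in> carrier (Q (ty q)). ty p = g}"
    then show "real_of_int (mobius (Q c) (f p) q) = real_of_int (mobius (Q (ty q)) p (tp (ty q)))"
      using f.mobius_eq[of p "tp (ty q)"] ft tp_carrier[OF h] le_tp[OF h]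
        finite_carrier[OF h] finite_carrier[OF c] by auto
  qed
  finally show "mobius_sum g (ty q) = (\<Sum>p \<in> ?A. real_of_int (mobius (Q c) p q))" by simp
qed

lemma sum_by_type:
  assumes c: "c \<in> I" and T: "finite T" "ty ` carrier (Q c) \<subseteq> T"
  shows "(\<Sum>h \<in> T. F h * real (cnt c h)) = (\<Sum>q \<in> carrier (Q c). F (ty q))"
proof -
  have "(\<Sum>q \<in> carrier (Q c). F (ty q)) = (\<Sum>h \<in> T. \<Sum>q \<in> {q \<in> carrier (Q c). ty q = h}. F (ty q))"
    by (rule sum.group[symmetric]) (use finite_carrier[OF c] T in auto)
  also have "\<dots> = (\<Sum>h \<in> T. F h * real (cnt c h))"
    unfolding cnt_def by (intro sum.cong) auto
  finally show ?thesis by simp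
qed

text \<open>Both factors unfold to a double sum of \<mu>(p,q) over \<open>p\<close> below
  \<open>q\<close> in the lattice of \<open>c\<close>; summing over \<open>q\<close> first leaves
  only \<open>p = tp c\<close>. Enlarging \<open>T\<close> beyond the types that occur adds zero
  terms.\<close>

lemma mobius_inversion:
  assumes c: "c \<in> I" and T: "finite T" "ty ` carrier (Q c) \<subseteq> T"
  shows "(\<Sum>h \<in> T. mobius_sum f h * real (cnt c h)) = (if c = f then 1 else 0)"
proof -
  interpret modular_lattice "Q c" using modular_lattice c .
  note fin = finite_carrier[OF c]
  have "(\<Sum>h \<in> T. mobius_sum f h * real (cnt c h)) = (\<Sum>q \<in> carrier (Q c). mobius_sum f (ty q))"
    using sum_by_type[OF c T] .
  also have "\<dots> = (\<Sum>q \<in> carrier (Q c). \<Sum>p \<in> carrier (Q c).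
      if p \<sqsubseteq>\<^bsub>Q c\<^esub> q \<and> ty p = f then real_of_int (mobius (Q c) p q) else 0)"
    by (rule sum.cong[OF HOL.refl], subst card_below(3)[OF c])
      (auto simp: sum.If_cases[OF fin] intro!: sum.cong)
  also have "\<dots> = (\<Sum>p \<in> carrier (Q c). \<Sum>q \<in> carrier (Q c).
      if p \<sqsubseteq>\<^bsub>Q c\<^esub> q \<and> ty p = f then real_of_int (mobius (Q c) p q) else 0)"
    by (rule sum.swap)
  also have "\<dots> = (\<Sum>p \<in> carrier (Q c). if p = tp c then (if c = f then 1 else 0) else 0)"
  proof (intro sum.cong HOL.refl)
    fix p assume p: "p \<in> carrier (Q c)"
    show "(\<Sum>q \<in> carrier (Q c). if p \<sqsubseteq>\<^bsub>Q c\<^esub> q \<and> ty p = f then real_of_int (mobius (Q c) p q) else 0) =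
        (if p = tp c then (if c = f then 1 else 0) else 0)"
    proof (cases "ty p = f")
      case True
      have "(\<Sum>q \<in> carrier (Q c). if p \<sqsubseteq>\<^bsub>Q c\<^esub> q \<and> ty p = f then real_of_int (mobius (Q c) p q) else 0) =
          (\<Sum>q \<in> {q \<in> carrier (Q c). p \<sqsubseteq>\<^bsub>Q c\<^esub> q}. real_of_int (mobius (Q c) p q))"
        using True by (simp add: sum.If_cases[OF fin] Int_def)
      also have "{q \<in> carrier (Q c). p \<sqsubseteq>\<^bsub>Q c\<^esub> q} = {q \<in> carrier (Q c). p \<sqsubseteq>\<^bsub>Q c\<^esub> q \<and> q \<sqsubseteq>\<^bsub>Q c\<^esub> tp c}"
        using le_tp[OF c] by auto
      also have "(\<Sum>q \<in> \<dots>. real_of_int (mobius (Q c) p q)) = (if p = tp c then 1 else 0)"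
        using arg_cong[OF sum_mobius[OF fin p tp_carrier[OF c] le_tp[OF c p]], of real_of_int] by simp
      finally show ?thesis using True ty_tp[OF c] by auto
    next
      case False
      then show ?thesis using ty_tp[OF c] by auto
    qed
  qed
  also have "\<dots> = (if c = f then 1 else 0)"
    using fin tp_carrier[OF c] by simp
  finally show ?thesis .
qed

text \<open>A quotient \<open>q\<close> of depth \<open>k + 1\<close> is charged to its first step \<open>r\<close> when the type of \<open>r\<close> lies
  in \<open>S\<close>, and otherwise to the first point where a path from \<open>q\<close> to \<open>r\<close> leaves \<open>S\<close>.\<close>

lemma dcnt_Suc_le:
  assumes L: "L \<subseteq> I" "\<And>c q. \<lbrakk>c \<in> L; q \<in> carrier (Q c)\<rbrakk> \<Longrightarrow> ty q \<in> L"
    and c: "c \<in> L" and g: "g \<in> S" and fin: "finite S" "finite (boundary L S)"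
  shows "dcnt (Suc k) c g \<le> (\<Sum>h \<in> S. cnt h g * dcnt k c h) + (\<Sum>h \<in> boundary L S. acnt h g * cnt c h)"
proof -
  have cI: "c \<in> I" using c L by auto
  interpret modular_lattice "Q c" using modular_lattice cI .
  note finc = finite_carrier[OF cI]
  let ?R1 = "{r \<in> carrier (Q c). ty r \<in> S \<and> depth_le (Q c) k r (tp c)}"
  let ?R2 = "{r \<in> carrier (Q c). ty r \<in> boundary L S}"
  let ?B1 = "\<lambda>r. {p \<in> carrier (Q c). p \<sqsubseteq>\<^bsub>Q c\<^esub> r \<and> ty p = g}"
  let ?B2 = "\<lambda>r. {p \<in> carrier (Q c). p \<sqsubseteq>\<^bsub>Q c\<^esub> r \<and> ty p = g \<and> atomistic (Q c) p r}"
  have "{q \<in> carrier (Q c). ty q = g \<and> depth_le (Q c) (Suc k) q (tp c)} \<subseteq> (\<Union>r \<in> ?R1. ?B1 r) \<union> (\<Union>r \<in> ?R2. ?B2 r)"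
  proof
    fix q assume q: "q \<in> {q \<in> carrier (Q c). ty q = g \<and> depth_le (Q c) (Suc k) q (tp c)}"
    then obtain r where r: "atomistic (Q c) q r" "depth_le (Q c) k r (tp c)" by auto
    then have rc: "r \<in> carrier (Q c)" "q \<sqsubseteq>\<^bsub>Q c\<^esub> r" by (auto simp: atomistic_def)
    show "q \<in> (\<Union>r \<in> ?R1. ?B1 r) \<union> (\<Union>r \<in> ?R2. ?B2 r)"
    proof (cases "ty r \<in> S")
      case True
      then show ?thesis using q r rc by auto
    next
      case False
      \<comment> \<open>The exit from \<open>S\<close>: a minimal element of type outside
        \<open>S\<close> between \<open>q\<close> and \<open>r\<close>. Everything it covers above
        \<open>q\<close> has type in \<open>S\<close>, so its own type is in the boundary.\<close>
      let ?A = "{s \<in> carrier (Q c). q \<sqsubseteq>\<^bsub>Q c\<^esub> s \<and> s \<sqsubseteq>\<^bsub>Q c\<^esub> r \<and> ty s \<notin> S}"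
      have "finite ?A" "?A \<noteq> {}" "?A \<subseteq> carrier (Q c)" using finc rc False by auto
      then obtain s where s: "s \<in> ?A" "\<forall>y \<in> ?A. y \<sqsubseteq>\<^bsub>Q c\<^esub> s \<longrightarrow> y = s"
        using exists_minimal by meson
      then have sc: "s \<in> carrier (Q c)" "q \<sqsubseteq>\<^bsub>Q c\<^esub> s" "s \<sqsubseteq>\<^bsub>Q c\<^esub> r" "ty s \<notin> S" by auto
      have qc: "q \<in> carrier (Q c)" "ty q = g" using q by auto
      have "q \<noteq> s" using qc sc g by auto
      then obtain u where u: "covers (Q c) u s" "q \<sqsubseteq>\<^bsub>Q c\<^esub> u"
        using exists_cover_below[OF finc qc(1) sc(1,2)] by auto
      then have uc: "u \<in> carrier (Q c)" "u \<sqsubseteq>\<^bsub>Q c\<^esub> s" "u \<noteq> s" by (auto simp: covers_def)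
      have "u \<sqsubseteq>\<^bsub>Q c\<^esub> r" using le_trans[OF uc(2) sc(3) uc(1) sc(1) rc(1)] .
      then have tu: "ty u \<in> S" using s(2) uc u(2) by blast
      have "ty s \<in> boundary L S"
      proof -
        obtain f where f: "down_embedding (Q (ty s)) (Q c) f s"
          and tf: "\<And>x. x \<in> carrier (Q (ty s)) \<Longrightarrow> ty (f x) = ty x"
          using ex_embedding[OF cI sc(1)] by blast
        interpret f: down_embedding "Q (ty s)" "Q c" f s by fact
        obtain x where x: "x \<in> carrier (Q (ty s))" "u = f x"
          using f.f_preimage uc by blast
        have sL: "ty s \<in> L" "ty s \<in> I" using L c sc by auto
        have "covers (Q (ty s)) x (tp (ty s))"
          using f.covers_iff[OF x(1) tp_carrier[OF sL(2)]] u(1) x embedding_tp[OF cI sc(1) f] by simp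
        then show ?thesis using sL sc x tu tf[OF x(1)] by (auto simp: boundary_def)
      qed
      \<comment> \<open>The exit point is charged with the atomistic interval from \<open>q\<close>
        to \<open>s\<close>. Its distance to the top is forgotten, which is why full counts
        \<open>cnt c h\<close> stand in the second sum.\<close>
      moreover have "atomistic (Q c) q s"
        using atomistic_lower[OF finc r(1) sc(1-3)] .
      ultimately have "q \<in> ?B2 s" "s \<in> ?R2" using qc sc by auto
      then show ?thesis by blast
    qed
  qed
  then have "dcnt (Suc k) c g \<le> card ((\<Union>r \<in> ?R1. ?B1 r) \<union> (\<Union>r \<in> ?R2. ?B2 r))"
    unfolding dcnt_def using finc by (intro card_mono) auto
  also have "\<dots> \<le> card (\<Union>r \<in> ?R1. ?B1 r) + card (\<Union>r \<in> ?R2. ?B2 r)"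
    by (rule card_Un_le)
  also have "\<dots> \<le> (\<Sum>r \<in> ?R1. card (?B1 r)) + (\<Sum>r \<in> ?R2. card (?B2 r))"
    using finc by (intro add_mono card_UN_le) auto
  also have "(\<Sum>r \<in> ?R1. card (?B1 r)) = (\<Sum>r \<in> ?R1. cnt (ty r) g)"
    by (rule sum.cong[OF HOL.refl], rule card_below(1)[OF cI]) simp
  also have "\<dots> = (\<Sum>h \<in> S. \<Sum>r \<in> {r \<in> ?R1. ty r = h}. cnt (ty r) g)"
    by (rule sum.group[symmetric]) (use finc fin in auto)
  also have "\<dots> = (\<Sum>h \<in> S. cnt h g * dcnt k c h)"
  proof (intro sum.cong HOL.refl)
    fix h assume h: "h \<in> S"
    have "{r \<in> ?R1. ty r = h} = {q \<in> carrier (Q c). ty q = h \<and> depth_le (Q c) k q (tp c)}"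
      using h by auto
    then show "(\<Sum>r \<in> {r \<in> ?R1. ty r = h}. cnt (ty r) g) = cnt h g * dcnt k c h"
      by (simp add: dcnt_def)
  qed
  also have "(\<Sum>r \<in> ?R2. card (?B2 r)) = (\<Sum>r \<in> ?R2. acnt (ty r) g)"
    by (rule sum.cong[OF HOL.refl], rule card_below(2)[OF cI]) simp
  also have "\<dots> = (\<Sum>h \<in> boundary L S. \<Sum>r \<in> {r \<in> ?R2. ty r = h}. acnt (ty r) g)"
    by (rule sum.group[symmetric]) (use finc fin in auto)
  also have "\<dots> = (\<Sum>h \<in> boundary L S. acnt h g * cnt c h)"
  proof (intro sum.cong HOL.refl)
    fix h assume h: "h \<in> boundary L S"
    have "{r \<in> ?R2. ty r = h} = {q \<in> carrier (Q c). ty q = h}"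
      using h by auto
    then show "(\<Sum>r \<in> {r \<in> ?R2. ty r = h}. acnt (ty r) g) = acnt h g * cnt c h"
      by (simp add: cnt_def)
  qed
  finally show ?thesis by simp
qed

end

section \<open>Tightness and the limits of the masses\<close>

lemma summable_on_small_tail:
  fixes f :: "'a \<Rightarrow> real"
  assumes "f summable_on A" "0 < \<epsilon>"
  obtains S where "finite S" "S \<subseteq> A" "\<And>D. \<lbrakk>finite D; D \<subseteq> A - S\<rbrakk> \<Longrightarrow> \<bar>sum f D\<bar> < \<epsilon>"
proof -
  have "(sum f \<longlongrightarrow> infsum f A) (finite_subsets_at_top A)"
    using assms(1) by (simp add: has_sum_def[symmetric])
  then have "\<forall>\<^sub>F F in finite_subsets_at_top A. dist (sum f F) (infsum f A) < \<epsilon> / 2"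
    using assms(2) by (intro tendstoD) auto
  then obtain S where S: "finite S" "S \<subseteq> A"
    and *: "\<And>F. \<lbrakk>finite F; S \<subseteq> F; F \<subseteq> A\<rbrakk> \<Longrightarrow> dist (sum f F) (infsum f A) < \<epsilon> / 2"
    unfolding eventually_finite_subsets_at_top by metis
  show ?thesis
  proof (rule that[OF S])
    fix D assume D: "finite D" "D \<subseteq> A - S"
    have "sum f (S \<union> D) = sum f S + sum f D"
      using S D by (intro sum.union_disjoint) auto
    moreover have "dist (sum f S) (infsum f A) < \<epsilon> / 2" "dist (sum f (S \<union> D)) (infsum f A) < \<epsilon> / 2"
      using * S D by auto
    ultimately show "\<bar>sum f D\<bar> < \<epsilon>"
      unfolding dist_real_def by linarith
  qed
qed

text \<open>One fixed level, freed of the category: \<open>L\<close> is its set of types,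
  \<open>a t c\<close> the mass that the \<open>t\<close>-th measure gives to type \<open>c\<close>,
  \<open>m g\<close> the limit moment after division by the order of the automorphism group, and
  \<open>n\<close> a bound for the depth of all members.\<close>

locale moment_limit = typed_lattices I Q tp ty
  for I :: "'c set" and Q :: "'c \<Rightarrow> ('q, 'z) gorder_scheme" and tp :: "'c \<Rightarrow> 'q" and ty :: "'q \<Rightarrow> 'c" +
  fixes L :: "'c set" and m :: "'c \<Rightarrow> real" and a :: "nat \<Rightarrow> 'c \<Rightarrow> ennreal" and n :: nat
  assumes L_sub: "L \<subseteq> I"
    and L_down: "\<lbrakk>c \<in> L; q \<in> carrier (Q c)\<rbrakk> \<Longrightarrow> ty q \<in> L"
    and L_simple: "g \<in> L \<Longrightarrow> finite {h \<in> L. \<exists>q \<in> carrier (Q h). ty q = g \<and> covers (Q h) q (tp h)}"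
    and L_depth: "\<lbrakk>c \<in> L; q \<in> carrier (Q c)\<rbrakk> \<Longrightarrow> depth_le (Q c) n q (tp c)"
    and m_nonneg: "g \<in> L \<Longrightarrow> 0 \<le> m g"
    and m_summable: "f \<in> L \<Longrightarrow> (\<lambda>h. mobius_abs_sum f h * m h) summable_on L"
    and moments: "g \<in> L \<Longrightarrow>
      (\<lambda>t. \<integral>\<^sup>+ c. of_nat (cnt c g) * a t c \<partial>count_space L) \<longlonglongrightarrow> ennreal (m g)"
begin

lemma finite_boundary: "\<lbrakk>finite S; S \<subseteq> L\<rbrakk> \<Longrightarrow> finite (boundary L S)"
proof -
  assume S: "finite S" "S \<subseteq> L"
  have "boundary L S \<subseteq> (\<Union>g \<in> S. {h \<in> L. \<exists>q \<in> carrier (Q h). ty q = g \<and> covers (Q h) q (tp h)})"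
    by (auto simp: boundary_def)
  moreover have "finite \<dots>"
    using S L_simple by (intro finite_UN_I) auto
  ultimately show ?thesis by (rule finite_subset)
qed

text \<open>One atomistic step is traded for two finite sums: over \<open>S1\<close>, where the
  shorter chains are handled by induction, and over the boundary, where only finitely many moments
  have to be near their limits. The claim is made for all \<open>g\<close> and
  \<open>\<epsilon>\<close> because the induction hypothesis is applied at every member of
  \<open>S1\<close>.\<close>

lemma tight_depth:
  assumes "g \<in> L" "0 < \<epsilon>"
  shows "\<exists>S. finite S \<and> S \<subseteq> L \<and> (\<forall>\<^sub>F t in sequentially.
      (\<integral>\<^sup>+ c. of_nat (dcnt k c g) * a t c * indicator (- S) c \<partial>count_space L) \<le> ennreal \<epsilon>)"
  using assms
proof (induction k arbitrary: g \<epsilon>)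
  case 0
  have z: "dcnt 0 c g = 0" if "c \<in> L" "c \<noteq> g" for c
  proof -
    have "{q \<in> carrier (Q c). ty q = g \<and> depth_le (Q c) 0 q (tp c)} = {}"
      using that ty_tp L_sub by auto
    then show ?thesis by (simp only: dcnt_def card.empty)
  qed
  have "(\<integral>\<^sup>+ c. of_nat (dcnt 0 c g) * a t c * indicator (- {g}) c \<partial>count_space L) = 0" for t
    by (subst nn_integral_0_iff_AE) (auto simp: AE_count_space z indicator_def)
  then show ?case using 0 by (intro exI[of _ "{g}"]) auto
next
  case (Suc k)
  have gI: "g \<in> I" using Suc.prems L_sub by auto
  have "(\<lambda>h. real (acnt h g) * m h) summable_on L"
    using m_summable[OF Suc.prems(1)] 
    by (rule summable_on_comparison_test)
      (use acnt_le_mobius_abs_sum L_sub m_nonneg in \<open>auto intro!: mult_right_mono\<close>)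
  then obtain S0 where S0: "finite S0" "S0 \<subseteq> L"
    and S0_tail: "\<And>D. \<lbrakk>finite D; D \<subseteq> L - S0\<rbrakk> \<Longrightarrow> \<bar>\<Sum>h \<in> D. real (acnt h g) * m h\<bar> < \<epsilon> / 2"
    using summable_on_small_tail[of "\<lambda>h. real (acnt h g) * m h" L "\<epsilon> / 2"] Suc.prems by auto
  \<comment> \<open>The exit argument starts inside the set, so \<open>g\<close> is added. The
    boundary still avoids \<open>S0\<close>, and its weighted moments remain part of the
    tail.\<close>
  define S1 where "S1 = insert g S0"
  have S1: "finite S1" "S1 \<subseteq> L" "g \<in> S1" using S0 Suc.prems by (auto simp: S1_def)
  let ?B = "boundary L S1"
  have B: "finite ?B" "?B \<subseteq> L - S0" using finite_boundary[OF S1(1,2)] by (auto simp: boundary_def S1_def)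
  \<comment> \<open>The total weight with which the induction hypothesis enters; the summand 1 keeps
    it positive. The accuracy \<open>\<delta>\<close> spends half of \<open>\<epsilon>\<close> here,
    and the boundary takes the other half.\<close>
  define K where "K = (\<Sum>h \<in> S1. real (cnt h g)) + 1"
  have K: "K > 0" by (simp add: K_def sum_nonneg add_nonneg_pos)
  define \<delta> where "\<delta> = \<epsilon> / 2 / K"
  have \<delta>: "\<delta> > 0" using K Suc.prems by (simp add: \<delta>_def)
  have "\<exists>T. \<forall>h \<in> S1. finite (T h) \<and> T h \<subseteq> L \<and> (\<forall>\<^sub>F t in sequentially.
      (\<integral>\<^sup>+ c. of_nat (dcnt k c h) * a t c * indicator (- T h) c \<partial>count_space L) \<le> ennreal \<delta>)"
    using Suc.IH[OF _ \<delta>] S1 by (intro bchoice ballI) auto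
  then obtain T where T0: "\<forall>h \<in> S1. finite (T h) \<and> T h \<subseteq> L \<and> (\<forall>\<^sub>F t in sequentially.
      (\<integral>\<^sup>+ c. of_nat (dcnt k c h) * a t c * indicator (- T h) c \<partial>count_space L) \<le> ennreal \<delta>)"
    by (elim exE)
  then have T: "\<And>h. h \<in> S1 \<Longrightarrow> finite (T h)" "\<And>h. h \<in> S1 \<Longrightarrow> T h \<subseteq> L"
    and T_tail: "\<And>h. h \<in> S1 \<Longrightarrow> \<forall>\<^sub>F t in sequentially.
      (\<integral>\<^sup>+ c. of_nat (dcnt k c h) * a t c * indicator (- T h) c \<partial>count_space L) \<le> ennreal \<delta>"
    by blast+
  \<comment> \<open>Outside the union all the indicators of the complements of \<open>T h\<close>
    equal 1 at once, so the bounds for the various \<open>h\<close> can be added.\<close>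
  define S where "S = (\<Union>h \<in> S1. T h)"
  have "(\<lambda>t. \<Sum>h \<in> ?B. of_nat (acnt h g) * (\<integral>\<^sup>+ c. of_nat (cnt c h) * a t c \<partial>count_space L)) \<longlonglongrightarrow>
      (\<Sum>h \<in> ?B. of_nat (acnt h g) * ennreal (m h))"
    by (intro tendsto_sum ennreal_tendsto_cmult moments) (use B in \<open>auto simp: less_top[symmetric]\<close>)
  moreover have "(\<Sum>h \<in> ?B. of_nat (acnt h g) * ennreal (m h)) < ennreal (\<epsilon> / 2)"
  proof -
    have "(\<Sum>h \<in> ?B. of_nat (acnt h g) * ennreal (m h)) = (\<Sum>h \<in> ?B. ennreal (real (acnt h g) * m h))"
      using m_nonneg B by (intro sum.cong) (auto simp: ennreal_mult ennreal_of_nat_eq_real_of_nat)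
    also have "\<dots> = ennreal (\<Sum>h \<in> ?B. real (acnt h g) * m h)"
      using m_nonneg B by (intro sum_ennreal) auto
    also have "\<dots> < ennreal (\<epsilon> / 2)"
      using S0_tail[OF B] Suc.prems by (intro ennreal_lessI) auto
    finally show ?thesis .
  qed
  ultimately have ev2: "\<forall>\<^sub>F t in sequentially.
      (\<Sum>h \<in> ?B. of_nat (acnt h g) * (\<integral>\<^sup>+ c. of_nat (cnt c h) * a t c \<partial>count_space L)) < ennreal (\<epsilon> / 2)"
    by (rule order_tendstoD(2))
  have ev1: "\<forall>\<^sub>F t in sequentially. \<forall>h \<in> S1.
      (\<integral>\<^sup>+ c. of_nat (dcnt k c h) * a t c * indicator (- T h) c \<partial>count_space L) \<le> ennreal \<delta>"
    using T_tail S1(1) by (simp add: eventually_ball_finite_distrib)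
  show ?case
  proof (intro exI[of _ S] conjI)
    show "finite S" "S \<subseteq> L" using T S1 by (auto simp: S_def)
    show "\<forall>\<^sub>F t in sequentially.
      (\<integral>\<^sup>+ c. of_nat (dcnt (Suc k) c g) * a t c * indicator (- S) c \<partial>count_space L) \<le> ennreal \<epsilon>"
      using ev1 ev2
    proof eventually_elim
      case (elim t)
      have "(\<integral>\<^sup>+ c. of_nat (dcnt (Suc k) c g) * a t c * indicator (- S) c \<partial>count_space L) \<le>
        (\<integral>\<^sup>+ c. (\<Sum>h \<in> S1. of_nat (cnt h g) * (of_nat (dcnt k c h) * a t c * indicator (- T h) c)) +
          (\<Sum>h \<in> ?B. of_nat (acnt h g) * (of_nat (cnt c h) * a t c)) \<partial>count_space L)"
      proof (rule nn_integral_mono)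
        fix c assume "c \<in> space (count_space L)"
        then have c: "c \<in> L" by simp
        have le: "(of_nat (dcnt (Suc k) c g) :: ennreal) \<le>
            (\<Sum>h \<in> S1. of_nat (cnt h g) * of_nat (dcnt k c h)) + (\<Sum>h \<in> ?B. of_nat (acnt h g) * of_nat (cnt c h))"
        proof -
          have "dcnt (Suc k) c g \<le> (\<Sum>h \<in> S1. cnt h g * dcnt k c h) + (\<Sum>h \<in> ?B. acnt h g * cnt c h)"
            by (rule dcnt_Suc_le[OF L_sub L_down c S1(3,1) B(1)])
          then have "(of_nat (dcnt (Suc k) c g) :: ennreal) \<le>
            of_nat ((\<Sum>h \<in> S1. cnt h g * dcnt k c h) + (\<Sum>h \<in> ?B. acnt h g * cnt c h))"
            using of_nat_mono by blast
          then show ?thesis by simp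
        qed
        show "of_nat (dcnt (Suc k) c g) * a t c * indicator (- S) c \<le>
          (\<Sum>h \<in> S1. of_nat (cnt h g) * (of_nat (dcnt k c h) * a t c * indicator (- T h) c)) +
          (\<Sum>h \<in> ?B. of_nat (acnt h g) * (of_nat (cnt c h) * a t c))"
        proof (cases "c \<in> S")
          case False
          then have "c \<notin> T h" if "h \<in> S1" for h using that by (auto simp: S_def)
          then have "(\<Sum>h \<in> S1. of_nat (cnt h g) * (of_nat (dcnt k c h) * a t c * indicator (- T h) c)) +
              (\<Sum>h \<in> ?B. of_nat (acnt h g) * (of_nat (cnt c h) * a t c)) =
            ((\<Sum>h \<in> S1. of_nat (cnt h g) * of_nat (dcnt k c h)) +
              (\<Sum>h \<in> ?B. of_nat (acnt h g) * of_nat (cnt c h))) * a t c"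
            by (simp add: distrib_right sum_distrib_right mult.assoc)
          then show ?thesis using mult_right_mono[OF le, of "a t c"] False by simp
        qed simp
      qed
      also have "\<dots> = (\<Sum>h \<in> S1. of_nat (cnt h g) *
            (\<integral>\<^sup>+ c. of_nat (dcnt k c h) * a t c * indicator (- T h) c \<partial>count_space L)) +
          (\<Sum>h \<in> ?B. of_nat (acnt h g) * (\<integral>\<^sup>+ c. of_nat (cnt c h) * a t c \<partial>count_space L))"
        by (simp add: nn_integral_add nn_integral_sum nn_integral_cmult)
      also have "\<dots> \<le> (\<Sum>h \<in> S1. of_nat (cnt h g) * ennreal \<delta>) + ennreal (\<epsilon> / 2)"
        using elim by (intro add_mono sum_mono mult_left_mono) auto
      also have "(\<Sum>h \<in> S1. of_nat (cnt h g) * ennreal \<delta>) = ennreal ((\<Sum>h \<in> S1. real (cnt h g)) * \<delta>)"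
        using \<delta> by (simp add: sum_distrib_right[symmetric] ennreal_mult sum_nonneg ennreal_of_nat_eq_real_of_nat)
      also have "\<dots> \<le> ennreal (\<epsilon> / 2)"
      proof (rule ennreal_leI)
        have "(\<Sum>h \<in> S1. real (cnt h g)) * \<delta> \<le> K * \<delta>"
          using \<delta> by (simp add: K_def)
        then show "(\<Sum>h \<in> S1. real (cnt h g)) * \<delta> \<le> \<epsilon> / 2"
          using K by (simp add: \<delta>_def)
      qed
      also have "ennreal (\<epsilon> / 2) + ennreal (\<epsilon> / 2) = ennreal \<epsilon>"
        using Suc.prems by (simp add: ennreal_plus[symmetric] del: ennreal_plus)
      finally show ?case by (simp add: add_right_mono)
    qed
  qed
qed

text \<open>The depth bound of the level turns the count of quotients reached by \<open>n\<close>
  steps into the full count.\<close>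

lemma tight:
  assumes "g \<in> L" "0 < \<epsilon>"
  shows "\<exists>S. finite S \<and> S \<subseteq> L \<and> (\<forall>\<^sub>F t in sequentially.
      (\<integral>\<^sup>+ c. of_nat (cnt c g) * a t c * indicator (- S) c \<partial>count_space L) \<le> ennreal \<epsilon>)"
proof -
  have "dcnt n c g = cnt c g" if "c \<in> L" for c
    unfolding dcnt_def cnt_def using L_depth[OF that] by (intro arg_cong[of _ _ card]) auto
  then have "(\<integral>\<^sup>+ c. of_nat (dcnt n c g) * a t c * indicator (- S) c \<partial>count_space L) =
      (\<integral>\<^sup>+ c. of_nat (cnt c g) * a t c * indicator (- S) c \<partial>count_space L)" for t S
    by (intro nn_integral_cong) auto
  then show ?thesis using tight_depth[OF assms, of n] by simp
qed

lemma mobius_summable: "f \<in> L \<Longrightarrow> (\<lambda>h. \<bar>mobius_sum f h * m h\<bar>) summable_on L"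
proof -
  assume "f \<in> L"
  then have "(\<lambda>h. mobius_abs_sum f h * m h) summable_on L" by (rule m_summable)
  then show ?thesis
    by (rule summable_on_comparison_test)
      (use abs_mobius_sum_le m_nonneg in \<open>auto simp: abs_mult intro!: mult_right_mono\<close>)
qed

text \<open>For mass on finitely many types, Moebius inversion expresses \<open>a t F\<close> as a
  finite combination of moments. Tightness makes the remaining mass negligible in finitely many of
  the moments, and the other moments involved belong to a tail of the limit series.\<close>

lemma mass_limit:
  assumes F: "F \<in> L"
  shows "0 \<le> (\<Sum>\<^sub>\<infinity>h \<in> L. mobius_sum F h * m h)"
    and "(\<lambda>t. a t F) \<longlonglongrightarrow> ennreal (\<Sum>\<^sub>\<infinity>h \<in> L. mobius_sum F h * m h)"
proof -
  define v where "v = (\<Sum>\<^sub>\<infinity>h \<in> L. mobius_sum F h * m h)"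
  define M where "M t h = enn2real (\<integral>\<^sup>+ c. of_nat (cnt c h) * a t c \<partial>count_space L)" for t h
  have fin_ev: "\<forall>\<^sub>F t in sequentially. (\<integral>\<^sup>+ c. of_nat (cnt c h) * a t c \<partial>count_space L) < \<infinity>" if "h \<in> L" for h
    using order_tendstoD(2)[OF moments[OF that], of \<infinity>] by simp
  have M_lim: "(\<lambda>t. M t h) \<longlonglongrightarrow> m h" if "h \<in> L" for h
    unfolding M_def using tendsto_enn2real[OF moments[OF that]] m_nonneg[OF that] by simp
  have point: "of_nat (cnt c h) * a t c \<le> (\<integral>\<^sup>+ c. of_nat (cnt c h) * a t c \<partial>count_space L)" if "c \<in> L" for c h t
    using nn_integral_ge_point[OF that, of "\<lambda>c. of_nat (cnt c h) * a t c"] .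
  have fin_aF: "\<forall>\<^sub>F t in sequentially. a t F < \<infinity>"
    using fin_ev[OF F]
  proof eventually_elim
    case (elim t)
    have "a t F \<le> of_nat (cnt F F) * a t F"
      using cnt_self_pos[of F] F L_sub mult_right_mono[of 1 "of_nat (cnt F F)" "a t F"] by auto
    then show ?case using point[OF F, of F t] elim by (meson le_less_trans)
  qed
  have "(\<lambda>t. enn2real (a t F)) \<longlonglongrightarrow> v"
  proof (rule tendstoI)
    fix \<epsilon>' :: real assume "0 < \<epsilon>'"
    \<comment> \<open>Four errors of size \<open>\<epsilon>\<close> are added up below: moments
      against limits on \<open>T'\<close>, truncation of the series to \<open>T'\<close>, and the
      mass outside \<open>S'\<close> as seen by \<open>T\<close> and by \<open>T' - T\<close>. The
      fifth part is slack.\<close>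
    define \<epsilon> where "\<epsilon> = \<epsilon>' / 5"
    have \<epsilon>: "0 < \<epsilon>" using \<open>0 < \<epsilon>'\<close> by (simp add: \<epsilon>_def)
    note absum = mobius_summable[OF F]
    obtain T where T: "finite T" "T \<subseteq> L"
      and T_tail: "\<And>D. \<lbrakk>finite D; D \<subseteq> L - T\<rbrakk> \<Longrightarrow> \<bar>\<Sum>h \<in> D. \<bar>mobius_sum F h * m h\<bar>\<bar> < \<epsilon>"
      using summable_on_small_tail[OF absum \<epsilon>] by blast
    define K where "K = (\<Sum>h \<in> T. \<bar>mobius_sum F h\<bar>) + 1"
    have K: "K > 0" by (simp add: K_def sum_nonneg add_nonneg_pos)
    define \<delta> where "\<delta> = \<epsilon> / K"
    have \<delta>: "\<delta> > 0" using K \<epsilon> by (simp add: \<delta>_def)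
    have "\<forall>h \<in> T. \<exists>S. finite S \<and> S \<subseteq> L \<and> (\<forall>\<^sub>F t in sequentially.
        (\<integral>\<^sup>+ c. of_nat (cnt c h) * a t c * indicator (- S) c \<partial>count_space L) \<le> ennreal \<delta>)"
      using tight[OF _ \<delta>] T by blast
    then obtain S where S: "\<forall>h \<in> T. finite (S h) \<and> S h \<subseteq> L \<and> (\<forall>\<^sub>F t in sequentially.
        (\<integral>\<^sup>+ c. of_nat (cnt c h) * a t c * indicator (- S h) c \<partial>count_space L) \<le> ennreal \<delta>)"
      unfolding bchoice_iff by (elim exE)
    define S' where "S' = insert F (\<Union>h \<in> T. S h)"
    have S': "finite S'" "S' \<subseteq> L" "F \<in> S'" using S T F by (auto simp: S'_def)
    \<comment> \<open>Inversion at each \<open>c\<close> in \<open>S'\<close> involves all types of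
      quotients of \<open>c\<close>, which forces an enlargement of \<open>T\<close>. For the new
      types no smallness of \<open>R t h\<close> is known; there it is bounded by the full moment,
      and the weighted moments of the new types tend to less than \<open>\<epsilon>\<close> by the
      choice of \<open>T\<close>.\<close>
    define T' where "T' = T \<union> (\<Union>c \<in> S'. ty ` carrier (Q c))"
    have T': "finite T'" "T' \<subseteq> L" "T \<subseteq> T'"
      using T S' L_down finite_carrier L_sub by (auto simp: T'_def)
    define R where "R t h = (\<integral>\<^sup>+ c. of_nat (cnt c h) * a t c * indicator (- S') c \<partial>count_space L)" for t h
    have tails: "\<forall>\<^sub>F t in sequentially. \<forall>h \<in> T. R t h \<le> ennreal \<delta>"
    proof (subst eventually_ball_finite_distrib[OF T(1)], intro ballI)
      fix h assume h: "h \<in> T"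
      have "\<forall>\<^sub>F t in sequentially.
        (\<integral>\<^sup>+ c. of_nat (cnt c h) * a t c * indicator (- S h) c \<partial>count_space L) \<le> ennreal \<delta>"
        using S h by blast
      then show "\<forall>\<^sub>F t in sequentially. R t h \<le> ennreal \<delta>"
      proof eventually_elim
        case (elim t)
        have "R t h \<le> (\<integral>\<^sup>+ c. of_nat (cnt c h) * a t c * indicator (- S h) c \<partial>count_space L)"
          unfolding R_def using h
          by (intro nn_integral_mono mult_left_mono) (auto simp: S'_def indicator_def)
        then show ?case using elim by (rule order_trans)
      qed
    qed
    have fins: "\<forall>\<^sub>F t in sequentially. \<forall>h \<in> T'. (\<integral>\<^sup>+ c. of_nat (cnt c h) * a t c \<partial>count_space L) < \<infinity>"
      using fin_ev T' by (subst eventually_ball_finite_distrib) auto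
    have "(\<lambda>t. \<Sum>h \<in> T'. mobius_sum F h * M t h) \<longlonglongrightarrow> (\<Sum>h \<in> T'. mobius_sum F h * m h)"
      using T' by (intro tendsto_sum tendsto_mult_left M_lim) auto
    then have close1: "\<forall>\<^sub>F t in sequentially. \<bar>(\<Sum>h \<in> T'. mobius_sum F h * M t h) - (\<Sum>h \<in> T'. mobius_sum F h * m h)\<bar> < \<epsilon>"
      using \<epsilon> by (auto dest: tendstoD simp: dist_real_def)
    have "(\<lambda>t. \<Sum>h \<in> T' - T. \<bar>mobius_sum F h\<bar> * M t h) \<longlonglongrightarrow> (\<Sum>h \<in> T' - T. \<bar>mobius_sum F h\<bar> * m h)"
      using T' by (intro tendsto_sum tendsto_mult_left M_lim) auto
    moreover have "(\<Sum>h \<in> T' - T. \<bar>mobius_sum F h\<bar> * m h) < \<epsilon>"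
    proof -
      have "(\<Sum>h \<in> T' - T. \<bar>mobius_sum F h\<bar> * m h) = (\<Sum>h \<in> T' - T. \<bar>mobius_sum F h * m h\<bar>)"
        using m_nonneg T' by (intro sum.cong) (auto simp: abs_mult)
      also have "\<dots> < \<epsilon>" using T_tail[of "T' - T"] T' by auto
      finally show ?thesis .
    qed
    ultimately have close2: "\<forall>\<^sub>F t in sequentially. (\<Sum>h \<in> T' - T. \<bar>mobius_sum F h\<bar> * M t h) < \<epsilon>"
      by (rule order_tendstoD(2))
    have close3: "\<bar>(\<Sum>h \<in> T'. mobius_sum F h * m h) - v\<bar> \<le> \<epsilon>"
    proof -
      have sm: "(\<lambda>h. mobius_sum F h * m h) summable_on L"
        by (rule Infinite_Sum.abs_summable_summable) (use absum in \<open>simp only: real_norm_def\<close>)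
      have "((\<lambda>D. \<Sum>h \<in> D. mobius_sum F h * m h) \<longlongrightarrow> v) (finite_subsets_at_top L)"
        using has_sum_infsum[OF sm] unfolding v_def has_sum_def .
      then have "((\<lambda>D. \<bar>(\<Sum>h \<in> T'. mobius_sum F h * m h) - (\<Sum>h \<in> D. mobius_sum F h * m h)\<bar>) \<longlongrightarrow>
          \<bar>(\<Sum>h \<in> T'. mobius_sum F h * m h) - v\<bar>) (finite_subsets_at_top L)"
        by (intro tendsto_intros)
      then show ?thesis
      proof (rule tendsto_upperbound)
        show "\<forall>\<^sub>F D in finite_subsets_at_top L. \<bar>(\<Sum>h \<in> T'. mobius_sum F h * m h) - (\<Sum>h \<in> D. mobius_sum F h * m h)\<bar> \<le> \<epsilon>"
          unfolding eventually_finite_subsets_at_top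
        proof (intro exI[of _ T'] conjI allI impI)
          fix D assume D: "finite D \<and> T' \<subseteq> D \<and> D \<subseteq> L"
          then have "(\<Sum>h \<in> D. mobius_sum F h * m h) = (\<Sum>h \<in> T'. mobius_sum F h * m h) + (\<Sum>h \<in> D - T'. mobius_sum F h * m h)"
            using sum.subset_diff[of T' D "\<lambda>h. mobius_sum F h * m h"] by auto
          moreover have "\<bar>\<Sum>h \<in> D - T'. mobius_sum F h * m h\<bar> \<le> (\<Sum>h \<in> D - T'. \<bar>mobius_sum F h * m h\<bar>)"
            by (rule sum_abs)
          moreover have "(\<Sum>h \<in> D - T'. \<bar>mobius_sum F h * m h\<bar>) < \<epsilon>"
            using T_tail[of "D - T'"] D T' by auto
          ultimately show "\<bar>(\<Sum>h \<in> T'. mobius_sum F h * m h) - (\<Sum>h \<in> D. mobius_sum F h * m h)\<bar> \<le> \<epsilon>"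
            by linarith
        qed (use T' in auto)
      qed simp
    qed
    show "\<forall>\<^sub>F t in sequentially. dist (enn2real (a t F)) v < \<epsilon>'"
      using tails fins close1 close2
    proof eventually_elim
      case (elim t)
      have split: "M t h = (\<Sum>c \<in> S'. real (cnt c h) * enn2real (a t c)) + enn2real (R t h)" if h: "h \<in> T'" for h
      proof -
        have fin: "(\<integral>\<^sup>+ c. of_nat (cnt c h) * a t c \<partial>count_space L) < \<infinity>" using elim h by auto
        have "(\<integral>\<^sup>+ c. of_nat (cnt c h) * a t c \<partial>count_space L) =
            (\<integral>\<^sup>+ c. of_nat (cnt c h) * a t c * indicator S' c +
              of_nat (cnt c h) * a t c * indicator (- S') c \<partial>count_space L)"
          by (intro nn_integral_cong) (auto simp: indicator_def)
        also have "\<dots> = (\<integral>\<^sup>+ c. of_nat (cnt c h) * a t c * indicator S' c \<partial>count_space L) + R t h"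
          unfolding R_def by (rule nn_integral_add) auto
        also have "(\<integral>\<^sup>+ c. of_nat (cnt c h) * a t c * indicator S' c \<partial>count_space L) =
            (\<Sum>c \<in> S'. of_nat (cnt c h) * a t c)"
        proof (subst nn_integral_count_space'[of S'])
          show "finite S'" "S' \<subseteq> L" by fact+
        qed (auto simp: indicator_def)
        finally have eq: "(\<integral>\<^sup>+ c. of_nat (cnt c h) * a t c \<partial>count_space L) =
            (\<Sum>c \<in> S'. of_nat (cnt c h) * a t c) + R t h" .
        then have f1: "(\<Sum>c \<in> S'. of_nat (cnt c h) * a t c) < \<infinity>" "R t h < \<infinity>"
          using fin by auto
        have f2: "of_nat (cnt c h) * a t c < \<infinity>" if "c \<in> S'" for c
          using point[of c h t] fin that S' by (auto intro: le_less_trans)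
        have "M t h = enn2real (\<Sum>c \<in> S'. of_nat (cnt c h) * a t c) + enn2real (R t h)"
          unfolding M_def eq using f1 by (intro enn2real_plus) auto
        also have "enn2real (\<Sum>c \<in> S'. of_nat (cnt c h) * a t c) = (\<Sum>c \<in> S'. enn2real (of_nat (cnt c h) * a t c))"
          using enn2real_sum[of S' "\<lambda>c. of_nat (cnt c h) * a t c"] f2 by simp
        finally show ?thesis by (simp add: enn2real_mult)
      qed
      have "(\<Sum>h \<in> T'. mobius_sum F h * M t h) =
          (\<Sum>h \<in> T'. \<Sum>c \<in> S'. mobius_sum F h * (real (cnt c h) * enn2real (a t c))) + (\<Sum>h \<in> T'. mobius_sum F h * enn2real (R t h))"
        by (simp add: split distrib_left sum.distrib sum_distrib_left)
      also have "(\<Sum>h \<in> T'. \<Sum>c \<in> S'. mobius_sum F h * (real (cnt c h) * enn2real (a t c))) =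
          (\<Sum>c \<in> S'. (\<Sum>h \<in> T'. mobius_sum F h * real (cnt c h)) * enn2real (a t c))"
        by (subst sum.swap) (simp add: sum_distrib_right mult.assoc)
      also have "\<dots> = (\<Sum>c \<in> S'. if c = F then enn2real (a t c) else 0)"
      proof (intro sum.cong refl)
        fix c assume c: "c \<in> S'"
        have "(\<Sum>h \<in> T'. mobius_sum F h * real (cnt c h)) = (if c = F then 1 else 0)"
          using c S' L_sub by (intro mobius_inversion T'(1)) (auto simp: T'_def)
        then show "(\<Sum>h \<in> T'. mobius_sum F h * real (cnt c h)) * enn2real (a t c) = (if c = F then enn2real (a t c) else 0)"
          by simp
      qed
      also have "\<dots> = enn2real (a t F)" using S' by simp
      also have "(\<Sum>h \<in> T'. mobius_sum F h * enn2real (R t h)) =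
          (\<Sum>h \<in> T. mobius_sum F h * enn2real (R t h)) + (\<Sum>h \<in> T' - T. mobius_sum F h * enn2real (R t h))"
        using sum.subset_diff[OF T'(3,1), of "\<lambda>h. mobius_sum F h * enn2real (R t h)"] by simp
      finally have main: "(\<Sum>h \<in> T'. mobius_sum F h * M t h) = enn2real (a t F) +
          ((\<Sum>h \<in> T. mobius_sum F h * enn2real (R t h)) + (\<Sum>h \<in> T' - T. mobius_sum F h * enn2real (R t h)))" .
      have "\<bar>\<Sum>h \<in> T. mobius_sum F h * enn2real (R t h)\<bar> \<le> (\<Sum>h \<in> T. \<bar>mobius_sum F h\<bar> * \<delta>)"
      proof (rule order_trans[OF sum_abs sum_mono])
        fix h assume h: "h \<in> T"
        have "enn2real (R t h) \<le> \<delta>"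
          using elim h \<delta> by (intro enn2real_leI) auto
        then show "\<bar>mobius_sum F h * enn2real (R t h)\<bar> \<le> \<bar>mobius_sum F h\<bar> * \<delta>"
          by (simp add: abs_mult mult_left_mono)
      qed
      also have "\<dots> \<le> K * \<delta>"
        using \<delta> by (simp add: K_def sum_distrib_right[symmetric])
      also have "\<dots> = \<epsilon>" using K by (simp add: \<delta>_def)
      finally have e1: "\<bar>\<Sum>h \<in> T. mobius_sum F h * enn2real (R t h)\<bar> \<le> \<epsilon>" .
      have "\<bar>\<Sum>h \<in> T' - T. mobius_sum F h * enn2real (R t h)\<bar> \<le> (\<Sum>h \<in> T' - T. \<bar>mobius_sum F h\<bar> * M t h)"
      proof (rule order_trans[OF sum_abs sum_mono])
        fix h assume h: "h \<in> T' - T"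
        have "enn2real (R t h) \<le> M t h"
          using split[of h] h by (auto intro!: sum_nonneg)
        then show "\<bar>mobius_sum F h * enn2real (R t h)\<bar> \<le> \<bar>mobius_sum F h\<bar> * M t h"
          by (simp add: abs_mult mult_left_mono)
      qed
      then have e2: "\<bar>\<Sum>h \<in> T' - T. mobius_sum F h * enn2real (R t h)\<bar> < \<epsilon>" using elim by linarith
      have "\<bar>(\<Sum>h \<in> T'. mobius_sum F h * M t h) - (\<Sum>h \<in> T'. mobius_sum F h * m h)\<bar> < \<epsilon>" using elim by blast
      then have "\<bar>enn2real (a t F) - v\<bar> < 5 * \<epsilon>"
        using e1 e2 close3 main \<epsilon> by linarith
      then show ?case by (simp add: dist_real_def \<epsilon>_def)
    qed
  qed
  moreover from this show "0 \<le> (\<Sum>\<^sub>\<infinity>h \<in> L. mobius_sum F h * m h)"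
    unfolding v_def by (rule tendsto_lowerbound) auto
  ultimately have "(\<lambda>t. ennreal (enn2real (a t F))) \<longlonglongrightarrow> ennreal v"
    by (intro tendsto_ennrealI)
  moreover have "\<forall>\<^sub>F t in sequentially. ennreal (enn2real (a t F)) = a t F"
    using fin_aF by eventually_elim (simp add: ennreal_enn2real_if)
  ultimately show "(\<lambda>t. a t F) \<longlonglongrightarrow> ennreal (\<Sum>\<^sub>\<infinity>h \<in> L. mobius_sum F h * m h)"
    unfolding v_def by (rule Lim_transform_eventually)
qed

text \<open>One inequality is Fatou's lemma, the other is tightness.\<close>

lemma mass_sum:
  assumes g: "g \<in> L" and e: "\<And>c. c \<in> L \<Longrightarrow> e c \<le> cnt c g"
    and lim: "(\<lambda>t. \<integral>\<^sup>+ c. of_nat (e c) * a t c \<partial>count_space L) \<longlonglongrightarrow> s"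
  shows "(\<integral>\<^sup>+ c. of_nat (e c) * ennreal (\<Sum>\<^sub>\<infinity>h \<in> L. mobius_sum c h * m h) \<partial>count_space L) = s"
proof (rule antisym)
  define v where "v c = ennreal (\<Sum>\<^sub>\<infinity>h \<in> L. mobius_sum c h * m h)" for c
  have lim_c: "(\<lambda>t. of_nat (e c) * a t c) \<longlonglongrightarrow> of_nat (e c) * v c" if "c \<in> L" for c
    unfolding v_def by (intro ennreal_tendsto_cmult mass_limit(2) that) (simp add: less_top[symmetric])
  have "(\<integral>\<^sup>+ c. of_nat (e c) * v c \<partial>count_space L) =
      (\<integral>\<^sup>+ c. liminf (\<lambda>t. of_nat (e c) * a t c) \<partial>count_space L)"
    using lim_imp_Liminf[OF _ lim_c] by (intro nn_integral_cong) (simp add: v_def)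
  also have "\<dots> \<le> liminf (\<lambda>t. \<integral>\<^sup>+ c. of_nat (e c) * a t c \<partial>count_space L)"
    by (rule nn_integral_liminf) auto
  also have "\<dots> = s" using lim_imp_Liminf[OF _ lim] by simp
  finally show "(\<integral>\<^sup>+ c. of_nat (e c) * ennreal (\<Sum>\<^sub>\<infinity>h \<in> L. mobius_sum c h * m h) \<partial>count_space L) \<le> s"
    by (simp add: v_def)
  show "s \<le> (\<integral>\<^sup>+ c. of_nat (e c) * ennreal (\<Sum>\<^sub>\<infinity>h \<in> L. mobius_sum c h * m h) \<partial>count_space L)"
  proof (rule ennreal_le_epsilon)
    fix \<epsilon> :: real assume \<epsilon>: "0 < \<epsilon>"
    obtain S where S: "finite S" "S \<subseteq> L" and S_tail: "\<forall>\<^sub>F t in sequentially.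
        (\<integral>\<^sup>+ c. of_nat (cnt c g) * a t c * indicator (- S) c \<partial>count_space L) \<le> ennreal \<epsilon>"
      using tight[OF g \<epsilon>] by blast
    have finsum: "(\<integral>\<^sup>+ c. f c * indicator S c \<partial>count_space L) = (\<Sum>c \<in> S. f c)" for f :: "'c \<Rightarrow> ennreal"
      using S by (subst nn_integral_count_space'[of S]) (auto simp: indicator_def)
    have "(\<lambda>t. (\<Sum>c \<in> S. of_nat (e c) * a t c) + ennreal \<epsilon>) \<longlonglongrightarrow> (\<Sum>c \<in> S. of_nat (e c) * v c) + ennreal \<epsilon>"
      using S by (intro tendsto_add tendsto_sum lim_c tendsto_const) auto
    moreover have "\<forall>\<^sub>F t in sequentially. (\<integral>\<^sup>+ c. of_nat (e c) * a t c \<partial>count_space L) \<le>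
        (\<Sum>c \<in> S. of_nat (e c) * a t c) + ennreal \<epsilon>"
      using S_tail
    proof eventually_elim
      case (elim t)
      have "(\<integral>\<^sup>+ c. of_nat (e c) * a t c \<partial>count_space L) =
          (\<integral>\<^sup>+ c. of_nat (e c) * a t c * indicator S c + of_nat (e c) * a t c * indicator (- S) c \<partial>count_space L)"
        by (intro nn_integral_cong) (auto simp: indicator_def)
      also have "\<dots> = (\<Sum>c \<in> S. of_nat (e c) * a t c) +
          (\<integral>\<^sup>+ c. of_nat (e c) * a t c * indicator (- S) c \<partial>count_space L)"
        by (subst nn_integral_add) (auto simp: finsum)
      \<comment> \<open>Domination of \<open>e\<close> by the count at \<open>g\<close> lets the
        tightness set for \<open>g\<close> serve for the weights \<open>e\<close>.\<close>
      also have "(\<integral>\<^sup>+ c. of_nat (e c) * a t c * indicator (- S) c \<partial>count_space L) \<le>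
          (\<integral>\<^sup>+ c. of_nat (cnt c g) * a t c * indicator (- S) c \<partial>count_space L)"
        using e by (intro nn_integral_mono mult_right_mono) auto
      also note elim
      finally show ?case by (simp add: add_left_mono)
    qed
    ultimately have "s \<le> (\<Sum>c \<in> S. of_nat (e c) * v c) + ennreal \<epsilon>"
      using lim by (intro tendsto_le[OF trivial_limit_sequentially])
    also have "(\<Sum>c \<in> S. of_nat (e c) * v c) \<le> (\<integral>\<^sup>+ c. of_nat (e c) * v c \<partial>count_space L)"
      unfolding finsum[symmetric] by (intro nn_integral_mono) (auto simp: indicator_def)
    finally show "s \<le> (\<integral>\<^sup>+ c. of_nat (e c) * ennreal (\<Sum>\<^sub>\<infinity>h \<in> L. mobius_sum c h * m h) \<partial>count_space L) + ennreal \<epsilon>"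
      by (simp add: v_def add_right_mono)
  qed
qed

end

section \<open>Quotients in a category\<close>

context category
begin

lemma HomD: "f \<in> Hom C A B \<Longrightarrow> f \<in> Arr C \<and> Dom C f = A \<and> Cod C f = B \<and> A \<in> Obj C \<and> B \<in> Obj C"
  using Dom_in_Obj Cod_in_Obj by (auto simp: Hom_def)

lemma epi_Hom: "epi C f \<Longrightarrow> f \<in> Hom C (Dom C f) (Cod C f)"
  by (simp add: epi_def Hom_def)

lemma epi_cancel:
  assumes "epi C f" "f \<in> Hom C A B" "g \<in> Hom C B T" "h \<in> Hom C B T" "Comp C g f = Comp C h f"
  shows "g = h"
  using assms HomD[OF assms(2)] HomD[OF assms(3)] unfolding epi_def by blast

lemma epiI:
  assumes "f \<in> Hom C A B"
    and "\<And>T g h. \<lbrakk>g \<in> Hom C B T; h \<in> Hom C B T; Comp C g f = Comp C h f\<rbrakk> \<Longrightarrow> g = h"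
  shows "epi C f"
  using assms HomD[OF assms(1)] unfolding epi_def by blast

lemma epi_Comp:
  assumes f: "epi C f" "f \<in> Hom C A B" and g: "epi C g" "g \<in> Hom C B D"
  shows "epi C (Comp C g f)"
proof (rule epiI[OF Comp_in_Hom[OF f(2) g(2)]])
  fix T h k assume h: "h \<in> Hom C D T" and k: "k \<in> Hom C D T"
    and eq: "Comp C h (Comp C g f) = Comp C k (Comp C g f)"
  then have "Comp C (Comp C h g) f = Comp C (Comp C k g) f"
    using Comp_assoc[OF f(2) g(2)] by simp
  then have "Comp C h g = Comp C k g"
    using epi_cancel[OF f Comp_in_Hom[OF g(2) h] Comp_in_Hom[OF g(2) k]] by simp
  then show "h = k" using epi_cancel[OF g h k] by simp
qed

lemma epi_of_Comp:
  assumes f: "f \<in> Hom C A B" and g: "g \<in> Hom C B D" and "epi C (Comp C g f)"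
  shows "epi C g"
proof (rule epiI[OF g])
  fix T h k assume h: "h \<in> Hom C D T" and k: "k \<in> Hom C D T" and eq: "Comp C h g = Comp C k g"
  then have "Comp C h (Comp C g f) = Comp C k (Comp C g f)"
    using Comp_assoc[OF f g] by simp
  then show "h = k" using epi_cancel[OF assms(3) Comp_in_Hom[OF f g] h k] by simp
qed

lemma isoE:
  assumes "iso C f" "f \<in> Hom C A B"
  obtains g where "g \<in> Hom C B A" "iso C g" "Comp C g f = Ident C A" "Comp C f g = Ident C B"
proof -
  have d: "Dom C f = A" "Cod C f = B" using HomD[OF assms(2)] by auto
  obtain g where g: "g \<in> Hom C B A" "Comp C g f = Ident C A" "Comp C f g = Ident C B"
    using assms(1) d unfolding iso_def by auto
  moreover have "iso C g"
    unfolding iso_def using g assms(2) HomD[OF g(1)] by auto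
  ultimately show ?thesis using that by blast
qed

lemma isoI:
  assumes "f \<in> Hom C A B" "g \<in> Hom C B A" "Comp C g f = Ident C A" "Comp C f g = Ident C B"
  shows "iso C f"
  using assms HomD[OF assms(1)] unfolding iso_def by auto

lemma iso_Ident: "A \<in> Obj C \<Longrightarrow> iso C (Ident C A)"
  by (rule isoI[of _ A A "Ident C A"]) (simp_all add: Ident_in_Hom Comp_Ident_left[OF Ident_in_Hom])

lemma iso_Comp:
  assumes f: "iso C f" "f \<in> Hom C A B" and g: "iso C g" "g \<in> Hom C B D"
  shows "iso C (Comp C g f)"
proof -
  obtain f' where f': "f' \<in> Hom C B A" "Comp C f' f = Ident C A" "Comp C f f' = Ident C B"
    using isoE[OF f] by blast
  obtain g' where g': "g' \<in> Hom C D B" "Comp C g' g = Ident C B" "Comp C g g' = Ident C D"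
    using isoE[OF g] by blast
  note H = Comp_in_Hom[OF f(2) g(2)] Comp_in_Hom[OF g'(1) f'(1)]
  have "Comp C (Comp C f' g') (Comp C g f) = Comp C f' (Comp C g' (Comp C g f))"
    using Comp_assoc[OF H(1) g'(1) f'(1)] by simp
  also have "Comp C g' (Comp C g f) = f"
    using Comp_assoc[OF f(2) g(2) g'(1)] g' Comp_Ident_left[OF f(2)] by simp
  finally have 1: "Comp C (Comp C f' g') (Comp C g f) = Ident C A" using f' by simp
  have "Comp C (Comp C g f) (Comp C f' g') = Comp C g (Comp C f (Comp C f' g'))"
    using Comp_assoc[OF H(2) f(2) g(2)] by simp
  also have "Comp C f (Comp C f' g') = g'"
    using Comp_assoc[OF g'(1) f'(1) f(2)] f' Comp_Ident_left[OF g'(1)] by simp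
  finally have 2: "Comp C (Comp C g f) (Comp C f' g') = Ident C D" using g' by simp
  show ?thesis by (rule isoI[OF H 1 2])
qed

lemma iso_imp_epi:
  assumes f: "iso C f" "f \<in> Hom C A B"
  shows "epi C f"
proof (rule epiI[OF f(2)])
  fix T g h assume g: "g \<in> Hom C B T" and h: "h \<in> Hom C B T" and eq: "Comp C g f = Comp C h f"
  obtain f' where f': "f' \<in> Hom C B A" "Comp C f f' = Ident C B"
    using isoE[OF f] by blast
  have "g = Comp C (Comp C g f) f'"
    using Comp_assoc[OF f'(1) f(2) g] f'(2) Comp_Ident_right[OF g] by simp
  also have "\<dots> = h"
    using Comp_assoc[OF f'(1) f(2) h] f'(2) Comp_Ident_right[OF h] eq by simp
  finally show "g = h" .
qed

lemma equiv_iso_rel: "equiv (Obj C) (iso_rel C)"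
proof (rule equivI)
  show "iso_rel C \<subseteq> Obj C \<times> Obj C" by (auto simp: iso_rel_def)
  show "refl_on (Obj C) (iso_rel C)"
    using iso_Ident Ident_in_Hom by (auto simp: refl_on_def iso_rel_def)
  show "sym (iso_rel C)"
  proof (rule symI)
    fix A B assume "(A, B) \<in> iso_rel C"
    then obtain f where f: "A \<in> Obj C" "B \<in> Obj C" "f \<in> Hom C A B" "iso C f"
      by (auto simp: iso_rel_def)
    obtain g where "g \<in> Hom C B A" "iso C g" by (rule isoE[OF f(4,3)])
    then show "(B, A) \<in> iso_rel C" using f by (auto simp: iso_rel_def)
  qed
  show "trans (iso_rel C)"
    unfolding trans_def iso_rel_def using iso_Comp Comp_in_Hom by fastforce
qed

lemma iso_class_self: "A \<in> Obj C \<Longrightarrow> A \<in> iso_class C A"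
  unfolding iso_class_def using equiv_class_self[OF equiv_iso_rel] .

lemma iso_class_in: "A \<in> Obj C \<Longrightarrow> iso_class C A \<in> Obj C // iso_rel C"
  unfolding iso_class_def by (rule quotientI)

lemma rep_in: "c \<in> Obj C // iso_rel C \<Longrightarrow> rep c \<in> c"
  unfolding rep_def using in_quotient_imp_non_empty[OF equiv_iso_rel] some_in_eq by blast

lemma rep_Obj: "c \<in> Obj C // iso_rel C \<Longrightarrow> rep c \<in> Obj C"
  using rep_in in_quotient_imp_subset[OF equiv_iso_rel] by blast

lemma iso_class_member:
  assumes "c \<in> Obj C // iso_rel C" "A \<in> c"
  shows "iso_class C A = c" "A \<in> Obj C"
proof -
  show A: "A \<in> Obj C" using assms in_quotient_imp_subset[OF equiv_iso_rel] by blast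
  have "iso_class C A \<in> Obj C // iso_rel C" "A \<in> iso_class C A"
    using A iso_class_in iso_class_self by auto
  then show "iso_class C A = c"
    using assms quotient_disj[OF equiv_iso_rel] by blast
qed

lemma iso_class_rep: "c \<in> Obj C // iso_rel C \<Longrightarrow> iso_class C (rep c) = c"
  using iso_class_member rep_in by blast

lemma iso_rel_imp_Hom:
  assumes "(A, B) \<in> iso_rel C"
  obtains f where "f \<in> Hom C A B" "iso C f"
  using assms by (auto simp: iso_rel_def)

lemma quotsD:
  "\<pi> \<in> quots C G \<Longrightarrow> epi C \<pi> \<and> \<pi> \<in> Hom C G (Cod C \<pi>) \<and> Dom C \<pi> = G \<and> G \<in> Obj C \<and> Cod C \<pi> \<in> Obj C"
proof -
  assume "\<pi> \<in> quots C G"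
  then have "epi C \<pi>" "Dom C \<pi> = G" by (auto simp: quots_def)
  then show ?thesis using epi_Hom[of \<pi>] HomD[of \<pi> G "Cod C \<pi>"] by auto
qed

lemma quotsI: "\<lbrakk>epi C \<pi>; \<pi> \<in> Hom C G F\<rbrakk> \<Longrightarrow> \<pi> \<in> quots C G"
  using HomD by (auto simp: quots_def)

lemma quots_Ident: "G \<in> Obj C \<Longrightarrow> Ident C G \<in> quots C G"
  using quotsI[OF iso_imp_epi[OF iso_Ident Ident_in_Hom] Ident_in_Hom] by blast

lemma quots_iso_Comp:
  "\<lbrakk>\<pi> \<in> quots C G; iso C \<rho>; \<rho> \<in> Hom C (Cod C \<pi>) B\<rbrakk> \<Longrightarrow> Comp C \<rho> \<pi> \<in> quots C G"
  using quotsD quotsI[OF epi_Comp Comp_in_Hom] iso_imp_epi by meson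

lemma equiv_quot_iso: "equiv (quots C G) (quot_iso C G)"
proof (rule equivI)
  show "quot_iso C G \<subseteq> quots C G \<times> quots C G" by (auto simp: quot_iso_def)
  show "refl_on (quots C G) (quot_iso C G)"
  proof (rule refl_onI)
    fix \<pi> assume q: "\<pi> \<in> quots C G"
    then have "\<pi> \<in> Hom C G (Cod C \<pi>)" "Cod C \<pi> \<in> Obj C" using quotsD by blast+
    then show "(\<pi>, \<pi>) \<in> quot_iso C G"
      using q iso_Ident Ident_in_Hom Comp_Ident_left[of \<pi> G "Cod C \<pi>"]
      by (auto simp: quot_iso_def intro!: bexI[of _ "Ident C (Cod C \<pi>)"])
  qed
  show "sym (quot_iso C G)"
    unfolding sym_def
  proof (intro allI impI)
    fix \<pi> \<pi>' assume "(\<pi>, \<pi>') \<in> quot_iso C G"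
    then obtain \<rho> where q: "\<pi> \<in> quots C G" "\<pi>' \<in> quots C G"
      and \<rho>: "\<rho> \<in> Hom C (Cod C \<pi>) (Cod C \<pi>')" "iso C \<rho>" "\<pi>' = Comp C \<rho> \<pi>"
      by (auto simp: quot_iso_def)
    obtain \<sigma> where \<sigma>: "\<sigma> \<in> Hom C (Cod C \<pi>') (Cod C \<pi>)" "iso C \<sigma>" "Comp C \<sigma> \<rho> = Ident C (Cod C \<pi>)"
      using isoE[OF \<rho>(2,1)] by blast
    have h: "\<pi> \<in> Hom C G (Cod C \<pi>)" using quotsD q by blast
    have "Comp C \<sigma> \<pi>' = \<pi>"
      using Comp_assoc[OF h \<rho>(1) \<sigma>(1)] \<rho>(3) \<sigma>(3) Comp_Ident_left[OF h] by simp
    then show "(\<pi>', \<pi>) \<in> quot_iso C G"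
      using q \<sigma> by (auto simp: quot_iso_def)
  qed
  show "trans (quot_iso C G)"
    unfolding trans_def
  proof (intro allI impI)
    fix x y z assume "(x, y) \<in> quot_iso C G" "(y, z) \<in> quot_iso C G"
    then obtain \<rho> \<sigma> where q: "x \<in> quots C G" "y \<in> quots C G" "z \<in> quots C G"
      and \<rho>: "\<rho> \<in> Hom C (Cod C x) (Cod C y)" "iso C \<rho>" "y = Comp C \<rho> x"
      and \<sigma>: "\<sigma> \<in> Hom C (Cod C y) (Cod C z)" "iso C \<sigma>" "z = Comp C \<sigma> y"
      by (auto simp: quot_iso_def)
    have h: "x \<in> Hom C G (Cod C x)" using quotsD q by blast
    have "z = Comp C (Comp C \<sigma> \<rho>) x" using Comp_assoc[OF h \<rho>(1) \<sigma>(1)] \<rho>(3) \<sigma>(3) by simp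
    then show "(x, z) \<in> quot_iso C G"
      using q iso_Comp[OF \<rho>(2,1) \<sigma>(2,1)] Comp_in_Hom[OF \<rho>(1) \<sigma>(1)] by (auto simp: quot_iso_def)
  qed
qed

lemma carrier_quot_poset: "carrier (quot_poset C G) = qclass C ` quots C G"
  using quotsD by (auto simp: quot_poset_def quotient_def qclass_def)

lemma qclass_self: "\<pi> \<in> quots C G \<Longrightarrow> \<pi> \<in> qclass C \<pi>"
  using quotsD[of \<pi> G] equiv_class_self[OF equiv_quot_iso] by (auto simp: qclass_def)

lemma qclass_carrier: "\<pi> \<in> quots C G \<Longrightarrow> qclass C \<pi> \<in> carrier (quot_poset C G)"
  by (simp add: carrier_quot_poset)

lemma qclass_eq_iff:
  "\<lbrakk>\<pi> \<in> quots C G; \<sigma> \<in> quots C G\<rbrakk> \<Longrightarrow> qclass C \<pi> = qclass C \<sigma> \<longleftrightarrow> (\<pi>, \<sigma>) \<in> quot_iso C G"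
  using quotsD[of \<pi> G] quotsD[of \<sigma> G] eq_equiv_class_iff[OF equiv_quot_iso] by (simp add: qclass_def)

lemma qclass_member:
  assumes "q \<in> carrier (quot_poset C G)" "\<pi> \<in> q"
  shows "\<pi> \<in> quots C G" "q = qclass C \<pi>"
proof -
  obtain \<sigma> where \<sigma>: "\<sigma> \<in> quots C G" "q = qclass C \<sigma>"
    using assms(1) by (auto simp: carrier_quot_poset)
  then have "(\<sigma>, \<pi>) \<in> quot_iso C G"
    using assms(2) quotsD[of \<sigma> G] by (auto simp: qclass_def)
  then show "\<pi> \<in> quots C G" by (auto simp: quot_iso_def)
  with \<sigma> \<open>(\<sigma>, \<pi>) \<in> quot_iso C G\<close> show "q = qclass C \<pi>"
    using qclass_eq_iff by blast
qed

lemma qclass_mem_iff: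
  assumes "\<pi> \<in> quots C G"
  shows "\<sigma> \<in> qclass C \<pi> \<longleftrightarrow> (\<exists>\<rho> B. \<rho> \<in> Hom C (Cod C \<pi>) B \<and> iso C \<rho> \<and> \<sigma> = Comp C \<rho> \<pi>)"
proof
  assume "\<sigma> \<in> qclass C \<pi>"
  then show "\<exists>\<rho> B. \<rho> \<in> Hom C (Cod C \<pi>) B \<and> iso C \<rho> \<and> \<sigma> = Comp C \<rho> \<pi>"
    by (auto simp: qclass_def quot_iso_def)
next
  assume "\<exists>\<rho> B. \<rho> \<in> Hom C (Cod C \<pi>) B \<and> iso C \<rho> \<and> \<sigma> = Comp C \<rho> \<pi>"
  then obtain \<rho> B where \<rho>: "\<rho> \<in> Hom C (Cod C \<pi>) B" "iso C \<rho>" "\<sigma> = Comp C \<rho> \<pi>" by blast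
  have \<pi>: "\<pi> \<in> Hom C G (Cod C \<pi>)" "Dom C \<pi> = G" using quotsD[OF assms] by auto
  have "Cod C \<sigma> = B" using HomD[OF Comp_in_Hom[OF \<pi>(1) \<rho>(1)]] \<rho>(3) by simp
  then show "\<sigma> \<in> qclass C \<pi>"
    using assms quots_iso_Comp[OF assms \<rho>(2,1)] \<rho> \<pi> by (auto simp: qclass_def quot_iso_def)
qed

text \<open>The order is defined by some pair of representatives; isomorphisms on both sides carry a
  factorization to any chosen pair.\<close>

lemma le_qclass_iff:
  assumes p: "\<pi> \<in> quots C G" and s: "\<sigma> \<in> quots C G"
  shows "qclass C \<pi> \<sqsubseteq>\<^bsub>quot_poset C G\<^esub> qclass C \<sigma> \<longleftrightarrow> (\<exists>h \<in> Hom C (Cod C \<sigma>) (Cod C \<pi>). Comp C h \<sigma> = \<pi>)"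
proof
  assume "qclass C \<pi> \<sqsubseteq>\<^bsub>quot_poset C G\<^esub> qclass C \<sigma>"
  then obtain \<pi>' \<sigma>' h where *: "\<pi>' \<in> qclass C \<pi>" "\<sigma>' \<in> qclass C \<sigma>"
    "h \<in> Hom C (Cod C \<sigma>') (Cod C \<pi>')" "Comp C h \<sigma>' = \<pi>'"
    by (auto simp: quot_poset_def)
  have hp: "\<pi> \<in> Hom C G (Cod C \<pi>)" and hs: "\<sigma> \<in> Hom C G (Cod C \<sigma>)"
    using quotsD p s by auto
  obtain \<rho> B where \<rho>: "\<rho> \<in> Hom C (Cod C \<pi>) B" "iso C \<rho>" "\<pi>' = Comp C \<rho> \<pi>"
    using *(1) qclass_mem_iff[OF p] by blast
  obtain \<tau> D where \<tau>: "\<tau> \<in> Hom C (Cod C \<sigma>) D" "iso C \<tau>" "\<sigma>' = Comp C \<tau> \<sigma>"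
    using *(2) qclass_mem_iff[OF s] by blast
  have c: "Cod C \<pi>' = B" "Cod C \<sigma>' = D"
    using HomD[OF Comp_in_Hom[OF hp \<rho>(1)]] HomD[OF Comp_in_Hom[OF hs \<tau>(1)]] \<rho>(3) \<tau>(3) by auto
  have h: "h \<in> Hom C D B" using *(3) c by simp
  obtain \<rho>' where \<rho>': "\<rho>' \<in> Hom C B (Cod C \<pi>)" "Comp C \<rho>' \<rho> = Ident C (Cod C \<pi>)"
    using isoE[OF \<rho>(2,1)] by blast
  have k: "Comp C h \<tau> \<in> Hom C (Cod C \<sigma>) B" using Comp_in_Hom[OF \<tau>(1) h] .
  have "Comp C (Comp C \<rho>' (Comp C h \<tau>)) \<sigma> = Comp C \<rho>' (Comp C (Comp C h \<tau>) \<sigma>)"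
    using Comp_assoc[OF hs k \<rho>'(1)] by simp
  also have "Comp C (Comp C h \<tau>) \<sigma> = Comp C \<rho> \<pi>"
    using Comp_assoc[OF hs \<tau>(1) h] \<tau>(3) *(4) \<rho>(3) by simp
  also have "Comp C \<rho>' (Comp C \<rho> \<pi>) = \<pi>"
    using Comp_assoc[OF hp \<rho>(1) \<rho>'(1)] \<rho>'(2) Comp_Ident_left[OF hp] by simp
  finally show "\<exists>h \<in> Hom C (Cod C \<sigma>) (Cod C \<pi>). Comp C h \<sigma> = \<pi>"
    using Comp_in_Hom[OF k \<rho>'(1)] by blast
next
  assume "\<exists>h \<in> Hom C (Cod C \<sigma>) (Cod C \<pi>). Comp C h \<sigma> = \<pi>"
  then show "qclass C \<pi> \<sqsubseteq>\<^bsub>quot_poset C G\<^esub> qclass C \<sigma>"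
    using qclass_self[OF p] qclass_self[OF s] by (auto simp: quot_poset_def)
qed

text \<open>Composition with isomorphisms out of the codomain reaches every isomorphic object. So
  the image of a class under \<open>Cod C\<close> is itself an isomorphism class, and it serves as
  the type of the quotient.\<close>

lemma Cod_qclass:
  assumes p: "\<pi> \<in> quots C G"
  shows "Cod C ` qclass C \<pi> = iso_class C (Cod C \<pi>)"
proof
  have hp: "\<pi> \<in> Hom C G (Cod C \<pi>)" "Cod C \<pi> \<in> Obj C" using quotsD p by auto
  show "Cod C ` qclass C \<pi> \<subseteq> iso_class C (Cod C \<pi>)"
  proof
    fix B assume "B \<in> Cod C ` qclass C \<pi>"
    then obtain \<sigma> where "\<sigma> \<in> qclass C \<pi>" "B = Cod C \<sigma>" by blast
    then obtain \<rho> D where \<rho>: "\<rho> \<in> Hom C (Cod C \<pi>) D" "iso C \<rho>" "\<sigma> = Comp C \<rho> \<pi>" and B: "B = Cod C \<sigma>"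
      using qclass_mem_iff[OF p] by blast
    then have "B = D" using HomD[OF Comp_in_Hom[OF hp(1) \<rho>(1)]] by simp
    then show "B \<in> iso_class C (Cod C \<pi>)"
      using \<rho> HomD[OF \<rho>(1)] by (auto simp: iso_class_def iso_rel_def)
  qed
  show "iso_class C (Cod C \<pi>) \<subseteq> Cod C ` qclass C \<pi>"
  proof
    fix B assume "B \<in> iso_class C (Cod C \<pi>)"
    then obtain \<rho> where \<rho>: "\<rho> \<in> Hom C (Cod C \<pi>) B" "iso C \<rho>"
      by (auto simp: iso_class_def iso_rel_def)
    then have "Comp C \<rho> \<pi> \<in> qclass C \<pi>" using qclass_mem_iff[OF p] by blast
    moreover have "Cod C (Comp C \<rho> \<pi>) = B" using HomD[OF Comp_in_Hom[OF hp(1) \<rho>(1)]] by simp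
    ultimately show "B \<in> Cod C ` qclass C \<pi>" by (metis imageI)
  qed
qed

lemma type_in_classes:
  "q \<in> carrier (quot_poset C G) \<Longrightarrow> Cod C ` q \<in> Obj C // iso_rel C"
  using Cod_qclass quotsD iso_class_in by (auto simp: carrier_quot_poset)

lemma le_qclass_Ident:
  assumes "q \<in> carrier (quot_poset C G)"
  shows "q \<sqsubseteq>\<^bsub>quot_poset C G\<^esub> qclass C (Ident C G)"
proof -
  obtain \<pi> where p: "\<pi> \<in> quots C G" "q = qclass C \<pi>"
    using assms by (auto simp: carrier_quot_poset)
  have G: "G \<in> Obj C" "\<pi> \<in> Hom C G (Cod C \<pi>)" using quotsD p by auto
  have "Cod C (Ident C G) = G" using HomD[OF Ident_in_Hom[OF G(1)]] by simp
  then show ?thesis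
    using le_qclass_iff[OF p(1) quots_Ident[OF G(1)]] p(2) G Comp_Ident_right[OF G(2)] by auto
qed

lemma obtain_member:
  assumes "q \<in> carrier (quot_poset C G)" "A \<in> Cod C ` q"
  obtains \<pi> where "\<pi> \<in> quots C G" "q = qclass C \<pi>" "Cod C \<pi> = A" "\<pi> \<in> Epi C G A"
proof -
  obtain \<pi> where "\<pi> \<in> q" "Cod C \<pi> = A" using assms by blast
  moreover then have "\<pi> \<in> quots C G" "q = qclass C \<pi>" using qclass_member assms by auto
  ultimately show ?thesis using that quotsD by (auto simp: Epi_def)
qed

lemma precomp_qclass:
  assumes p: "\<pi> \<in> quots C G" and s: "\<sigma> \<in> quots C (Cod C \<pi>)"
  shows "Comp C \<sigma> \<pi> \<in> quots C G" "Cod C (Comp C \<sigma> \<pi>) = Cod C \<sigma>"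
    "(\<lambda>\<sigma>. Comp C \<sigma> \<pi>) ` qclass C \<sigma> = qclass C (Comp C \<sigma> \<pi>)"
proof -
  have hp: "\<pi> \<in> Hom C G (Cod C \<pi>)" "epi C \<pi>" and hs: "\<sigma> \<in> Hom C (Cod C \<pi>) (Cod C \<sigma>)" "epi C \<sigma>"
    using quotsD p s by auto
  note h = Comp_in_Hom[OF hp(1) hs(1)]
  show sp: "Comp C \<sigma> \<pi> \<in> quots C G" using quotsI[OF epi_Comp[OF hp(2,1) hs(2,1)] h] .
  show cod: "Cod C (Comp C \<sigma> \<pi>) = Cod C \<sigma>" using HomD[OF h] by simp
  show "(\<lambda>\<sigma>. Comp C \<sigma> \<pi>) ` qclass C \<sigma> = qclass C (Comp C \<sigma> \<pi>)"
  proof (intro Set.set_eqI iffI)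
    fix \<tau> assume "\<tau> \<in> (\<lambda>\<sigma>. Comp C \<sigma> \<pi>) ` qclass C \<sigma>"
    then obtain \<upsilon> where "\<upsilon> \<in> qclass C \<sigma>" "\<tau> = Comp C \<upsilon> \<pi>" by blast
    then obtain \<rho> B where \<rho>: "\<rho> \<in> Hom C (Cod C \<sigma>) B" "iso C \<rho>" "\<tau> = Comp C (Comp C \<rho> \<sigma>) \<pi>"
      using qclass_mem_iff[OF s, of \<upsilon>] by auto
    then show "\<tau> \<in> qclass C (Comp C \<sigma> \<pi>)"
      using qclass_mem_iff[OF sp] cod Comp_assoc[OF hp(1) hs(1) \<rho>(1)] by metis
  next
    fix \<tau> assume "\<tau> \<in> qclass C (Comp C \<sigma> \<pi>)"
    then obtain \<rho> B where \<rho>: "\<rho> \<in> Hom C (Cod C \<sigma>) B" "iso C \<rho>" "\<tau> = Comp C \<rho> (Comp C \<sigma> \<pi>)"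
      using qclass_mem_iff[OF sp] cod by metis
    then have "\<tau> = Comp C (Comp C \<rho> \<sigma>) \<pi>" using Comp_assoc[OF hp(1) hs(1) \<rho>(1)] by simp
    moreover have "Comp C \<rho> \<sigma> \<in> qclass C \<sigma>" using qclass_mem_iff[OF s] \<rho> by blast
    ultimately show "\<tau> \<in> (\<lambda>\<sigma>. Comp C \<sigma> \<pi>) ` qclass C \<sigma>" by blast
  qed
qed

lemma Cod_precomp:
  assumes p: "\<pi> \<in> quots C G" and q: "q \<in> carrier (quot_poset C (Cod C \<pi>))"
  shows "Cod C ` ((\<lambda>\<sigma>. Comp C \<sigma> \<pi>) ` q) = Cod C ` q"
proof -
  obtain \<sigma> where s: "\<sigma> \<in> quots C (Cod C \<pi>)" "q = qclass C \<sigma>"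
    using q by (auto simp: carrier_quot_poset)
  show ?thesis
    using precomp_qclass[OF p s(1)] Cod_qclass s by metis
qed

text \<open>If \<open>h\<close> after \<open>\<pi>\<close> is epi, then so is \<open>h\<close>;
  hence every class below that of \<open>\<pi>\<close> comes from a quotient of its codomain.
  Cancelling \<open>\<pi>\<close> shows that the order is reflected.\<close>

lemma down_embedding_precomp:
  assumes p: "\<pi> \<in> quots C G"
    and po: "partial_order (quot_poset C G)" "partial_order (quot_poset C (Cod C \<pi>))"
  shows "down_embedding (quot_poset C (Cod C \<pi>)) (quot_poset C G) ((`) (\<lambda>\<sigma>. Comp C \<sigma> \<pi>)) (qclass C \<pi>)"
proof -
  let ?\<phi> = "(`) (\<lambda>\<sigma>. Comp C \<sigma> \<pi>)"
  have hp: "\<pi> \<in> Hom C G (Cod C \<pi>)" "epi C \<pi>" using quotsD p by auto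
  have le: "?\<phi> x \<sqsubseteq>\<^bsub>quot_poset C G\<^esub> ?\<phi> y \<longleftrightarrow> x \<sqsubseteq>\<^bsub>quot_poset C (Cod C \<pi>)\<^esub> y"
    if xy: "x \<in> carrier (quot_poset C (Cod C \<pi>))" "y \<in> carrier (quot_poset C (Cod C \<pi>))" for x y
  proof -
    obtain \<sigma> \<tau> where s: "\<sigma> \<in> quots C (Cod C \<pi>)" "x = qclass C \<sigma>" and t: "\<tau> \<in> quots C (Cod C \<pi>)" "y = qclass C \<tau>"
      using xy by (auto simp: carrier_quot_poset)
    note S = precomp_qclass[OF p s(1)] and T = precomp_qclass[OF p t(1)]
    have hs: "\<sigma> \<in> Hom C (Cod C \<pi>) (Cod C \<sigma>)" and ht: "\<tau> \<in> Hom C (Cod C \<pi>) (Cod C \<tau>)"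
      using quotsD s t by auto
    have "(\<exists>h \<in> Hom C (Cod C \<tau>) (Cod C \<sigma>). Comp C h (Comp C \<tau> \<pi>) = Comp C \<sigma> \<pi>) \<longleftrightarrow>
        (\<exists>h \<in> Hom C (Cod C \<tau>) (Cod C \<sigma>). Comp C h \<tau> = \<sigma>)"
    proof (intro bex_cong HOL.refl)
      fix h assume h: "h \<in> Hom C (Cod C \<tau>) (Cod C \<sigma>)"
      show "Comp C h (Comp C \<tau> \<pi>) = Comp C \<sigma> \<pi> \<longleftrightarrow> Comp C h \<tau> = \<sigma>"
        using Comp_assoc[OF hp(1) ht h] epi_cancel[OF hp(2,1) Comp_in_Hom[OF ht h] hs] by auto
    qed
    then show ?thesis
      using le_qclass_iff[OF s(1) t(1)] le_qclass_iff[OF S(1) T(1)] S T s(2) t(2) by simp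
  qed
  interpret F: partial_order "quot_poset C (Cod C \<pi>)" by fact
  interpret G: partial_order "quot_poset C G" by fact
  show ?thesis
  proof unfold_locales
    show "qclass C \<pi> \<in> carrier (quot_poset C G)" using p by (rule qclass_carrier)
    show "?\<phi> x \<sqsubseteq>\<^bsub>quot_poset C G\<^esub> ?\<phi> y \<longleftrightarrow> x \<sqsubseteq>\<^bsub>quot_poset C (Cod C \<pi>)\<^esub> y"
      if "x \<in> carrier (quot_poset C (Cod C \<pi>))" "y \<in> carrier (quot_poset C (Cod C \<pi>))" for x y
      using le[OF that] .
    show "bij_betw ?\<phi> (carrier (quot_poset C (Cod C \<pi>))) {z \<in> carrier (quot_poset C G). z \<sqsubseteq>\<^bsub>quot_poset C G\<^esub> qclass C \<pi>}"
      unfolding bij_betw_def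
    proof
      have im: "?\<phi> x \<in> carrier (quot_poset C G)" if "x \<in> carrier (quot_poset C (Cod C \<pi>))" for x
        using that precomp_qclass[OF p] by (auto simp: carrier_quot_poset)
      show "inj_on ?\<phi> (carrier (quot_poset C (Cod C \<pi>)))"
      proof (rule inj_onI)
        fix x y assume x: "x \<in> carrier (quot_poset C (Cod C \<pi>))" and y: "y \<in> carrier (quot_poset C (Cod C \<pi>))"
          and eq: "?\<phi> x = ?\<phi> y"
        then show "x = y"
          using F.le_antisym[OF le[OF x y, THEN iffD1] le[OF y x, THEN iffD1]] im[OF x] im[OF y] by simp
      qed
      show "?\<phi> ` carrier (quot_poset C (Cod C \<pi>)) = {z \<in> carrier (quot_poset C G). z \<sqsubseteq>\<^bsub>quot_poset C G\<^esub> qclass C \<pi>}"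
      proof (intro Set.set_eqI iffI)
        fix z assume "z \<in> ?\<phi> ` carrier (quot_poset C (Cod C \<pi>))"
        then obtain \<sigma> where s: "\<sigma> \<in> quots C (Cod C \<pi>)" "z = qclass C (Comp C \<sigma> \<pi>)"
          using precomp_qclass[OF p] by (auto simp: carrier_quot_poset)
        have "qclass C (Comp C \<sigma> \<pi>) \<sqsubseteq>\<^bsub>quot_poset C G\<^esub> qclass C \<pi>"
          using le_qclass_iff[OF precomp_qclass(1)[OF p s(1)] p] precomp_qclass(2)[OF p s(1)] quotsD[OF s(1)] by auto
        then show "z \<in> {z \<in> carrier (quot_poset C G). z \<sqsubseteq>\<^bsub>quot_poset C G\<^esub> qclass C \<pi>}"
          using s(2) qclass_carrier[OF precomp_qclass(1)[OF p s(1)]] by simp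
      next
        fix z assume z: "z \<in> {z \<in> carrier (quot_poset C G). z \<sqsubseteq>\<^bsub>quot_poset C G\<^esub> qclass C \<pi>}"
        then obtain \<tau> where t: "\<tau> \<in> quots C G" "z = qclass C \<tau>" by (auto simp: carrier_quot_poset)
        then obtain h where h: "h \<in> Hom C (Cod C \<pi>) (Cod C \<tau>)" "Comp C h \<pi> = \<tau>"
          using z le_qclass_iff[OF t(1) p] by auto
        have "epi C h" using epi_of_Comp[OF hp(1) h(1)] h(2) quotsD[OF t(1)] by simp
        then have hq: "h \<in> quots C (Cod C \<pi>)" using quotsI h by blast
        show "z \<in> ?\<phi> ` carrier (quot_poset C (Cod C \<pi>))"
          using precomp_qclass(3)[OF p hq] h(2) t(2) qclass_carrier[OF hq] by (metis imageI)
      qed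
    qed
  qed
qed

text \<open>The automorphism group acts freely because epimorphisms cancel, and its orbits are cut
  out by quotient classes. This is the source of the factor |Aut(F)| between epimorphisms and
  quotients.\<close>

lemma Epi_fibre:
  assumes p: "\<pi> \<in> Epi C G F"
  shows "{\<sigma> \<in> qclass C \<pi>. Cod C \<sigma> = F} = (\<lambda>\<rho>. Comp C \<rho> \<pi>) ` Aut C F"
    and "inj_on (\<lambda>\<rho>. Comp C \<rho> \<pi>) (Aut C F)"
proof -
  have hp: "\<pi> \<in> Hom C G F" "epi C \<pi>" "\<pi> \<in> quots C G" "Cod C \<pi> = F"
    using p quotsI HomD by (auto simp: Epi_def)
  show "inj_on (\<lambda>\<rho>. Comp C \<rho> \<pi>) (Aut C F)"
    using epi_cancel[OF hp(2,1)] by (auto simp: inj_on_def Aut_def)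
  show "{\<sigma> \<in> qclass C \<pi>. Cod C \<sigma> = F} = (\<lambda>\<rho>. Comp C \<rho> \<pi>) ` Aut C F"
    unfolding qclass_mem_iff[OF hp(3)] hp(4) Aut_def
    using HomD Comp_in_Hom[OF hp(1)] by (auto simp: image_iff) metis+
qed

lemma Epi_mem_iff: "\<pi> \<in> Epi C G F \<longleftrightarrow> \<pi> \<in> quots C G \<and> Cod C \<pi> = F"
  using quotsD quotsI HomD by (auto simp: Epi_def)

text \<open>Sending a class of type \<open>F\<close> to its members with codomain exactly
  \<open>F\<close> matches classes with orbits. As \<open>mu\<close> depends on the class alone, the
  choice of a member of the orbit is harmless.\<close>

lemma mu_hat_eq_sum:
  assumes F: "F \<in> Obj C"
  shows "mu_hat C F G = (\<Sum>q \<in> {q \<in> carrier (quot_poset C G). Cod C ` q = iso_class C F}.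
      real_of_int (mobius (quot_poset C G) q (qclass C (Ident C G))))"
proof -
  let ?A = "{q \<in> carrier (quot_poset C G). Cod C ` q = iso_class C F}"
  let ?f = "\<lambda>q. {\<sigma> \<in> q. Cod C \<sigma> = F}"
  have ne: "\<exists>\<pi>. \<pi> \<in> Epi C G F \<and> q = qclass C \<pi>" if "q \<in> ?A" for q
  proof -
    have "F \<in> Cod C ` q" using that iso_class_self[OF F] by auto
    then show ?thesis using obtain_member[of q G F] that by blast
  qed
  have im: "?f ` ?A = (\<lambda>\<pi>. (\<lambda>\<rho>. Comp C \<rho> \<pi>) ` Aut C F) ` Epi C G F"
  proof (intro Set.set_eqI iffI)
    fix x assume "x \<in> ?f ` ?A"
    then obtain \<pi> where "\<pi> \<in> Epi C G F" "x = ?f (qclass C \<pi>)" using ne by blast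
    then show "x \<in> (\<lambda>\<pi>. (\<lambda>\<rho>. Comp C \<rho> \<pi>) ` Aut C F) ` Epi C G F"
      using Epi_fibre(1) by auto
  next
    fix x assume "x \<in> (\<lambda>\<pi>. (\<lambda>\<rho>. Comp C \<rho> \<pi>) ` Aut C F) ` Epi C G F"
    then obtain \<pi> where p: "\<pi> \<in> Epi C G F" "x = ?f (qclass C \<pi>)" using Epi_fibre(1) by blast
    then have "\<pi> \<in> quots C G" "Cod C \<pi> = F" by (auto simp: Epi_mem_iff)
    then have "qclass C \<pi> \<in> ?A"
      using qclass_carrier[of \<pi> G] Cod_qclass[of \<pi> G] by blast
    then show "x \<in> ?f ` ?A" using p(2) by blast
  qed
  have q_of: "q = qclass C \<pi>" "Dom C \<pi> = G" if "q \<in> ?A" "\<pi> \<in> ?f q" for q \<pi>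
    using that qclass_member quotsD by auto
  have inj: "inj_on ?f ?A"
  proof (rule inj_onI)
    fix q q' assume q: "q \<in> ?A" "q' \<in> ?A" "?f q = ?f q'"
    obtain \<pi> where p: "\<pi> \<in> Epi C G F" "q = qclass C \<pi>" using ne[OF q(1)] by blast
    then have "\<pi> \<in> ?f q" using Epi_mem_iff qclass_self by auto
    then have "\<pi> \<in> ?f q'" unfolding q(3) .
    then show "q = q'" using q_of(1)[OF q(2)] p(2) by simp
  qed
  have "mu_hat C F G = (\<Sum>q \<in> ?A. mu C (SOME \<pi>. \<pi> \<in> ?f q))"
    unfolding mu_hat_def im[symmetric] by (subst sum.reindex[OF inj]) simp
  also have "\<dots> = (\<Sum>q \<in> ?A. real_of_int (mobius (quot_poset C G) q (qclass C (Ident C G))))"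
  proof (rule sum.cong[OF HOL.refl])
    fix q assume q: "q \<in> ?A"
    then obtain \<pi> where "\<pi> \<in> Epi C G F" "q = qclass C \<pi>" using ne by blast
    then have "\<pi> \<in> ?f q" using Epi_mem_iff qclass_self by auto
    then have some: "(SOME \<pi>. \<pi> \<in> ?f q) \<in> ?f q" by (rule someI)
    then show "mu C (SOME \<pi>. \<pi> \<in> ?f q) = real_of_int (mobius (quot_poset C G) q (qclass C (Ident C G)))"
      unfolding mu_def q_of(2)[OF q some] using q_of(1)[OF q some] by simp
  qed
  finally show ?thesis .
qed

end

section \<open>Finite counts of epimorphisms and quotients\<close>

context diamond_category
begin

lemma lattice_quot_poset: "G \<in> Obj C \<Longrightarrow> lattice (quot_poset C G)"
  using quot_modular_lattice modular_lattice.axioms(1) by blast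

lemma partial_order_quot_poset: "G \<in> Obj C \<Longrightarrow> partial_order (quot_poset C G)"
  using lattice_quot_poset lattice.axioms(1) upper_semilattice.axioms(1) by blast

text \<open>The epimorphisms are partitioned by their quotient class, and each part is a free orbit
  of the automorphism group.\<close>

lemma Epi_card:
  assumes F: "F \<in> Obj C" and G: "G \<in> Obj C"
  shows "finite (Epi C G F)"
    and "card (Epi C G F) = card (Aut C F) * card {q \<in> carrier (quot_poset C G). Cod C ` q = iso_class C F}"
proof -
  let ?A = "{q \<in> carrier (quot_poset C G). Cod C ` q = iso_class C F}"
  let ?f = "\<lambda>q. {\<sigma> \<in> q. Cod C \<sigma> = F}"
  have finA: "finite ?A" using quot_finite[OF G] by simp
  have fibre: "finite (?f q) \<and> card (?f q) = card (Aut C F)" if "q \<in> ?A" for q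
  proof -
    have q: "q \<in> carrier (quot_poset C G)" "F \<in> Cod C ` q" using that iso_class_self[OF F] by auto
    obtain \<pi> where p: "\<pi> \<in> Epi C G F" "q = qclass C \<pi>"
      by (rule obtain_member[OF q])
    show ?thesis
      unfolding p(2) Epi_fibre(1)[OF p(1)] using Aut_finite[OF F] card_image[OF Epi_fibre(2)[OF p(1)]] by simp
  qed
  have un: "Epi C G F = (\<Union>q \<in> ?A. ?f q)"
  proof (intro Set.set_eqI iffI)
    fix \<pi> assume "\<pi> \<in> Epi C G F"
    then have p: "\<pi> \<in> quots C G" "Cod C \<pi> = F" by (auto simp: Epi_mem_iff)
    then have "qclass C \<pi> \<in> ?A" "\<pi> \<in> ?f (qclass C \<pi>)"
      using qclass_carrier Cod_qclass qclass_self by auto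
    then show "\<pi> \<in> (\<Union>q \<in> ?A. ?f q)" by blast
  next
    fix \<pi> assume "\<pi> \<in> (\<Union>q \<in> ?A. ?f q)"
    then show "\<pi> \<in> Epi C G F" using qclass_member by (auto simp: Epi_mem_iff)
  qed
  show "finite (Epi C G F)" unfolding un using finA fibre by blast
  have "card (\<Union>q \<in> ?A. ?f q) = (\<Sum>q \<in> ?A. card (?f q))"
  proof (rule card_UN_disjoint[OF finA])
    show "\<forall>q \<in> ?A. finite (?f q)" using fibre by blast
    show "\<forall>q \<in> ?A. \<forall>q' \<in> ?A. q \<noteq> q' \<longrightarrow> ?f q \<inter> ?f q' = {}"
    proof (intro ballI impI)
      fix q q' assume "q \<in> ?A" "q' \<in> ?A" "q \<noteq> q'"
      then show "?f q \<inter> ?f q' = {}"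
        using qclass_member(2)[of q G] qclass_member(2)[of q' G] by blast
    qed
  qed
  also have "\<dots> = (\<Sum>q \<in> ?A. card (Aut C F))" using fibre by (intro sum.cong) auto
  finally show "card (Epi C G F) = card (Aut C F) * card ?A" using un by simp
qed

lemma Aut_card_pos: "F \<in> Obj C \<Longrightarrow> 0 < card (Aut C F)"
  using Aut_finite iso_Ident Ident_in_Hom by (auto simp: card_gt_0_iff Aut_def)

text \<open>The least element of the interval is always counted, as both sides of its identity equal
  \<open>K\<^sub>1 \<sqinter> K\<^sub>2\<close>.\<close>

lemma Z_num_pos:
  assumes p: "\<pi> \<in> quots C G"
  shows "1 \<le> Z_num C \<pi>"
proof -
  have G: "G \<in> Obj C" "Dom C \<pi> = G" using quotsD p by auto
  interpret lattice "quot_poset C G" using lattice_quot_poset G by blast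
  let ?I = "quot_interval C \<pi>"
  have I: "?I = {q \<in> carrier (quot_poset C G). qclass C \<pi> \<sqsubseteq>\<^bsub>quot_poset C G\<^esub> q}"
    by (simp add: quot_interval_def G)
  have c: "qclass C \<pi> \<in> carrier (quot_poset C G)" by (rule qclass_carrier[OF p])
  let ?S = "{H \<in> ?I. \<forall>K\<^sub>1 \<in> ?I. \<forall>K\<^sub>2 \<in> ?I. H \<squnion>\<^bsub>quot_poset C G\<^esub> (K\<^sub>1 \<sqinter>\<^bsub>quot_poset C G\<^esub> K\<^sub>2) =
    (H \<squnion>\<^bsub>quot_poset C G\<^esub> K\<^sub>1) \<sqinter>\<^bsub>quot_poset C G\<^esub> (H \<squnion>\<^bsub>quot_poset C G\<^esub> K\<^sub>2)}"
  have "qclass C \<pi> \<in> ?S"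
    using c by (auto simp: I join_absorb le_meet_iff)
  moreover have "finite ?S" using quot_finite[OF G(1)] by (simp add: I)
  ultimately have "card {qclass C \<pi>} \<le> card ?S" by (intro card_mono) auto
  then show ?thesis by (simp add: Z_num_def G Let_def)
qed

end

section \<open>Isomorphism classes of objects as types\<close>

sublocale diamond_category \<subseteq> quots: typed_lattices "Obj C // iso_rel C" "\<lambda>c. quot_poset C (rep c)"
  "\<lambda>c. qclass C (Ident C (rep c))" "\<lambda>q. Cod C ` q"
proof (rule typed_lattices.intro)
  fix c assume c: "c \<in> Obj C // iso_rel C"
  then have r: "rep c \<in> Obj C" by (rule rep_Obj)
  show "modular_lattice (quot_poset C (rep c))" by (rule quot_modular_lattice[OF r])
  show "finite (carrier (quot_poset C (rep c)))" by (rule quot_finite[OF r])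
  show "qclass C (Ident C (rep c)) \<in> carrier (quot_poset C (rep c))"
    using qclass_carrier[OF quots_Ident[OF r]] .
  show "Cod C ` qclass C (Ident C (rep c)) = c"
    using Cod_qclass[OF quots_Ident[OF r]] HomD[OF Ident_in_Hom[OF r]] iso_class_rep[OF c] by simp
  fix q assume q: "q \<in> carrier (quot_poset C (rep c))"
  show "q \<sqsubseteq>\<^bsub>quot_poset C (rep c)\<^esub> qclass C (Ident C (rep c))" by (rule le_qclass_Ident[OF q])
  show t: "Cod C ` q \<in> Obj C // iso_rel C" by (rule type_in_classes[OF q])
  \<comment> \<open>The member of \<open>q\<close> that ends in the representative of its type is
    taken, so that precomposition with it starts from the lattice attached to that type.\<close>
  obtain \<pi> where p: "\<pi> \<in> quots C (rep c)" "q = qclass C \<pi>" "Cod C \<pi> = rep (Cod C ` q)"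
    using obtain_member[OF q rep_in[OF t]] by blast
  show "\<exists>f. down_embedding (quot_poset C (rep (Cod C ` q))) (quot_poset C (rep c)) f q \<and>
      (\<forall>x \<in> carrier (quot_poset C (rep (Cod C ` q))). Cod C ` f x = Cod C ` x)"
    using down_embedding_precomp[OF p(1)] partial_order_quot_poset rep_Obj r t p(2,3) Cod_precomp[OF p(1)] by metis
qed

context diamond_category
begin

lemma card_Epi_rep:
  assumes "c \<in> Obj C // iso_rel C" "G \<in> Obj C"
  shows "card (Epi C (rep c) G) = card (Aut C G) * quots.cnt c (iso_class C G)"
  using Epi_card(2)[OF assms(2) rep_Obj[OF assms(1)]] by (simp add: quots.cnt_def)

lemma mu_hat_eq_mobius_sum:
  "F \<in> Obj C \<Longrightarrow> mu_hat C F (rep c) = quots.mobius_sum (iso_class C F) c"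
  using mu_hat_eq_sum by (simp add: quots.mobius_sum_def)

text \<open>One epimorphism is picked from each class, injectively. Adding the remaining
  epimorphisms and multiplying by the third powers of \<open>Z_num\<close>, which are at least 1,
  only increases the terms and leads to the series in \<open>well_behaved\<close>.\<close>

lemma mobius_abs_sum_summable:
  assumes wb: "well_behaved C M" and L: "level C L" "L // iso_rel C \<subseteq> Obj C // iso_rel C" and F: "F \<in> L" "F \<in> Obj C"
  shows "(\<lambda>c. quots.mobius_abs_sum (iso_class C F) c * (\<bar>M c\<bar> / real (card (Aut C (rep c))))) summable_on (L // iso_rel C)"
proof (rule summable_on_comparison_test)
  show "(\<lambda>c. \<Sum>\<pi> \<in> Epi C (rep c) F.
      \<bar>mu C \<pi>\<bar> / real (card (Aut C (rep c))) * real (Z_num C \<pi>) ^ 3 * \<bar>M c\<bar>) summable_on (L // iso_rel C)"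
    using wb L(1) F(1) unfolding well_behaved_def by blast
  fix c assume "c \<in> L // iso_rel C"
  then have c: "c \<in> Obj C // iso_rel C" "rep c \<in> Obj C" using L rep_Obj by auto
  show "0 \<le> quots.mobius_abs_sum (iso_class C F) c * (\<bar>M c\<bar> / real (card (Aut C (rep c))))"
    by (simp add: quots.mobius_abs_sum_nonneg)
  let ?P = "{q \<in> carrier (quot_poset C (rep c)). Cod C ` q = iso_class C F}"
  define w where "w = \<bar>M c\<bar> / real (card (Aut C (rep c)))"
  have w: "0 \<le> w" by (simp add: w_def)
  have "\<forall>q \<in> ?P. \<exists>\<pi>. \<pi> \<in> Epi C (rep c) F \<and> q = qclass C \<pi>"
  proof
    fix q assume q: "q \<in> ?P"
    then have "F \<in> Cod C ` q" using iso_class_self[OF F(2)] by auto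
    then show "\<exists>\<pi>. \<pi> \<in> Epi C (rep c) F \<and> q = qclass C \<pi>"
      using obtain_member[of q "rep c" F] q by blast
  qed
  then obtain s where s: "\<forall>q \<in> ?P. s q \<in> Epi C (rep c) F \<and> q = qclass C (s q)"
    unfolding bchoice_iff by (elim exE)
  have inj: "inj_on s ?P"
  proof (rule inj_onI)
    fix x y assume "x \<in> ?P" "y \<in> ?P" "s x = s y"
    then have "x = qclass C (s x)" "y = qclass C (s y)" using s by blast+
    then show "x = y" using \<open>s x = s y\<close> by simp
  qed
  have "quots.mobius_abs_sum (iso_class C F) c * w = (\<Sum>q \<in> ?P. \<bar>mu C (s q)\<bar> * w)"
    unfolding quots.mobius_abs_sum_def sum_distrib_right
  proof (rule sum.cong[OF HOL.refl])
    fix q assume q: "q \<in> ?P"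
    then have sq: "s q \<in> Epi C (rep c) F" "q = qclass C (s q)" using s by blast+
    then have "Dom C (s q) = rep c" using Epi_mem_iff quotsD[of "s q"] by simp
    then show "\<bar>real_of_int (mobius (quot_poset C (rep c)) q (qclass C (Ident C (rep c))))\<bar> * w = \<bar>mu C (s q)\<bar> * w"
      using sq(2) by (simp add: mu_def)
  qed
  also have "\<dots> = (\<Sum>\<pi> \<in> s ` ?P. \<bar>mu C \<pi>\<bar> * w)"
    by (simp add: sum.reindex[OF inj])
  also have "\<dots> \<le> (\<Sum>\<pi> \<in> Epi C (rep c) F. \<bar>mu C \<pi>\<bar> * w)"
    using s w Epi_card(1)[OF F(2) c(2)] by (intro sum_mono2) auto
  also have "\<dots> \<le> (\<Sum>\<pi> \<in> Epi C (rep c) F. \<bar>mu C \<pi>\<bar> * w * real (Z_num C \<pi>) ^ 3)"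
  proof (rule sum_mono)
    fix \<pi> assume "\<pi> \<in> Epi C (rep c) F"
    then have "1 \<le> real (Z_num C \<pi>) ^ 3" using Z_num_pos Epi_mem_iff by (intro one_le_power) auto
    then show "\<bar>mu C \<pi>\<bar> * w \<le> \<bar>mu C \<pi>\<bar> * w * real (Z_num C \<pi>) ^ 3"
      using w mult_left_mono[of 1 "real (Z_num C \<pi>) ^ 3" "\<bar>mu C \<pi>\<bar> * w"] by simp
  qed
  also have "\<dots> = (\<Sum>\<pi> \<in> Epi C (rep c) F.
      \<bar>mu C \<pi>\<bar> / real (card (Aut C (rep c))) * real (Z_num C \<pi>) ^ 3 * \<bar>M c\<bar>)"
    by (intro sum.cong) (auto simp: w_def)
  finally show "quots.mobius_abs_sum (iso_class C F) c * (\<bar>M c\<bar> / real (card (Aut C (rep c)))) \<le> \<dots>"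
    by (simp add: w_def)
qed

end

context diamond_category
begin

lemma quotient_subset_classes: "S \<subseteq> Obj C \<Longrightarrow> S // iso_rel C \<subseteq> Obj C // iso_rel C"
  by (auto simp: quotient_def)

lemma iso_stable_mem:
  assumes S: "iso_stable C S" and A: "A \<in> S" and B: "B \<in> iso_class C A"
  shows "B \<in> S"
  using assms unfolding iso_stable_def iso_class_def by blast

lemma mem_quotient_iff:
  assumes S: "iso_stable C S" and c: "c \<in> Obj C // iso_rel C" and A: "A \<in> c"
  shows "c \<in> S // iso_rel C \<longleftrightarrow> A \<in> S"
proof
  assume "c \<in> S // iso_rel C"
  then obtain B where B: "B \<in> S" "c = iso_class C B" by (auto simp: quotient_def iso_class_def)
  then show "A \<in> S" using iso_stable_mem[OF S B(1)] A by simp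
next
  assume "A \<in> S"
  then have "iso_class C A \<in> S // iso_rel C" by (auto simp: quotient_def iso_class_def)
  then show "c \<in> S // iso_rel C" using iso_class_member(1)[OF c A] by simp
qed

lemma class_subset_iff:
  assumes S: "iso_stable C S" and c: "c \<in> Obj C // iso_rel C"
  shows "c \<subseteq> S \<longleftrightarrow> c \<in> S // iso_rel C"
proof
  assume "c \<subseteq> S"
  then show "c \<in> S // iso_rel C" using mem_quotient_iff[OF S c rep_in[OF c]] rep_in[OF c] by blast
next
  assume "c \<in> S // iso_rel C"
  then show "c \<subseteq> S" using mem_quotient_iff[OF S c] by blast
qed

lemma type_subset_iff:
  assumes S: "iso_stable C S" and p: "\<pi> \<in> quots C G"
  shows "Cod C ` qclass C \<pi> \<subseteq> S \<longleftrightarrow> Cod C \<pi> \<in> S"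
proof -
  have "iso_class C (Cod C \<pi>) \<in> Obj C // iso_rel C" "Cod C \<pi> \<in> iso_class C (Cod C \<pi>)"
    using quotsD[OF p] iso_class_in iso_class_self by auto
  then show ?thesis
    using Cod_qclass[OF p] class_subset_iff[OF S] mem_quotient_iff[OF S] by simp
qed

lemma iso_class_in_quotient: "F \<in> S \<Longrightarrow> iso_class C F \<in> S // iso_rel C"
  by (auto simp: quotient_def iso_class_def)

section \<open>Formations and levels\<close>

text \<open>It makes the family intersected in \<open>gen_level\<close> nonempty, so that the
  generated set is a formation.\<close>

lemma formation_Obj: "formation C (Obj C)"
  unfolding formation_def
proof (intro conjI)
  show "iso_stable C (Obj C)" by (auto simp: iso_stable_def iso_rel_def)
  show "downward_closed C (Obj C)" unfolding downward_closed_def using quotsD by blast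
  show "join_closed C (Obj C)" unfolding join_closed_def using quotsD by blast
qed (auto simp: minimal_def)

lemma formation_Inter:
  assumes "\<And>S. S \<in> \<S> \<Longrightarrow> formation C S" "\<S> \<noteq> {}"
  shows "formation C (\<Inter>\<S>)"
  unfolding formation_def
proof (intro conjI)
  show "iso_stable C (\<Inter>\<S>)"
    unfolding iso_stable_def
  proof
    show "\<Inter>\<S> \<subseteq> Obj C"
      using assms unfolding formation_def iso_stable_def by blast
    show "iso_rel C `` \<Inter>\<S> \<subseteq> \<Inter>\<S>"
    proof (rule Inter_greatest)
      fix S assume S: "S \<in> \<S>"
      then have "iso_rel C `` S \<subseteq> S" using assms(1) by (simp add: formation_def iso_stable_def)
      then show "iso_rel C `` \<Inter>\<S> \<subseteq> S" using S by blast
    qed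
  qed
  show "downward_closed C (\<Inter>\<S>)"
    using assms unfolding formation_def downward_closed_def by fast
  show "join_closed C (\<Inter>\<S>)"
    unfolding join_closed_def
  proof (intro ballI impI InterI)
    fix G \<pi>\<^sub>1 \<pi>\<^sub>2 \<pi> S
    assume "G \<in> Obj C" "\<pi>\<^sub>1 \<in> quots C G" "\<pi>\<^sub>2 \<in> quots C G" "\<pi> \<in> quots C G" and S: "S \<in> \<S>"
      "Cod C \<pi>\<^sub>1 \<in> \<Inter>\<S> \<and> Cod C \<pi>\<^sub>2 \<in> \<Inter>\<S> \<and>
        least (quot_poset C G) (qclass C \<pi>) (Upper (quot_poset C G) {qclass C \<pi>\<^sub>1, qclass C \<pi>\<^sub>2})"
    moreover have "join_closed C S" using assms(1)[OF S(1)] by (simp add: formation_def)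
    ultimately show "Cod C \<pi> \<in> S" unfolding join_closed_def by blast
  qed
  show "\<forall>G. minimal C G \<longrightarrow> G \<in> \<Inter>\<S>"
    using assms unfolding formation_def by blast
qed

lemma formation_gen_level:
  assumes "B \<subseteq> Obj C // iso_rel C"
  shows "formation C (gen_level C B)" "\<Union>B \<subseteq> gen_level C B"
proof -
  have "\<Union>B \<subseteq> Obj C"
    using assms in_quotient_imp_subset[OF equiv_iso_rel] by blast
  then have "Obj C \<in> {S. formation C S \<and> \<Union>B \<subseteq> S}" using formation_Obj by simp
  then show "formation C (gen_level C B)"
    unfolding gen_level_def by (intro formation_Inter) auto
  show "\<Union>B \<subseteq> gen_level C B" unfolding gen_level_def by blast
qed

lemma gen_level_least: "\<lbrakk>formation C S; \<Union>B \<subseteq> S\<rbrakk> \<Longrightarrow> gen_level C B \<subseteq> S"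
  unfolding gen_level_def by blast

lemma level_formation: "level C L \<Longrightarrow> formation C L"
  unfolding level_def using formation_gen_level by blast

lemma level_iso_stable: "level C L \<Longrightarrow> iso_stable C L"
  using level_formation by (simp add: formation_def)

lemma level_Obj: "level C L \<Longrightarrow> L \<subseteq> Obj C"
  using level_iso_stable by (simp add: iso_stable_def)

lemma level_classes: "level C L \<Longrightarrow> L // iso_rel C \<subseteq> Obj C // iso_rel C"
  using level_Obj quotient_subset_classes by blast

lemma level_rep: "\<lbrakk>level C L; c \<in> L // iso_rel C\<rbrakk> \<Longrightarrow> rep c \<in> L"
  using mem_quotient_iff[OF level_iso_stable] level_classes rep_in by blast

lemma level_type_down:
  assumes L: "level C L" and c: "c \<in> L // iso_rel C" and q: "q \<in> carrier (quot_poset C (rep c))"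
  shows "Cod C ` q \<in> L // iso_rel C"
proof -
  obtain \<pi> where p: "\<pi> \<in> quots C (rep c)" "q = qclass C \<pi>" using q by (auto simp: carrier_quot_poset)
  have "Cod C \<pi> \<in> L"
    using level_formation[OF L] level_rep[OF L c] p(1) unfolding formation_def downward_closed_def by blast
  then show ?thesis using Cod_qclass[OF p(1)] p(2) iso_class_in_quotient by simp
qed

text \<open>A class covered by the top has an interval of exactly two elements, so its epimorphisms
  are simple. This puts condition (3) into lattice terms.\<close>

lemma level_simple_finite:
  assumes L: "level C L" and g: "g \<in> L // iso_rel C"
  shows "finite {h \<in> L // iso_rel C. \<exists>q \<in> carrier (quot_poset C (rep h)). Cod C ` q = g \<and>
    covers (quot_poset C (rep h)) q (qclass C (Ident C (rep h)))}"
proof (rule finite_subset)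
  show "finite {c \<in> L // iso_rel C. \<exists>H \<in> c. \<exists>\<pi> \<in> Epi C H (rep g). simple_epi C \<pi>}"
    using simple_finite[OF L level_rep[OF L g]] .
  show "{h \<in> L // iso_rel C. \<exists>q \<in> carrier (quot_poset C (rep h)). Cod C ` q = g \<and>
      covers (quot_poset C (rep h)) q (qclass C (Ident C (rep h)))} \<subseteq>
    {c \<in> L // iso_rel C. \<exists>H \<in> c. \<exists>\<pi> \<in> Epi C H (rep g). simple_epi C \<pi>}"
  proof safe
    fix h q assume h: "h \<in> L // iso_rel C" and q: "q \<in> carrier (quot_poset C (rep h))"
      and g': "g = Cod C ` q" and cov: "covers (quot_poset C (rep h)) q (qclass C (Ident C (rep h)))"
    let ?Q = "quot_poset C (rep h)"
    have hc: "h \<in> Obj C // iso_rel C" using h level_classes[OF L] by auto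
    note r = rep_in[OF hc] rep_Obj[OF hc]
    have gc: "rep g \<in> Cod C ` q" using rep_in type_in_classes[OF q] g' by auto
    obtain \<pi> where p: "\<pi> \<in> quots C (rep h)" "q = qclass C \<pi>" "\<pi> \<in> Epi C (rep h) (rep g)"
      using obtain_member[OF q gc] by blast
    have d: "Dom C \<pi> = rep h" "epi C \<pi>" using quotsD p by auto
    have "\<not> iso C \<pi>"
    proof
      assume i: "iso C \<pi>"
      have hp: "\<pi> \<in> Hom C (rep h) (Cod C \<pi>)" using quotsD[OF p(1)] by blast
      have "Cod C (Ident C (rep h)) = rep h" using HomD[OF Ident_in_Hom[OF r(2)]] by simp
      then have "\<pi> \<in> qclass C (Ident C (rep h))"
        unfolding qclass_mem_iff[OF quots_Ident[OF r(2)]] using hp i Comp_Ident_right[OF hp] by auto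
      then have "qclass C (Ident C (rep h)) = qclass C \<pi>"
        using qclass_member(2)[OF qclass_carrier[OF quots_Ident[OF r(2)]]] by blast
      then show False using cov p(2) by (auto simp: covers_def)
    qed
    moreover have "quot_interval C \<pi> = {qclass C \<pi>, qclass C (Ident C (rep h))}"
    proof -
      interpret partial_order ?Q using partial_order_quot_poset[OF r(2)] .
      show ?thesis
        using cov le_qclass_Ident unfolding quot_interval_def d p(2) covers_def by auto
    qed
    ultimately have "simple_epi C \<pi>" using d by (simp add: simple_epi_def)
    then show "\<exists>H \<in> h. \<exists>\<pi> \<in> Epi C H (rep (Cod C ` q)). simple_epi C \<pi>"
      using r(1) p(3) g' by auto
  qed
qed

section \<open>Bounded depth as a formation\<close>

definition depth_objects :: "nat \<Rightarrow> 'a set" where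
  "depth_objects n = {X \<in> Obj C. \<forall>q \<in> carrier (quot_poset C X).
     depth_le (quot_poset C X) n q (qclass C (Ident C X))}"

text \<open>Moves the depth of a quotient object into the lattice of \<open>G\<close>, where several
  quotients can be compared.\<close>

lemma depth_precomp_iff:
  assumes p: "\<pi> \<in> quots C G"
  shows "Cod C \<pi> \<in> depth_objects n \<longleftrightarrow>
    (\<forall>x \<in> carrier (quot_poset C G). x \<sqsubseteq>\<^bsub>quot_poset C G\<^esub> qclass C \<pi> \<longrightarrow> depth_le (quot_poset C G) n x (qclass C \<pi>))"
proof -
  have F: "G \<in> Obj C" "Cod C \<pi> \<in> Obj C" using quotsD[OF p] by auto
  let ?\<phi> = "(`) (\<lambda>\<sigma>. Comp C \<sigma> \<pi>)"
  let ?t = "qclass C (Ident C (Cod C \<pi>))"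
  interpret \<phi>: down_embedding "quot_poset C (Cod C \<pi>)" "quot_poset C G" ?\<phi> "qclass C \<pi>"
    using down_embedding_precomp[OF p] partial_order_quot_poset F by blast
  have t: "?t \<in> carrier (quot_poset C (Cod C \<pi>))" using qclass_carrier[OF quots_Ident[OF F(2)]] .
  have ft: "?\<phi> ?t = qclass C \<pi>" using \<phi>.f_top[OF t] le_qclass_Ident by blast
  have *: "depth_le (quot_poset C (Cod C \<pi>)) n q ?t \<longleftrightarrow> depth_le (quot_poset C G) n (?\<phi> q) (qclass C \<pi>)"
    if "q \<in> carrier (quot_poset C (Cod C \<pi>))" for q
    using \<phi>.depth_le_iff[OF that t] ft by simp
  have "Cod C \<pi> \<in> depth_objects n \<longleftrightarrow>
      (\<forall>q \<in> carrier (quot_poset C (Cod C \<pi>)). depth_le (quot_poset C G) n (?\<phi> q) (qclass C \<pi>))"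
    unfolding depth_objects_def using F * by auto
  also have "\<dots> \<longleftrightarrow> (\<forall>x \<in> ?\<phi> ` carrier (quot_poset C (Cod C \<pi>)). depth_le (quot_poset C G) n x (qclass C \<pi>))"
    by blast
  also have "?\<phi> ` carrier (quot_poset C (Cod C \<pi>)) =
      {z \<in> carrier (quot_poset C G). z \<sqsubseteq>\<^bsub>quot_poset C G\<^esub> qclass C \<pi>}"
    using \<phi>.bij unfolding bij_betw_def by blast
  finally show ?thesis by auto
qed

text \<open>A chain from \<open>x\<close> to the top, met with the class of \<open>\<pi>\<close>,
  becomes a chain from \<open>x\<close> to that class.\<close>

lemma depth_objects_downward: "downward_closed C (depth_objects n)"
  unfolding downward_closed_def
proof (intro ballI)
  fix G \<pi> assume G: "G \<in> depth_objects n" and p: "\<pi> \<in> quots C G"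
  have GO: "G \<in> Obj C" using quotsD[OF p] by auto
  interpret modular_lattice "quot_poset C G" using quot_modular_lattice[OF GO] .
  show "Cod C \<pi> \<in> depth_objects n"
    unfolding depth_precomp_iff[OF p]
  proof (intro ballI impI)
    fix x assume x: "x \<in> carrier (quot_poset C G)" "x \<sqsubseteq>\<^bsub>quot_poset C G\<^esub> qclass C \<pi>"
    let ?t = "qclass C (Ident C G)"
    have "depth_le (quot_poset C G) n x ?t" using G x by (auto simp: depth_objects_def)
    then have "depth_le (quot_poset C G) n (x \<sqinter>\<^bsub>quot_poset C G\<^esub> qclass C \<pi>) (?t \<sqinter>\<^bsub>quot_poset C G\<^esub> qclass C \<pi>)"
      using depth_le_meet[OF quot_finite[OF GO]] qclass_carrier[OF p] by blast
    moreover have "x \<sqinter>\<^bsub>quot_poset C G\<^esub> qclass C \<pi> = x" using meet_absorb x qclass_carrier[OF p] by blast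
    moreover have "?t \<sqinter>\<^bsub>quot_poset C G\<^esub> qclass C \<pi> = qclass C \<pi>"
      using meet_absorb[OF qclass_carrier[OF p] qclass_carrier[OF quots_Ident[OF GO]] le_qclass_Ident[OF qclass_carrier[OF p]]]
      by blast
    ultimately show "depth_le (quot_poset C G) n x (qclass C \<pi>)" by simp
  qed
qed

lemma formation_depth_objects: "formation C (depth_objects n)"
  unfolding formation_def
proof (intro conjI)
  show "downward_closed C (depth_objects n)" by (rule depth_objects_downward)
  show "iso_stable C (depth_objects n)"
    unfolding iso_stable_def
  proof
    show "depth_objects n \<subseteq> Obj C" by (auto simp: depth_objects_def)
    show "iso_rel C `` depth_objects n \<subseteq> depth_objects n"
    proof
      fix B assume "B \<in> iso_rel C `` depth_objects n"
      then obtain A where A: "A \<in> depth_objects n" "(A, B) \<in> iso_rel C" by blast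
      obtain f where f: "f \<in> Hom C A B" "iso C f" by (rule iso_rel_imp_Hom[OF A(2)])
      then have "f \<in> quots C A" using quotsI[OF iso_imp_epi] by blast
      then show "B \<in> depth_objects n"
        using depth_objects_downward A(1) HomD[OF f(1)] unfolding downward_closed_def by blast
    qed
  qed
  show "join_closed C (depth_objects n)"
    unfolding join_closed_def
  proof (intro ballI impI)
    fix G \<pi>\<^sub>1 \<pi>\<^sub>2 \<pi>
    assume G: "G \<in> Obj C" and p: "\<pi>\<^sub>1 \<in> quots C G" "\<pi>\<^sub>2 \<in> quots C G" "\<pi> \<in> quots C G"
    assume *: "Cod C \<pi>\<^sub>1 \<in> depth_objects n \<and> Cod C \<pi>\<^sub>2 \<in> depth_objects n \<and>
        least (quot_poset C G) (qclass C \<pi>) (Upper (quot_poset C G) {qclass C \<pi>\<^sub>1, qclass C \<pi>\<^sub>2})"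
    let ?Q = "quot_poset C G"
    interpret modular_lattice ?Q using quot_modular_lattice[OF G] .
    note c = p[THEN qclass_carrier]
    have jn: "qclass C \<pi>\<^sub>1 \<squnion>\<^bsub>?Q\<^esub> qclass C \<pi>\<^sub>2 = qclass C \<pi>"
      using least_unique[OF sup_of_two_least[OF c(1,2)]] * unfolding join_def by blast
    show "Cod C \<pi> \<in> depth_objects n"
      unfolding depth_precomp_iff[OF p(3)]
    proof (intro ballI impI)
      fix x assume x: "x \<in> carrier ?Q" "x \<sqsubseteq>\<^bsub>?Q\<^esub> qclass C \<pi>"
      have m: "depth_le ?Q n (x \<sqinter>\<^bsub>?Q\<^esub> qclass C \<sigma>) (qclass C \<sigma>)"
        if "\<sigma> \<in> quots C G" "Cod C \<sigma> \<in> depth_objects n" for \<sigma>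
        using depth_precomp_iff[OF that(1)] that(2) x(1) qclass_carrier[OF that(1)] by (simp add: meet_right)
      \<comment> \<open>The lattice need not be distributive, so the join of the two meets may be
        strictly below \<open>x\<close>. Joining its chain with the constant chain at
        \<open>x\<close> repairs this: the start becomes \<open>x\<close>, while the end is
        unchanged.\<close>
      let ?m1 = "x \<sqinter>\<^bsub>?Q\<^esub> qclass C \<pi>\<^sub>1" and ?m2 = "x \<sqinter>\<^bsub>?Q\<^esub> qclass C \<pi>\<^sub>2"
      have "depth_le ?Q n (?m1 \<squnion>\<^bsub>?Q\<^esub> ?m2) (qclass C \<pi>)"
        using depth_le_join[OF m[OF p(1)] m[OF p(2)]] * jn by simp
      then have "depth_le ?Q n ((?m1 \<squnion>\<^bsub>?Q\<^esub> ?m2) \<squnion>\<^bsub>?Q\<^esub> x) (qclass C \<pi> \<squnion>\<^bsub>?Q\<^esub> x)"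
        using depth_le_join depth_le_refl[OF x(1)] by blast
      moreover have "(?m1 \<squnion>\<^bsub>?Q\<^esub> ?m2) \<squnion>\<^bsub>?Q\<^esub> x = x"
        using x(1) c join_absorb[of "?m1 \<squnion>\<^bsub>?Q\<^esub> ?m2" x] by (simp add: join_le_iff meet_left)
      moreover have "qclass C \<pi> \<squnion>\<^bsub>?Q\<^esub> x = qclass C \<pi>" using join_absorb x c by blast
      ultimately show "depth_le ?Q n x (qclass C \<pi>)" by simp
    qed
  qed
  show "\<forall>G. minimal C G \<longrightarrow> G \<in> depth_objects n"
  proof (intro allI impI)
    fix G assume G: "minimal C G"
    then have GO: "G \<in> Obj C" by (simp add: minimal_def)
    interpret lattice "quot_poset C G" using lattice_quot_poset[OF GO] .
    show "G \<in> depth_objects n"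
      using G depth_le_refl[of "qclass C (Ident C G)" n] by (auto simp: depth_objects_def minimal_def)
  qed
qed

lemma exists_depth_object:
  assumes X: "X \<in> Obj C"
  shows "\<exists>n. X \<in> depth_objects n"
proof -
  let ?Q = "quot_poset C X" and ?t = "qclass C (Ident C X)"
  interpret lattice ?Q using lattice_quot_poset[OF X] .
  have "\<forall>q \<in> carrier ?Q. \<exists>n. depth_le ?Q n q ?t"
    using exists_depth[OF quot_finite[OF X]] qclass_carrier[OF quots_Ident[OF X]] le_qclass_Ident by blast
  then obtain N where N: "\<forall>q \<in> carrier ?Q. depth_le ?Q (N q) q ?t" by metis
  have "depth_le ?Q (Max (N ` carrier ?Q)) q ?t" if q: "q \<in> carrier ?Q" for q
    using depth_le_mono[of "N q" q ?t "Max (N ` carrier ?Q)"] N q quot_finite[OF X] by simp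
  then show ?thesis using X unfolding depth_objects_def by blast
qed

lemma depth_objects_mono:
  assumes "n \<le> m"
  shows "depth_objects n \<subseteq> depth_objects m"
proof
  fix X assume X: "X \<in> depth_objects n"
  then have XO: "X \<in> Obj C" by (simp add: depth_objects_def)
  interpret lattice "quot_poset C X" using lattice_quot_poset[OF XO] .
  show "X \<in> depth_objects m" using X depth_le_mono[OF _ assms] by (auto simp: depth_objects_def)
qed

lemma level_depth:
  assumes L: "level C L"
  shows "\<exists>n. L \<subseteq> depth_objects n"
proof -
  obtain B where B: "finite B" "B \<subseteq> Obj C // iso_rel C" "L = gen_level C B"
    using L by (auto simp: level_def)
  have "\<forall>c \<in> B. \<exists>n. rep c \<in> depth_objects n"
    using exists_depth_object rep_Obj B by blast
  then obtain N where N: "\<forall>c \<in> B. rep c \<in> depth_objects (N c)" by metis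
  have "c \<subseteq> depth_objects (Max (N ` B))" if c: "c \<in> B" for c
  proof -
    have cc: "c \<in> Obj C // iso_rel C" using B c by blast
    have "rep c \<in> depth_objects (Max (N ` B))"
      using N c B(1) depth_objects_mono[of "N c" "Max (N ` B)"] by auto
    moreover have st: "iso_stable C (depth_objects (Max (N ` B)))"
      using formation_depth_objects by (simp add: formation_def)
    ultimately have "c \<in> depth_objects (Max (N ` B)) // iso_rel C"
      using mem_quotient_iff[OF st cc rep_in[OF cc]] by simp
    then show ?thesis using class_subset_iff[OF st cc] by simp
  qed
  then show ?thesis
    using gen_level_least[OF formation_depth_objects] B(3) by (metis Sup_le_iff)
qed

section \<open>The maximal quotient in a level\<close>

definition level_max :: "'a set \<Rightarrow> 'a set \<Rightarrow> 'b set \<Rightarrow> bool" where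
  "level_max L c s \<longleftrightarrow> s \<in> carrier (quot_poset C (rep c)) \<and> Cod C ` s \<in> L // iso_rel C \<and>
     (\<forall>q \<in> carrier (quot_poset C (rep c)). Cod C ` q \<in> L // iso_rel C \<longrightarrow> q \<sqsubseteq>\<^bsub>quot_poset C (rep c)\<^esub> s)"

text \<open>A minimal element of the lattice of \<open>G\<close> has only itself below it, so its
  codomain has a single quotient. Levels contain the minimal objects, and \<open>G\<close> thus has
  a quotient in each of them.\<close>

lemma minimal_quotient:
  assumes G: "G \<in> Obj C"
  shows "\<exists>\<pi> \<in> quots C G. minimal C (Cod C \<pi>)"
proof -
  interpret lattice "quot_poset C G" using lattice_quot_poset[OF G] .
  have "carrier (quot_poset C G) \<noteq> {}" using qclass_carrier[OF quots_Ident[OF G]] by auto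
  then obtain b where b: "b \<in> carrier (quot_poset C G)" "\<forall>y \<in> carrier (quot_poset C G). y \<sqsubseteq>\<^bsub>quot_poset C G\<^esub> b \<longrightarrow> y = b"
    using exists_minimal[OF quot_finite[OF G]] by blast
  then obtain \<pi> where p: "\<pi> \<in> quots C G" "b = qclass C \<pi>" by (auto simp: carrier_quot_poset)
  have F: "Cod C \<pi> \<in> Obj C" using quotsD[OF p(1)] by auto
  interpret \<phi>: down_embedding "quot_poset C (Cod C \<pi>)" "quot_poset C G" "(`) (\<lambda>\<sigma>. Comp C \<sigma> \<pi>)" "qclass C \<pi>"
    using down_embedding_precomp[OF p(1)] partial_order_quot_poset F G by blast
  have t: "qclass C (Ident C (Cod C \<pi>)) \<in> carrier (quot_poset C (Cod C \<pi>))"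
    using qclass_carrier[OF quots_Ident[OF F]] .
  have "q = qclass C (Ident C (Cod C \<pi>))" if "q \<in> carrier (quot_poset C (Cod C \<pi>))" for q
  proof -
    have "(`) (\<lambda>\<sigma>. Comp C \<sigma> \<pi>) q = b" "(`) (\<lambda>\<sigma>. Comp C \<sigma> \<pi>) (qclass C (Ident C (Cod C \<pi>))) = b"
      using \<phi>.f_carrier[OF that] \<phi>.f_carrier[OF t] b(2) p(2) by blast+
    then show ?thesis using \<phi>.f_eq_iff[OF that t] by simp
  qed
  then have "minimal C (Cod C \<pi>)" unfolding minimal_def using F t by blast
  then show ?thesis using p(1) by blast
qed

text \<open>A maximal quotient in \<open>L\<close> absorbs every other one, since the join of two
  quotients in \<open>L\<close> is again in \<open>L\<close>.\<close>

lemma exists_level_max: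
  assumes L: "level C L" and c: "c \<in> Obj C // iso_rel C"
  shows "\<exists>s. level_max L c s"
proof -
  let ?Q = "quot_poset C (rep c)"
  have r: "rep c \<in> Obj C" using rep_Obj[OF c] .
  interpret lattice ?Q using lattice_quot_poset[OF r] .
  note st = level_iso_stable[OF L]
  let ?S = "{q \<in> carrier ?Q. Cod C ` q \<in> L // iso_rel C}"
  have mem: "qclass C \<pi> \<in> ?S \<longleftrightarrow> Cod C \<pi> \<in> L" if "\<pi> \<in> quots C (rep c)" for \<pi>
    using type_subset_iff[OF st that] class_subset_iff[OF st type_in_classes[OF qclass_carrier[OF that]]]
      qclass_carrier[OF that] by simp
  obtain \<beta> where "\<beta> \<in> quots C (rep c)" "minimal C (Cod C \<beta>)" using minimal_quotient[OF r] by blast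
  then have "qclass C \<beta> \<in> ?S" using mem level_formation[OF L] by (auto simp: formation_def)
  then have "finite ?S" "?S \<noteq> {}" "?S \<subseteq> carrier ?Q" using quot_finite[OF r] by auto
  then obtain s where s: "s \<in> ?S" "\<forall>y \<in> ?S. s \<sqsubseteq>\<^bsub>?Q\<^esub> y \<longrightarrow> y = s"
    using exists_maximal by meson
  have "q \<sqsubseteq>\<^bsub>?Q\<^esub> s" if q: "q \<in> ?S" for q
  proof -
    obtain \<pi>\<^sub>1 \<pi>\<^sub>2 \<pi> where p: "\<pi>\<^sub>1 \<in> quots C (rep c)" "q = qclass C \<pi>\<^sub>1" "\<pi>\<^sub>2 \<in> quots C (rep c)" "s = qclass C \<pi>\<^sub>2"
      "\<pi> \<in> quots C (rep c)" "q \<squnion>\<^bsub>?Q\<^esub> s = qclass C \<pi>"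
    proof -
      have "q \<in> carrier ?Q" "s \<in> carrier ?Q" "q \<squnion>\<^bsub>?Q\<^esub> s \<in> carrier ?Q" using q s by auto
      then show ?thesis using that unfolding carrier_quot_poset by blast
    qed
    have "least ?Q (qclass C \<pi>) (Upper ?Q {qclass C \<pi>\<^sub>1, qclass C \<pi>\<^sub>2})"
      using sup_of_two_least[of q s] q s(1) p by (simp add: join_def)
    moreover have "Cod C \<pi>\<^sub>1 \<in> L" "Cod C \<pi>\<^sub>2 \<in> L" using mem p q s(1) by auto
    moreover have "join_closed C L" using level_formation[OF L] by (simp add: formation_def)
    ultimately have "Cod C \<pi> \<in> L" unfolding join_closed_def using r p(1,3,5) by blast
    then have "q \<squnion>\<^bsub>?Q\<^esub> s \<in> ?S" using mem[OF p(5)] p(6) by simp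
    then have "q \<squnion>\<^bsub>?Q\<^esub> s = s" using s q join_right[of q s] by auto
    then show ?thesis using join_left[of q s] q s by auto
  qed
  then show ?thesis using s(1) unfolding level_max_def by blast
qed

text \<open>The supremum in \<open>level_quot\<close> is taken over a set that has a greatest
  element, so it is attained there.\<close>

lemma level_quot_eq:
  assumes L: "level C L" and c: "c \<in> Obj C // iso_rel C" and s: "level_max L c s"
  shows "level_quot C L (rep c) = Cod C ` s"
proof -
  let ?Q = "quot_poset C (rep c)"
  have r: "rep c \<in> Obj C" using rep_Obj[OF c] .
  interpret lattice ?Q using lattice_quot_poset[OF r] .
  let ?S = "{q \<in> carrier ?Q. Cod C ` q \<subseteq> L}"
  have S: "?S = {q \<in> carrier ?Q. Cod C ` q \<in> L // iso_rel C}"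
    using class_subset_iff[OF level_iso_stable[OF L] type_in_classes] by auto
  have "least ?Q s (Upper ?Q ?S)"
    using s unfolding level_max_def S by (intro least_UpperI) auto
  then have "\<Squnion>\<^bsub>?Q\<^esub> ?S = s"
    unfolding sup_def using least_unique by (metis (lifting) someI)
  then show ?thesis by (simp add: level_quot_def)
qed

lemma level_quot_in:
  assumes "level C L" "c \<in> Obj C // iso_rel C"
  shows "level_quot C L (rep c) \<in> L // iso_rel C"
  using exists_level_max[OF assms] level_quot_eq[OF assms] by (auto simp: level_max_def)

lemma level_quot_self:
  assumes L: "level C L" and c: "c \<in> L // iso_rel C"
  shows "level_quot C L (rep c) = c"
proof -
  have cc: "c \<in> Obj C // iso_rel C" using level_classes[OF L] c by blast
  have "level_max L c (qclass C (Ident C (rep c)))"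
    unfolding level_max_def using quots.tp_carrier[OF cc] quots.ty_tp[OF cc] quots.le_tp[OF cc] c by auto
  then show ?thesis using level_quot_eq[OF L cc] quots.ty_tp[OF cc] by simp
qed

text \<open>The maximal quotient in \<open>L\<close> lies below the one in \<open>L'\<close>, hence
  is a quotient of the latter, and the embedding of lattices keeps it maximal. Compatible families
  can therefore be built along a sequence of levels.\<close>

lemma level_quot_trans:
  assumes L: "level C L" "level C L'" "L \<subseteq> L'" and c: "c \<in> Obj C // iso_rel C"
  shows "level_quot C L (rep (level_quot C L' (rep c))) = level_quot C L (rep c)"
proof -
  obtain s s' where s: "level_max L c s" "level_max L' c s'"
    using exists_level_max L c by blast
  have LL: "L // iso_rel C \<subseteq> L' // iso_rel C" using L(3) by (auto simp: quotient_def)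
  then have ss: "s \<sqsubseteq>\<^bsub>quot_poset C (rep c)\<^esub> s'" using s by (auto simp: level_max_def)
  have sc: "s \<in> carrier (quot_poset C (rep c))" "s' \<in> carrier (quot_poset C (rep c))"
    using s by (auto simp: level_max_def)
  let ?d = "Cod C ` s'"
  have d: "?d \<in> Obj C // iso_rel C" using type_in_classes[OF sc(2)] .
  obtain f where f: "down_embedding (quot_poset C (rep ?d)) (quot_poset C (rep c)) f s'"
    and "\<forall>x \<in> carrier (quot_poset C (rep ?d)). Cod C ` f x = Cod C ` x"
    using quots.ex_embedding[OF c sc(2)] by (elim exE conjE)
  then have tf: "\<And>x. x \<in> carrier (quot_poset C (rep ?d)) \<Longrightarrow> Cod C ` f x = Cod C ` x"
    by (simp only:)
  interpret f: down_embedding "quot_poset C (rep ?d)" "quot_poset C (rep c)" f s' by fact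
  obtain x where x: "x \<in> carrier (quot_poset C (rep ?d))" "s = f x" using f.f_preimage[OF sc(1) ss] .
  have "level_max L ?d x"
    unfolding level_max_def
  proof (intro conjI ballI impI)
    show "Cod C ` x \<in> L // iso_rel C" using s(1) tf[OF x(1)] x(2) by (simp add: level_max_def)
    fix y assume y: "y \<in> carrier (quot_poset C (rep ?d))" "Cod C ` y \<in> L // iso_rel C"
    then have "f y \<sqsubseteq>\<^bsub>quot_poset C (rep c)\<^esub> f x"
      using s(1) f.f_carrier[OF y(1)] tf[OF y(1)] x(2) by (simp add: level_max_def)
    then show "y \<sqsubseteq>\<^bsub>quot_poset C (rep ?d)\<^esub> x" using f.le_iff y(1) x(1) by blast
  qed (rule x(1))
  then show ?thesis
    using level_quot_eq[OF L(1) d] level_quot_eq[OF L(1) c s(1)] level_quot_eq[OF L(2) c s(2)] tf[OF x(1)] x(2) by simp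
qed

text \<open>All quotients of a type in \<open>L\<close> lie below the maximal quotient in
  \<open>L\<close>. So a moment can be computed at any level containing the type.\<close>

lemma cnt_level_quot:
  assumes L: "level C L" and c: "c \<in> Obj C // iso_rel C" and g: "g \<in> L // iso_rel C"
  shows "quots.cnt (level_quot C L (rep c)) g = quots.cnt c g"
proof -
  obtain s where s: "level_max L c s" using exists_level_max[OF L c] by blast
  then have sc: "s \<in> carrier (quot_poset C (rep c))" by (simp add: level_max_def)
  have "{p \<in> carrier (quot_poset C (rep c)). p \<sqsubseteq>\<^bsub>quot_poset C (rep c)\<^esub> s \<and> Cod C ` p = g} =
      {q \<in> carrier (quot_poset C (rep c)). Cod C ` q = g}"
    using s g by (auto simp: level_max_def)
  then show ?thesis
    using quots.card_below(1)[OF c sc, of g] level_quot_eq[OF L c s] by (simp add: quots.cnt_def)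
qed

text \<open>The maximal quotient in \<open>L\<close> is itself a quotient of \<open>c\<close>. Hence
  the indicator of a fibre of \<open>level_quot\<close> is dominated by a count.\<close>

lemma cnt_level_quot_pos:
  assumes L: "level C L" and c: "c \<in> Obj C // iso_rel C"
  shows "1 \<le> quots.cnt c (level_quot C L (rep c))"
  using cnt_level_quot[OF L c level_quot_in[OF L c]]
    quots.cnt_self_pos[of "level_quot C L (rep c)"] level_quot_in[OF L c] level_classes[OF L] by auto

section \<open>A cofinal sequence of levels\<close>

definition nth_level :: "nat \<Rightarrow> 'a set" where
  "nth_level n = gen_level C {c \<in> Obj C // iso_rel C. to_nat_on (Obj C // iso_rel C) c < n}"

lemma nth_level_mono: "n \<le> m \<Longrightarrow> nth_level n \<subseteq> nth_level m"
  unfolding nth_level_def gen_level_def by (intro Inf_superset_mono) fastforce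

context
  assumes cnt_classes: "countable (Obj C // iso_rel C)"
begin

lemma level_nth_level: "level C (nth_level n)"
  unfolding level_def nth_level_def
proof (intro exI conjI)
  have "finite (to_nat_on (Obj C // iso_rel C) ` {c \<in> Obj C // iso_rel C. to_nat_on (Obj C // iso_rel C) c < n})"
    by (rule finite_subset[of _ "{..<n}"]) auto
  then show "finite {c \<in> Obj C // iso_rel C. to_nat_on (Obj C // iso_rel C) c < n}"
    by (rule finite_imageD) (rule inj_on_subset[OF inj_on_to_nat_on[OF cnt_classes]], auto)
qed auto

text \<open>The finitely many generators of a level occur among the first classes of the
  enumeration. So a pro-isomorphism class is determined by its values on this sequence.\<close>

lemma level_subset_nth_level:
  assumes "level C L"
  shows "\<exists>n. L \<subseteq> nth_level n"
proof -
  obtain B where B: "finite B" "B \<subseteq> Obj C // iso_rel C" "L = gen_level C B"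
    using assms by (auto simp: level_def)
  let ?t = "to_nat_on (Obj C // iso_rel C)"
  have "B \<subseteq> {c \<in> Obj C // iso_rel C. ?t c < Suc (Max (?t ` B))}"
    using B by (auto simp: less_Suc_eq_le)
  then have "L \<subseteq> nth_level (Suc (Max (?t ` B)))"
    unfolding B(3) nth_level_def gen_level_def by (intro Inf_superset_mono) fastforce
  then show ?thesis by blast
qed

end

lemma level_gen_single:
  assumes "G \<in> Obj C"
  shows "level C (gen_level C {iso_class C G})" "G \<in> gen_level C {iso_class C G}"
proof -
  have B: "{iso_class C G} \<subseteq> Obj C // iso_rel C" using iso_class_in[OF assms] by simp
  then show "level C (gen_level C {iso_class C G})"
    unfolding level_def by (intro exI[of _ "{iso_class C G}"]) simp
  show "G \<in> gen_level C {iso_class C G}" using formation_gen_level(2)[OF B] iso_class_self[OF assms] by auto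
qed

lemma gen_single_subset:
  assumes L: "level C L" and G: "G \<in> L"
  shows "gen_level C {iso_class C G} \<subseteq> L"
proof (rule gen_level_least[OF level_formation[OF L]])
  show "\<Union>{iso_class C G} \<subseteq> L" using iso_stable_mem[OF level_iso_stable[OF L] G] by auto
qed

end

section \<open>Nested partitions of the line into intervals\<close>

lemma has_sum_of_nn_integral:
  fixes f :: "'a \<Rightarrow> real"
  assumes nonneg: "\<And>x. x \<in> A \<Longrightarrow> 0 \<le> f x" and T: "0 \<le> T"
    and int: "(\<integral>\<^sup>+ x. ennreal (f x) \<partial>count_space A) = ennreal T"
  shows "(f has_sum T) A"
proof -
  have "sum f F \<le> T" if F: "F \<subseteq> A" "finite F" for F
  proof -
    have "ennreal (sum f F) = (\<Sum>x \<in> F. ennreal (f x))"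
      using nonneg F by (intro sum_ennreal[symmetric]) auto
    also have "\<dots> = (\<integral>\<^sup>+ x. ennreal (f x) * indicator F x \<partial>count_space A)"
      using F by (subst nn_integral_count_space'[of F]) (auto simp: indicator_def)
    also have "\<dots> \<le> (\<integral>\<^sup>+ x. ennreal (f x) \<partial>count_space A)"
      by (intro nn_integral_mono) (auto simp: indicator_def)
    finally show ?thesis using int T by simp
  qed
  then have sm: "f summable_on A"
    using nonneg by (intro nonneg_bdd_above_summable_on) (auto simp: bdd_above_def)
  have "(\<lambda>x. norm (f x)) summable_on A"
    using sm nonneg by (subst summable_on_cong[of A _ f]) auto
  then have abs: "Infinite_Set_Sum.abs_summable_on f A"
    using abs_summable_equivalent by blast
  have "ennreal T = ennreal (infsum f A)"
    using nn_integral_conv_infsetsum[OF abs] nonneg int infsetsum_infsum[OF abs] by simp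
  then have "infsum f A = T"
    using T nonneg by (simp add: infsum_nonneg)
  then show ?thesis using has_sum_infsum[OF sm] by simp
qed

text \<open>The left end of the block of \<open>y\<close> when blocks of lengths \<open>v\<close>
  are laid end to end from 0 in the order given by \<open>e\<close>. For injective \<open>e\<close>
  only finitely many blocks precede a given one, so the total length may be infinite.\<close>

definition block_start :: "('c \<Rightarrow> nat) \<Rightarrow> ('c \<Rightarrow> real) \<Rightarrow> 'c set \<Rightarrow> 'c \<Rightarrow> real" where
  "block_start e v B y = (\<Sum>z \<in> {z \<in> B. e z < e y}. v z)"

lemma finite_below: "inj_on e B \<Longrightarrow> finite {z \<in> B. e z < (k::nat)}"
  by (rule inj_on_finite[of e _ "{..<k}"]) (auto intro: inj_on_subset)

lemma sum_below_le:
  assumes e: "inj_on e B" and v: "\<And>z. z \<in> B \<Longrightarrow> 0 \<le> (v z :: real)" and y: "y \<in> B" "e y < k"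
  shows "block_start e v B y + v y \<le> (\<Sum>z \<in> {z \<in> B. e z < k}. v z)"
proof -
  have "block_start e v B y + v y = (\<Sum>z \<in> insert y {z \<in> B. e z < e y}. v z)"
    using finite_below[OF e] by (simp add: block_start_def)
  also have "\<dots> \<le> (\<Sum>z \<in> {z \<in> B. e z < k}. v z)"
    using finite_below[OF e] v y by (intro sum_mono2) auto
  finally show ?thesis .
qed

lemma block_disjoint:
  assumes e: "inj_on e B" and v: "\<And>z. z \<in> B \<Longrightarrow> 0 \<le> (v z :: real)" and yz: "y \<in> B" "z \<in> B" "y \<noteq> z"
    and x: "block_start e v B y \<le> x" "x < block_start e v B y + v y"
      "block_start e v B z \<le> x" "x < block_start e v B z + v z"
  shows False
proof -
  have "e y \<noteq> e z" using e yz by (auto simp: inj_on_def)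
  then consider "e y < e z" | "e z < e y" by linarith
  then show False
  proof cases
    case 1
    show ?thesis using sum_below_le[of e B v y "e z", OF e v yz(1) 1] x by (simp add: block_start_def)
  next
    case 2
    show ?thesis using sum_below_le[of e B v z "e y", OF e v yz(2) 2] x by (simp add: block_start_def)
  qed
qed

text \<open>A point lies in the block at which the partial sums first exceed it; the sums converge
  to \<open>T\<close>, so this happens exactly below \<open>T\<close>.\<close>

lemma block_cover:
  assumes e: "inj_on e B" and v: "\<And>z. z \<in> B \<Longrightarrow> 0 \<le> (v z :: real)" and T: "(v has_sum T) B"
  shows "(\<exists>y \<in> B. block_start e v B y \<le> x \<and> x < block_start e v B y + v y) \<longleftrightarrow> 0 \<le> x \<and> x < T"
proof
  assume "\<exists>y \<in> B. block_start e v B y \<le> x \<and> x < block_start e v B y + v y"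
  then obtain y where y: "y \<in> B" "block_start e v B y \<le> x" "x < block_start e v B y + v y" by blast
  have "0 \<le> block_start e v B y" unfolding block_start_def using v by (intro sum_nonneg) auto
  moreover have "(\<Sum>z \<in> {z \<in> B. e z < Suc (e y)}. v z) \<le> T"
    using finite_below[OF e] v by (intro finite_sum_le_has_sum[OF T]) auto
  ultimately show "0 \<le> x \<and> x < T"
    using sum_below_le[of e B v y "Suc (e y)", OF e v y(1)] y by auto
next
  assume x: "0 \<le> x \<and> x < T"
  define S where "S k = (\<Sum>z \<in> {z \<in> B. e z < k}. v z)" for k
  have "\<exists>k. x < S k"
  proof -
    have "(sum v \<longlongrightarrow> T) (finite_subsets_at_top B)" using T by (simp add: has_sum_def)
    then have "\<forall>\<^sub>F F in finite_subsets_at_top B. x < sum v F"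
      using x by (intro order_tendstoD(1)) auto
    then obtain F where F: "finite F" "F \<subseteq> B" "x < sum v F"
      unfolding eventually_finite_subsets_at_top by blast
    obtain k where k: "\<And>z. z \<in> F \<Longrightarrow> e z < k"
      using F(1) finite_nat_set_iff_bounded[of "e ` F"] by auto
    have "sum v F \<le> S k"
      unfolding S_def using F k v finite_below[OF e] by (intro sum_mono2) auto
    then show ?thesis using F(3) by (intro exI[of _ k]) simp
  qed
  \<comment> \<open>The least such index is positive because \<open>S 0 = 0\<close>, and the last
    increment must come from an element numbered one less.\<close>
  then obtain k where k: "x < S k" "\<And>j. j < k \<Longrightarrow> \<not> x < S j"
    using exists_least_iff[of "\<lambda>k. x < S k"] by blast
  have "S 0 = 0" by (simp add: S_def)
  then have "k \<noteq> 0" using k(1) x by (intro notI) simp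
  then obtain j where j: "k = Suc j" by (cases k) auto
  have Sj: "S j \<le> x" using k(2)[of j] j by simp
  have "\<exists>y \<in> B. e y = j"
  proof (rule ccontr)
    assume "\<not> (\<exists>y \<in> B. e y = j)"
    then have "{z \<in> B. e z < k} = {z \<in> B. e z < j}" using j less_Suc_eq by auto
    then show False using k(1) Sj by (simp add: S_def)
  qed
  then obtain y where y: "y \<in> B" "e y = j" by blast
  have "{z \<in> B. e z < k} = insert y {z \<in> B. e z < j}"
    using j y e by (auto simp: less_Suc_eq inj_on_def)
  then have "S k = S j + v y" using finite_below[OF e] y by (simp add: S_def)
  then show "\<exists>y \<in> B. block_start e v B y \<le> x \<and> x < block_start e v B y + v y"
    using y Sj k(1) by (intro bexI[of _ y]) (auto simp: block_start_def S_def)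
qed

text \<open>The nodes at height \<open>n\<close> form \<open>A n\<close>, and \<open>p n\<close>
  sends a node to its parent, whose mass is the sum of the masses of its children. The masses of the
  roots may have an infinite sum.\<close>

locale mass_tree =
  fixes A :: "nat \<Rightarrow> 'c set" and p :: "nat \<Rightarrow> 'c \<Rightarrow> 'c" and v :: "nat \<Rightarrow> 'c \<Rightarrow> real" and e :: "'c \<Rightarrow> nat"
  assumes inj_e: "inj_on e (A n)"
    and p_in: "y \<in> A (Suc n) \<Longrightarrow> p n y \<in> A n"
    and v_nonneg: "x \<in> A n \<Longrightarrow> 0 \<le> v n x"
    and v_sum: "x \<in> A n \<Longrightarrow> (v (Suc n) has_sum v n x) {y \<in> A (Suc n). p n y = x}"
begin

primrec start :: "nat \<Rightarrow> 'c \<Rightarrow> real" where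
  "start 0 x = block_start e (v 0) (A 0) x"
| "start (Suc n) y = start n (p n y) + block_start e (v (Suc n)) {z \<in> A (Suc n). p n z = p n y} y"

definition ivl :: "nat \<Rightarrow> 'c \<Rightarrow> real set" where
  "ivl n x = {start n x ..< start n x + v n x}"

text \<open>The covering by blocks, shifted to the start of \<open>x\<close>. A node of mass zero
  gets the empty interval, so no point runs through it.\<close>

lemma ivl_children:
  assumes x: "x \<in> A n"
  shows "\<omega> \<in> ivl n x \<longleftrightarrow> (\<exists>y \<in> A (Suc n). p n y = x \<and> \<omega> \<in> ivl (Suc n) y)"
proof -
  let ?B = "{y \<in> A (Suc n). p n y = x}"
  have e: "inj_on e ?B" by (rule inj_on_subset[OF inj_e[of "Suc n"]]) auto
  have "\<omega> \<in> ivl n x \<longleftrightarrow> 0 \<le> \<omega> - start n x \<and> \<omega> - start n x < v n x"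
    by (auto simp: ivl_def)
  also have "\<dots> \<longleftrightarrow> (\<exists>y \<in> ?B. block_start e (v (Suc n)) ?B y \<le> \<omega> - start n x \<and>
      \<omega> - start n x < block_start e (v (Suc n)) ?B y + v (Suc n) y)"
    using block_cover[OF e _ v_sum[OF x]] v_nonneg by auto
  also have "\<dots> \<longleftrightarrow> (\<exists>y \<in> ?B. \<omega> \<in> ivl (Suc n) y)"
    by (intro bex_cong) (auto simp: ivl_def algebra_simps)
  finally show ?thesis by auto
qed

lemma ivl_disjoint:
  "\<lbrakk>x \<in> A n; y \<in> A n; \<omega> \<in> ivl n x; \<omega> \<in> ivl n y\<rbrakk> \<Longrightarrow> x = y"
proof (induction n arbitrary: x y)
  case 0
  show ?case
  proof (rule ccontr)
    assume "x \<noteq> y"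
    then show False
      using block_disjoint[OF inj_e, of 0 "v 0" x y \<omega>] v_nonneg[of _ 0] 0 by (auto simp: ivl_def)
  qed
next
  case (Suc n)
  have "p n x = p n y"
    using Suc.IH[of "p n x" "p n y"] ivl_children[of "p n x" n \<omega>] ivl_children[of "p n y" n \<omega>] Suc.prems p_in by blast
  let ?B = "{z \<in> A (Suc n). p n z = p n y}"
  have e: "inj_on e ?B" by (rule inj_on_subset[OF inj_e[of "Suc n"]]) auto
  show ?case
  proof (rule ccontr)
    assume "x \<noteq> y"
    then show False
      using block_disjoint[OF e, of "v (Suc n)" x y "\<omega> - start n (p n y)"] v_nonneg[of _ "Suc n"] Suc.prems \<open>p n x = p n y\<close>
      by (auto simp: ivl_def)
  qed
qed

lemma emeasure_ivl: "x \<in> A n \<Longrightarrow> emeasure lborel (ivl n x) = ennreal (v n x)"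
  using v_nonneg by (simp add: ivl_def)

definition points :: "real set" where "points = (\<Union>x \<in> A 0. ivl 0 x)"

lemma branch_exists:
  assumes "\<omega> \<in> points"
  shows "\<exists>x \<in> A n. \<omega> \<in> ivl n x"
proof (induction n)
  case 0
  then show ?case using assms by (auto simp: points_def)
next
  case (Suc n)
  then show ?case using ivl_children by blast
qed

text \<open>The infinite path of nodes whose intervals contain \<open>\<omega>\<close>; outside
  \<open>points\<close> the value is meaningless.\<close>

definition branch :: "real \<Rightarrow> nat \<Rightarrow> 'c" where
  "branch \<omega> n = (THE x. x \<in> A n \<and> \<omega> \<in> ivl n x)"

lemma branch_eq: "\<lbrakk>x \<in> A n; \<omega> \<in> ivl n x\<rbrakk> \<Longrightarrow> branch \<omega> n = x"
  unfolding branch_def using ivl_disjoint by (intro the_equality) auto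

lemma branch_in: "\<omega> \<in> points \<Longrightarrow> branch \<omega> n \<in> A n \<and> \<omega> \<in> ivl n (branch \<omega> n)"
  using branch_exists[of \<omega> n] branch_eq by auto

lemma branch_Suc: "\<omega> \<in> points \<Longrightarrow> p n (branch \<omega> (Suc n)) = branch \<omega> n"
  using branch_in[of \<omega> "Suc n"] ivl_children[of "p n (branch \<omega> (Suc n))" n \<omega>] p_in
  by (intro branch_eq[symmetric]) auto

lemma ivl_points: "x \<in> A n \<Longrightarrow> ivl n x \<subseteq> points"
proof (induction n arbitrary: x)
  case 0
  then show ?case by (auto simp: points_def)
next
  case (Suc n)
  have "ivl (Suc n) x \<subseteq> ivl n (p n x)"
    using ivl_children[OF p_in[OF Suc.prems]] Suc.prems by blast
  then show ?case using Suc.IH[OF p_in[OF Suc.prems]] by blast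
qed

lemma branch_eq_iff: "\<lbrakk>\<omega> \<in> points; x \<in> A n\<rbrakk> \<Longrightarrow> branch \<omega> n = x \<longleftrightarrow> \<omega> \<in> ivl n x"
  using branch_in branch_eq by blast

lemma points_borel: "points \<in> sets borel"
proof -
  have "countable (A 0)" using inj_e by (rule countableI)
  then show ?thesis unfolding points_def by (intro sets.countable_UN'') (auto simp: ivl_def)
qed

end

section \<open>Pro-isomorphism classes\<close>

context diamond_category
begin

text \<open>The basic open set indexed by a class instead of an object, so that sums over
  \<open>L // iso_rel C\<close> can be formed.\<close>

definition cyl :: "'a set \<Rightarrow> 'a set \<Rightarrow> ('a set \<Rightarrow> 'a set) set" where
  "cyl L c = {X \<in> pro_classes C. X L = c}"

lemma pro_class_in: "\<lbrakk>X \<in> pro_classes C; level C L\<rbrakk> \<Longrightarrow> X L \<in> L // iso_rel C"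
  by (auto simp: pro_classes_def PiE_def Pi_def)

lemma pro_class_trans:
  "\<lbrakk>X \<in> pro_classes C; level C L; level C L'; L \<subseteq> L'\<rbrakk> \<Longrightarrow> level_quot C L (rep (X L')) = X L"
  by (auto simp: pro_classes_def)

lemma pro_nbhd_eq_cyl: "pro_nbhd C L F = cyl L (iso_class C F)"
  by (simp add: pro_nbhd_def cyl_def)

lemma pro_nbhds_eq: "pro_nbhds C = {cyl L c | L c. level C L \<and> c \<in> L // iso_rel C}"
proof (intro Set.set_eqI iffI)
  fix U assume "U \<in> pro_nbhds C"
  then show "U \<in> {cyl L c | L c. level C L \<and> c \<in> L // iso_rel C}"
    using iso_class_in_quotient by (auto simp: pro_nbhds_def pro_nbhd_eq_cyl)
next
  fix U assume "U \<in> {cyl L c | L c. level C L \<and> c \<in> L // iso_rel C}"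
  then obtain L c where L: "level C L" "c \<in> L // iso_rel C" "U = cyl L c" by blast
  have "U = pro_nbhd C L (rep c)"
    using iso_class_rep level_classes[OF L(1)] L by (auto simp: pro_nbhd_eq_cyl)
  then show "U \<in> pro_nbhds C"
    using L(1) level_rep[OF L(1,2)] unfolding pro_nbhds_def by blast
qed

lemma cyl_sub: "cyl L c \<subseteq> pro_classes C"
  by (auto simp: cyl_def)

lemma pro_nbhds_Pow: "pro_nbhds C \<subseteq> Pow (pro_classes C)"
  using cyl_sub by (auto simp: pro_nbhds_eq)

text \<open>The union may be infinite, so the resulting relation between masses does not pass to
  limits by itself; this is the task of \<open>limit_mass_split\<close>.\<close>

lemma cyl_split:
  assumes L: "level C L" "level C L'" "L \<subseteq> L'"
  shows "cyl L c = (\<Union>d \<in> {d \<in> L' // iso_rel C. level_quot C L (rep d) = c}. cyl L' d)"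
  using pro_class_in L pro_class_trans[OF _ L] by (auto simp: cyl_def)

lemma pro_epi_count_eq:
  assumes X: "X \<in> pro_classes C" and L: "level C L" and G: "G \<in> L"
  shows "pro_epi_count C X G = card (Aut C G) * quots.cnt (X L) (iso_class C G)"
proof -
  have GO: "G \<in> Obj C" using level_Obj[OF L] G by auto
  let ?L = "gen_level C {iso_class C G}"
  note l = level_gen_single[OF GO]
  have sub: "?L \<subseteq> L" using gen_single_subset[OF L G] .
  have XL: "X L \<in> Obj C // iso_rel C" "X ?L \<in> Obj C // iso_rel C"
    using pro_class_in[OF X] L l level_classes by blast+
  have "quots.cnt (X ?L) (iso_class C G) = quots.cnt (X L) (iso_class C G)"
    using cnt_level_quot[OF l(1) XL(1) iso_class_in_quotient[OF l(2)]] pro_class_trans[OF X l(1) L sub] by simp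
  then show ?thesis unfolding pro_epi_count_def card_Epi_rep[OF XL(2) GO] by simp
qed

end

section \<open>Measures on pro-isomorphism classes in the countable case\<close>

locale countable_diamond_category = diamond_category +
  assumes countable_classes: "countable (Obj C // iso_rel C)"
begin

lemma level_nth [simp, intro]: "level C (nth_level n)"
  using level_nth_level[OF countable_classes] .

lemma countable_level: "level C L \<Longrightarrow> countable (L // iso_rel C)"
  using countable_subset[OF level_classes countable_classes] .

lemma cyl_measurable:
  assumes "pro_measure C \<nu>" "level C L" "c \<in> L // iso_rel C"
  shows "cyl L c \<in> sets \<nu>"
  using assms unfolding pro_measure_def pro_nbhds_eq by (auto intro: sigma_sets.Basic)

text \<open>Evaluation at \<open>L\<close> has countably many fibres, so the integrand is a
  countable sum of multiples of indicators of cylinders.\<close>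

lemma nn_integral_level:
  assumes \<nu>: "pro_measure C \<nu>" and L: "level C L"
  shows "(\<integral>\<^sup>+ X. f (X L) \<partial>\<nu>) = (\<integral>\<^sup>+ c. f c * emeasure \<nu> (cyl L c) \<partial>count_space (L // iso_rel C))"
proof -
  have "(\<integral>\<^sup>+ X. f (X L) \<partial>\<nu>) = (\<integral>\<^sup>+ X. (\<integral>\<^sup>+ c. f c * indicator (cyl L c) X \<partial>count_space (L // iso_rel C)) \<partial>\<nu>)"
  proof (rule nn_integral_cong)
    fix X assume "X \<in> space \<nu>"
    then have X: "X \<in> pro_classes C" using \<nu> by (simp add: pro_measure_def)
    have "(\<integral>\<^sup>+ c. f c * indicator (cyl L c) X \<partial>count_space (L // iso_rel C)) = (\<Sum>c \<in> {X L}. f c * indicator (cyl L c) X)"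
      using pro_class_in[OF X L] X by (intro nn_integral_count_space') (auto simp: cyl_def)
    then show "f (X L) = (\<integral>\<^sup>+ c. f c * indicator (cyl L c) X \<partial>count_space (L // iso_rel C))"
      using X by (simp add: cyl_def)
  qed
  also have "\<dots> = (\<integral>\<^sup>+ c. (\<integral>\<^sup>+ X. f c * indicator (cyl L c) X \<partial>\<nu>) \<partial>count_space (L // iso_rel C))"
    using cyl_measurable[OF \<nu> L] by (intro nn_integral_count_space_nn_integral countable_level[OF L]) auto
  also have "\<dots> = (\<integral>\<^sup>+ c. f c * emeasure \<nu> (cyl L c) \<partial>count_space (L // iso_rel C))"
    using cyl_measurable[OF \<nu> L] by (intro nn_integral_cong) (simp add: nn_integral_cmult_indicator)
  finally show ?thesis .
qed

lemma level_measurable: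
  assumes \<nu>: "pro_measure C \<nu>" and L: "level C L"
  shows "(\<lambda>X. f (X L)) \<in> borel_measurable \<nu>"
proof -
  have "(\<lambda>X. X L) \<in> measurable \<nu> (count_space (L // iso_rel C))"
    unfolding measurable_count_space_eq_countable[OF countable_level[OF L]]
  proof (intro conjI ballI)
    show "(\<lambda>X. X L) \<in> space \<nu> \<rightarrow> L // iso_rel C"
      using \<nu> pro_class_in[OF _ L] by (auto simp: pro_measure_def)
    fix c assume "c \<in> L // iso_rel C"
    then have "cyl L c \<in> sets \<nu>" using cyl_measurable \<nu> L by blast
    moreover have "(\<lambda>X. X L) -` {c} \<inter> space \<nu> = cyl L c" using \<nu> by (auto simp: cyl_def pro_measure_def)
    ultimately show "(\<lambda>X. X L) -` {c} \<inter> space \<nu> \<in> sets \<nu>" by simp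
  qed
  then show ?thesis by (rule measurable_compose) auto
qed

text \<open>The indicator of the fibre is written as a natural number to be an instance of the
  weights \<open>e\<close> in \<open>mass_sum\<close>.\<close>

lemma emeasure_cyl_split:
  assumes \<nu>: "pro_measure C \<nu>" and L: "level C L" "level C L'" "L \<subseteq> L'"
  shows "emeasure \<nu> (cyl L c) =
    (\<integral>\<^sup>+ d. of_nat (of_bool (level_quot C L (rep d) = c)) * emeasure \<nu> (cyl L' d) \<partial>count_space (L' // iso_rel C))"
proof -
  have "emeasure \<nu> (cyl L c) = (\<integral>\<^sup>+ X. indicator (cyl L c) X \<partial>\<nu>)"
  proof (cases "c \<in> L // iso_rel C")
    case True
    then show ?thesis using cyl_measurable[OF \<nu> L(1)] by simp
  next
    case False
    then have "cyl L c = {}" using pro_class_in[OF _ L(1)] by (auto simp: cyl_def)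
    then show ?thesis by simp
  qed
  also have "\<dots> = (\<integral>\<^sup>+ X. of_nat (of_bool (level_quot C L (rep (X L')) = c)) \<partial>\<nu>)"
    using \<nu> pro_class_trans[OF _ L] by (intro nn_integral_cong) (auto simp: pro_measure_def cyl_def)
  also have "\<dots> = (\<integral>\<^sup>+ d. of_nat (of_bool (level_quot C L (rep d) = c)) * emeasure \<nu> (cyl L' d) \<partial>count_space (L' // iso_rel C))"
    by (rule nn_integral_level[OF \<nu> L(2), of "\<lambda>d. of_nat (of_bool (level_quot C L (rep d) = c))"])
  finally show ?thesis .
qed

lemma moment_eq:
  assumes \<nu>: "pro_measure C \<nu>" and L: "level C L" and G: "G \<in> L"
  shows "moment C \<nu> G = of_nat (card (Aut C G)) *
    (\<integral>\<^sup>+ c. of_nat (quots.cnt c (iso_class C G)) * emeasure \<nu> (cyl L c) \<partial>count_space (L // iso_rel C))"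
proof -
  have "moment C \<nu> G = (\<integral>\<^sup>+ X. of_nat (card (Aut C G)) * of_nat (quots.cnt (X L) (iso_class C G)) \<partial>\<nu>)"
    unfolding moment_def using \<nu> pro_epi_count_eq[OF _ L G] by (intro nn_integral_cong) (auto simp: pro_measure_def)
  also have "\<dots> = of_nat (card (Aut C G)) * (\<integral>\<^sup>+ X. of_nat (quots.cnt (X L) (iso_class C G)) \<partial>\<nu>)"
    by (rule nn_integral_cmult) (rule level_measurable[OF \<nu> L])
  also have "(\<integral>\<^sup>+ X. of_nat (quots.cnt (X L) (iso_class C G)) \<partial>\<nu>) =
      (\<integral>\<^sup>+ c. of_nat (quots.cnt c (iso_class C G)) * emeasure \<nu> (cyl L c) \<partial>count_space (L // iso_rel C))"
    by (rule nn_integral_level[OF \<nu> L, of "\<lambda>c. of_nat (quots.cnt c (iso_class C G))"])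
  finally show ?thesis .
qed

definition cyls :: "('a set \<Rightarrow> 'a set) set set" where
  "cyls = {cyl (nth_level n) c | n c. c \<in> nth_level n // iso_rel C}"

lemma countable_cyls: "countable cyls"
proof -
  have "cyls = (\<Union>n. cyl (nth_level n) ` (nth_level n // iso_rel C))" by (auto simp: cyls_def)
  then show ?thesis using countable_level by auto
qed

lemma cyls_sub: "cyls \<subseteq> pro_nbhds C"
  unfolding cyls_def pro_nbhds_eq using level_nth by blast

lemma nbhd_union_cyls:
  assumes L: "level C L"
  shows "\<exists>\<A>. \<A> \<subseteq> cyls \<and> cyl L c = \<Union>\<A>"
proof -
  obtain n where n: "L \<subseteq> nth_level n" using level_subset_nth_level[OF countable_classes L] by blast
  have "cyl (nth_level n) ` {d \<in> nth_level n // iso_rel C. level_quot C L (rep d) = c} \<subseteq> cyls"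
    by (auto simp: cyls_def)
  then show ?thesis using cyl_split[OF L level_nth n] by blast
qed

text \<open>Every basic open set is a countable union of cylinders from the cofinal
  sequence.\<close>

lemma sigma_sets_cyls: "sigma_sets (pro_classes C) (pro_nbhds C) = sigma_sets (pro_classes C) cyls"
proof (rule antisym)
  show "sigma_sets (pro_classes C) cyls \<subseteq> sigma_sets (pro_classes C) (pro_nbhds C)"
    using cyls_sub by (rule sigma_sets_mono')
  have "U \<in> sigma_sets (pro_classes C) cyls" if "U \<in> pro_nbhds C" for U
  proof -
    from that obtain L c where L: "level C L" "U = cyl L c" unfolding pro_nbhds_eq by blast
    obtain \<A> where A: "\<A> \<subseteq> cyls" "U = \<Union>\<A>" using nbhd_union_cyls[OF L(1), of c] L(2) by auto
    interpret sigma_algebra "pro_classes C" "sigma_sets (pro_classes C) cyls"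
      using cyls_sub pro_nbhds_Pow by (intro sigma_algebra_sigma_sets) blast
    have "countable \<A>" using countable_subset[OF A(1) countable_cyls] .
    moreover have "\<A> \<subseteq> sigma_sets (pro_classes C) cyls" using A(1) by (auto intro: sigma_sets.Basic)
    ultimately show ?thesis unfolding A(2) by (rule countable_Union)
  qed
  then show "sigma_sets (pro_classes C) (pro_nbhds C) \<subseteq> sigma_sets (pro_classes C) cyls"
    by (intro sigma_sets_mono) blast
qed

text \<open>The value at a later level of the sequence determines the values at earlier ones, so the
  cylinders form a tree. Together with the empty set they are therefore closed under
  intersection.\<close>

lemma cyl_nested:
  assumes "n \<le> m"
  shows "cyl (nth_level n) c \<inter> cyl (nth_level m) d = cyl (nth_level m) d \<or> cyl (nth_level n) c \<inter> cyl (nth_level m) d = {}"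
proof -
  have "X (nth_level n) = Y (nth_level n)"
    if "X \<in> pro_classes C" "Y \<in> pro_classes C" "X (nth_level m) = Y (nth_level m)" for X Y
    using pro_class_trans[OF that(1) level_nth level_nth nth_level_mono[OF assms]]
      pro_class_trans[OF that(2) level_nth level_nth nth_level_mono[OF assms]] that(3) by simp
  then have "X \<in> cyl (nth_level n) c"
    if "X \<in> cyl (nth_level m) d" "Y \<in> cyl (nth_level m) d" "Y \<in> cyl (nth_level n) c" for X Y
    using that unfolding cyl_def by (metis (mono_tags, lifting) mem_Collect_eq)
  then show ?thesis by blast
qed

text \<open>The cylinders and the empty set generate the sigma-algebra and are closed under
  intersection, and the cylinders of the initial level are a countable cover by sets of finite
  measure.\<close>

lemma pro_measure_eqI:
  assumes \<mu>: "pro_measure C \<mu>" and \<nu>: "pro_measure C \<nu>"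
    and eq: "\<And>n c. c \<in> nth_level n // iso_rel C \<Longrightarrow> emeasure \<mu> (cyl (nth_level n) c) = emeasure \<nu> (cyl (nth_level n) c)"
    and fin: "\<And>c. c \<in> nth_level 0 // iso_rel C \<Longrightarrow> emeasure \<mu> (cyl (nth_level 0) c) \<noteq> \<infinity>"
  shows "\<mu> = \<nu>"
proof (rule measure_eqI_generator_eq_countable[where \<Omega> = "pro_classes C" and E = "insert {} cyls"
      and A = "cyl (nth_level 0) ` (nth_level 0 // iso_rel C)"])
  have s: "sigma_sets (pro_classes C) (insert {} cyls) = sigma_sets (pro_classes C) cyls"
  proof (rule antisym)
    show "sigma_sets (pro_classes C) (insert {} cyls) \<subseteq> sigma_sets (pro_classes C) cyls"
      by (intro sigma_sets_mono) (auto intro: sigma_sets.Empty sigma_sets.Basic)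
    show "sigma_sets (pro_classes C) cyls \<subseteq> sigma_sets (pro_classes C) (insert {} cyls)"
      by (intro sigma_sets_mono') auto
  qed
  show "sets \<mu> = sigma_sets (pro_classes C) (insert {} cyls)" "sets \<nu> = sigma_sets (pro_classes C) (insert {} cyls)"
    using \<mu> \<nu> s sigma_sets_cyls by (auto simp: pro_measure_def)
  show "insert {} cyls \<subseteq> Pow (pro_classes C)" using cyls_sub pro_nbhds_Pow by blast
  show "emeasure \<mu> X = emeasure \<nu> X" if "X \<in> insert {} cyls" for X
    using that eq by (auto simp: cyls_def)
  show "cyl (nth_level 0) ` (nth_level 0 // iso_rel C) \<subseteq> insert {} cyls" by (auto simp: cyls_def)
  show "\<Union> (cyl (nth_level 0) ` (nth_level 0 // iso_rel C)) = pro_classes C"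
    using pro_class_in[OF _ level_nth] by (auto simp: cyl_def)
  show "countable (cyl (nth_level 0) ` (nth_level 0 // iso_rel C))"
    using countable_level by auto
  show "emeasure \<mu> a \<noteq> \<infinity>" if "a \<in> cyl (nth_level 0) ` (nth_level 0 // iso_rel C)" for a
    using that fin by blast
  show "Int_stable (insert {} cyls)"
    unfolding Int_stable_def
  proof (intro ballI)
    fix a b assume ab: "a \<in> insert {} cyls" "b \<in> insert {} cyls"
    show "a \<inter> b \<in> insert {} cyls"
    proof (cases "a = {} \<or> b = {}")
      case False
      then obtain n c m d where *: "a = cyl (nth_level n) c" "b = cyl (nth_level m) d" using ab by (auto simp: cyls_def)
      have "a \<inter> b = a \<or> a \<inter> b = b \<or> a \<inter> b = {}"
        using cyl_nested[of n m c d] cyl_nested[of m n d c] * by (cases "n \<le> m") (auto simp: Int_commute)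
      then show ?thesis using ab by auto
    qed auto
  qed
qed

text \<open>Each node of the tree of cylinders gets an interval of length its mass. Lebesgue measure
  is pushed forward along the map that sends a point to the pro-isomorphism class read off from its
  branch.\<close>

lemma pro_measure_exists:
  assumes nonneg: "\<And>n c. c \<in> nth_level n // iso_rel C \<Longrightarrow> 0 \<le> v n c"
    and sum: "\<And>n c. c \<in> nth_level n // iso_rel C \<Longrightarrow>
      (v (Suc n) has_sum v n c) {d \<in> nth_level (Suc n) // iso_rel C. level_quot C (nth_level n) (rep d) = c}"
  shows "\<exists>\<nu>. pro_measure C \<nu> \<and> (\<forall>n. \<forall>c \<in> nth_level n // iso_rel C. emeasure \<nu> (cyl (nth_level n) c) = ennreal (v n c))"
proof -
  let ?A = "\<lambda>n. nth_level n // iso_rel C"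
  have AC: "?A n \<subseteq> Obj C // iso_rel C" for n using level_classes[OF level_nth] .
  interpret mass_tree ?A "\<lambda>n d. level_quot C (nth_level n) (rep d)" v "to_nat_on (Obj C // iso_rel C)"
  proof
    show "inj_on (to_nat_on (Obj C // iso_rel C)) (?A n)" for n
      using inj_on_subset[OF inj_on_to_nat_on[OF countable_classes] AC] .
    show "level_quot C (nth_level n) (rep y) \<in> ?A n" if "y \<in> ?A (Suc n)" for y n
      using level_quot_in[OF level_nth] that AC by blast
  qed (use nonneg sum in auto)
  have branch_le: "level_quot C (nth_level n) (rep (branch \<omega> m)) = branch \<omega> n" if "n \<le> m" "\<omega> \<in> points" for n m \<omega>
    using that
  proof (induction m rule: dec_induct)
    case base
    then show ?case using level_quot_self[OF level_nth] branch_in by blast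
  next
    case (step m)
    have "branch \<omega> (Suc m) \<in> Obj C // iso_rel C" using branch_in[OF step.prems] AC by blast
    then have "level_quot C (nth_level n) (rep (level_quot C (nth_level m) (rep (branch \<omega> (Suc m))))) =
        level_quot C (nth_level n) (rep (branch \<omega> (Suc m)))"
      using level_quot_trans[OF level_nth level_nth nth_level_mono[OF step.hyps(1)]] by blast
    then show ?case using branch_Suc[OF step.prems] step by simp
  qed
  \<comment> \<open>Any index whose level contains \<open>L\<close> leads to the same value below;
    the least one is a mere choice.\<close>
  define N where "N L = (LEAST n. L \<subseteq> nth_level n)" for L
  have N: "L \<subseteq> nth_level (N L)" if "level C L" for L
    unfolding N_def using level_subset_nth_level[OF countable_classes that] by (rule LeastI_ex)
  \<comment> \<open>The restricted abstraction is \<open>undefined\<close> off the levels, as the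
    extensional product in \<open>pro_classes\<close> demands.\<close>
  define \<xi> where "\<xi> \<omega> = (\<lambda>L \<in> {L. level C L}. level_quot C L (rep (branch \<omega> (N L))))" for \<omega>
  have bC: "branch \<omega> n \<in> Obj C // iso_rel C" if "\<omega> \<in> points" for \<omega> n
    using branch_in[OF that] AC by blast
  have xi: "\<xi> \<omega> L = level_quot C L (rep (branch \<omega> n))" if "\<omega> \<in> points" "level C L" "L \<subseteq> nth_level n" for \<omega> L n
  proof -
    have "level_quot C L (rep (branch \<omega> n)) = level_quot C L (rep (branch \<omega> m))"
      if "n \<le> m" "L \<subseteq> nth_level n" for n m
      using level_quot_trans[OF \<open>level C L\<close> level_nth that(2) bC[OF \<open>\<omega> \<in> points\<close>, of m]]
        branch_le[OF that(1) \<open>\<omega> \<in> points\<close>] by simp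
    then have "level_quot C L (rep (branch \<omega> n)) = level_quot C L (rep (branch \<omega> (N L)))"
      using N[OF that(2)] that(3) by (metis nat_le_linear)
    then show ?thesis using that(2) by (simp add: \<xi>_def)
  qed
  have xi_pro: "\<xi> \<omega> \<in> pro_classes C" if w: "\<omega> \<in> points" for \<omega>
    unfolding pro_classes_def
  proof (intro CollectI conjI allI impI PiE_I)
    show "\<xi> \<omega> L \<in> L // iso_rel C" if "L \<in> {L. level C L}" for L
      using that level_quot_in bC[OF w] by (simp add: \<xi>_def)
    show "\<xi> \<omega> L = undefined" if "L \<notin> {L. level C L}" for L
      using that by (simp add: \<xi>_def)
    fix L L' assume L: "level C L \<and> level C L' \<and> L \<subseteq> L'"
    have "\<xi> \<omega> L = level_quot C L (rep (branch \<omega> (N L')))"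
      using xi[OF w, of L "N L'"] L N[of L'] by auto
    then show "level_quot C L (rep (\<xi> \<omega> L')) = \<xi> \<omega> L"
      using level_quot_trans[of L L' "branch \<omega> (N L')"] L bC[OF w] by (simp add: \<xi>_def)
  qed
  have xi_nth: "\<xi> \<omega> (nth_level n) = branch \<omega> n" if "\<omega> \<in> points" for \<omega> n
    using xi[OF that level_nth order_refl] branch_le[OF order_refl that] by simp
  \<comment> \<open>Preimages of cylinders are intervals, which yields measurability and the
    prescribed masses together.\<close>
  have pre: "\<xi> -` cyl (nth_level n) c \<inter> points = ivl n c" if "c \<in> ?A n" for n c
  proof (intro Set.set_eqI)
    fix \<omega>
    show "\<omega> \<in> \<xi> -` cyl (nth_level n) c \<inter> points \<longleftrightarrow> \<omega> \<in> ivl n c"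
      using xi_pro[of \<omega>] xi_nth[of \<omega> n] branch_eq_iff[OF _ that, of \<omega>] ivl_points[OF that]
      unfolding cyl_def by (cases "\<omega> \<in> points") auto
  qed
  let ?S = "sigma (pro_classes C) cyls"
  let ?P = "restrict_space lborel points"
  have pow: "cyls \<subseteq> Pow (pro_classes C)" using cyls_sub pro_nbhds_Pow by blast
  have sp: "space ?P = points" by (simp add: space_restrict_space)
  have meas: "\<xi> \<in> measurable ?P ?S"
  proof (rule measurable_measure_of[OF pow])
    show "\<xi> \<in> space ?P \<rightarrow> pro_classes C" using xi_pro sp by auto
    fix U assume "U \<in> cyls"
    then obtain n c where U: "U = cyl (nth_level n) c" "c \<in> ?A n" by (auto simp: cyls_def)
    show "\<xi> -` U \<inter> space ?P \<in> sets ?P"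
      unfolding sp U(1) pre[OF U(2)] using ivl_points[OF U(2)] points_borel
      by (subst sets_restrict_space_iff) (auto simp: ivl_def)
  qed
  define \<nu> where "\<nu> = distr ?P ?S \<xi>"
  have "pro_measure C \<nu>"
    unfolding pro_measure_def \<nu>_def using pow sigma_sets_cyls by (simp add: space_measure_of sets_measure_of)
  moreover have "emeasure \<nu> (cyl (nth_level n) c) = ennreal (v n c)" if c: "c \<in> ?A n" for n c
  proof -
    have "cyl (nth_level n) c \<in> sets ?S" using c pow by (auto simp: cyls_def intro!: sigma_sets.Basic)
    then have "emeasure \<nu> (cyl (nth_level n) c) = emeasure ?P (ivl n c)"
      unfolding \<nu>_def using emeasure_distr[OF meas] sp pre[OF c] by simp
    also have "\<dots> = emeasure lborel (ivl n c)"
      using ivl_points[OF c] points_borel by (intro emeasure_restrict_space) auto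
    finally show ?thesis using emeasure_ivl[OF c] by simp
  qed
  ultimately show ?thesis by blast
qed

end

section \<open>Weak convergence\<close>

context countable_diamond_category
begin

text \<open>Continuity tested on the cylinders of the cofinal sequence: every open set around
  \<open>X\<close> contains a cylinder of \<open>X\<close> at some
  \<open>nth_level n\<close>.\<close>

definition locally_near_constant :: "(('a set \<Rightarrow> 'a set) \<Rightarrow> real) \<Rightarrow> bool" where
  "locally_near_constant f \<longleftrightarrow> (\<forall>X \<in> pro_classes C. \<forall>\<epsilon> > 0. \<exists>n. \<forall>Y \<in> pro_classes C.
     Y (nth_level n) = X (nth_level n) \<longrightarrow> \<bar>f Y - f X\<bar> < \<epsilon>)"

lemma nth_agree_mono:
  assumes "X \<in> pro_classes C" "Y \<in> pro_classes C" "level C L" "L \<subseteq> nth_level m" "X (nth_level m) = Y (nth_level m)"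
  shows "X L = Y L"
  using pro_class_trans[OF assms(1,3) level_nth assms(4)] pro_class_trans[OF assms(2,3) level_nth assms(4)] assms(5)
  by simp

lemma locally_near_constant_add:
  assumes f: "locally_near_constant f" and g: "locally_near_constant g"
  shows "locally_near_constant (\<lambda>X. f X + g X)"
  unfolding locally_near_constant_def
proof (intro ballI allI impI)
  fix X \<epsilon> assume X: "X \<in> pro_classes C" and e: "(0::real) < \<epsilon>"
  have e2: "\<epsilon> / 2 > 0" using e by simp
  obtain n where n: "\<And>Y. \<lbrakk>Y \<in> pro_classes C; Y (nth_level n) = X (nth_level n)\<rbrakk> \<Longrightarrow> \<bar>f Y - f X\<bar> < \<epsilon> / 2"
    using f X e2 unfolding locally_near_constant_def by blast
  obtain m where m: "\<And>Y. \<lbrakk>Y \<in> pro_classes C; Y (nth_level m) = X (nth_level m)\<rbrakk> \<Longrightarrow> \<bar>g Y - g X\<bar> < \<epsilon> / 2"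
    using g X e2 unfolding locally_near_constant_def by blast
  show "\<exists>k. \<forall>Y \<in> pro_classes C. Y (nth_level k) = X (nth_level k) \<longrightarrow> \<bar>f Y + g Y - (f X + g X)\<bar> < \<epsilon>"
  proof (intro exI[of _ "max n m"] ballI impI)
    fix Y assume Y: "Y \<in> pro_classes C" "Y (nth_level (max n m)) = X (nth_level (max n m))"
    have "Y (nth_level n) = X (nth_level n)" "Y (nth_level m) = X (nth_level m)"
      using nth_agree_mono[OF Y(1) X level_nth nth_level_mono Y(2)] by auto
    then have "\<bar>f Y - f X\<bar> < \<epsilon> / 2" "\<bar>g Y - g X\<bar> < \<epsilon> / 2" using n m Y(1) by auto
    then show "\<bar>f Y + g Y - (f X + g X)\<bar> < \<epsilon>" by linarith
  qed
qed

lemma locally_near_constant_uminus: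
  "locally_near_constant f \<Longrightarrow> locally_near_constant (\<lambda>X. - f X)"
  unfolding locally_near_constant_def by (simp add: abs_minus_commute)

text \<open>Induction over the generation of open sets. For an intersection the larger of the two
  indices works, because agreement at a level implies agreement at the earlier ones.\<close>

lemma open_contains_cyl:
  assumes "generate_topology_on (pro_nbhds C) U" "X \<in> U" "X \<in> pro_classes C"
  shows "\<exists>n. \<forall>Y \<in> pro_classes C. Y (nth_level n) = X (nth_level n) \<longrightarrow> Y \<in> U"
  using assms
proof (induction U)
  case Empty
  then show ?case by simp
next
  case (Int a b)
  then obtain n m where n: "\<forall>Y \<in> pro_classes C. Y (nth_level n) = X (nth_level n) \<longrightarrow> Y \<in> a"
    and m: "\<forall>Y \<in> pro_classes C. Y (nth_level m) = X (nth_level m) \<longrightarrow> Y \<in> b" by auto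
  show ?case
  proof (intro exI[of _ "max n m"] ballI impI)
    fix Y assume Y: "Y \<in> pro_classes C" "Y (nth_level (max n m)) = X (nth_level (max n m))"
    have "Y (nth_level n) = X (nth_level n)" "Y (nth_level m) = X (nth_level m)"
      using nth_agree_mono[OF Y(1) Int.prems(2) level_nth nth_level_mono Y(2)] by auto
    then show "Y \<in> a \<inter> b" using n m Y(1) by blast
  qed
next
  case (UN K)
  then obtain k where "k \<in> K" "X \<in> k" by blast
  then show ?case using UN.IH[of k] UN.prems(2) by blast
next
  case (Basis s)
  then obtain L c where L: "level C L" "s = cyl L c" by (auto simp: pro_nbhds_eq)
  obtain n where n: "L \<subseteq> nth_level n" using level_subset_nth_level[OF countable_classes L(1)] by blast
  show ?case
  proof (intro exI[of _ n] ballI impI)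
    fix Y assume Y: "Y \<in> pro_classes C" "Y (nth_level n) = X (nth_level n)"
    then have "Y L = X L" using nth_agree_mono[OF Y(1) Basis.prems(2) L(1) n] by simp
    then show "Y \<in> s" using Basis.prems Y(1) L(2) by (simp add: cyl_def)
  qed
qed

lemma topspace_pro_topology: "topspace (pro_topology C) = pro_classes C"
proof -
  have "X \<in> \<Union>(pro_nbhds C)" if X: "X \<in> pro_classes C" for X
  proof -
    have "X \<in> cyl (nth_level 0) (X (nth_level 0))" using X by (simp add: cyl_def)
    moreover have "cyl (nth_level 0) (X (nth_level 0)) \<in> pro_nbhds C"
      using pro_class_in[OF X level_nth[of 0]] level_nth[of 0] unfolding pro_nbhds_eq by blast
    ultimately show ?thesis by blast
  qed
  then show ?thesis
    unfolding pro_topology_def using pro_nbhds_Pow by (auto simp: topology_generated_by_topspace)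
qed

lemma continuous_imp_locally_near_constant:
  assumes f: "continuous_map (pro_topology C) euclideanreal f"
  shows "locally_near_constant f"
  unfolding locally_near_constant_def
proof (intro ballI allI impI)
  fix X \<epsilon> assume X: "X \<in> pro_classes C" and e: "(0::real) < \<epsilon>"
  let ?U = "{Y \<in> pro_classes C. f Y \<in> ball (f X) \<epsilon>}"
  have "openin (pro_topology C) ?U"
    using openin_continuous_map_preimage[OF f, of "ball (f X) \<epsilon>"] by (simp add: topspace_pro_topology)
  then have "generate_topology_on (pro_nbhds C) ?U"
    unfolding pro_topology_def by (rule openin_topology_generated_by)
  then obtain n where "\<forall>Y \<in> pro_classes C. Y (nth_level n) = X (nth_level n) \<longrightarrow> Y \<in> ?U"
    using open_contains_cyl[of ?U X] X e by auto
  then show "\<exists>n. \<forall>Y \<in> pro_classes C. Y (nth_level n) = X (nth_level n) \<longrightarrow> \<bar>f Y - f X\<bar> < \<epsilon>"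
    by (intro exI[of _ n]) (auto simp: dist_real_def abs_minus_commute)
qed

text \<open>A superlevel set is the union of the cylinders contained in it, and there are only
  countably many cylinders.\<close>

lemma locally_near_constant_measurable:
  assumes f: "locally_near_constant f" and \<nu>: "pro_measure C \<nu>"
  shows "f \<in> borel_measurable \<nu>"
  unfolding borel_measurable_iff_greater
proof
  fix a
  have sp: "space \<nu> = pro_classes C" using \<nu> by (simp add: pro_measure_def)
  let ?A = "{U \<in> cyls. \<forall>Y \<in> U. a < f Y}"
  have "{X \<in> space \<nu>. a < f X} = \<Union>?A"
  proof (intro Set.set_eqI iffI)
    fix X assume "X \<in> {X \<in> space \<nu>. a < f X}"
    then have X: "X \<in> pro_classes C" "0 < f X - a" using sp by auto
    then obtain n where n: "\<forall>Y \<in> pro_classes C. Y (nth_level n) = X (nth_level n) \<longrightarrow> \<bar>f Y - f X\<bar> < f X - a"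
      using f unfolding locally_near_constant_def by blast
    let ?U = "cyl (nth_level n) (X (nth_level n))"
    have "?U \<in> cyls" using pro_class_in[OF X(1) level_nth[of n]] unfolding cyls_def by blast
    moreover have "\<forall>Y \<in> ?U. a < f Y" using n by (fastforce simp: cyl_def)
    moreover have "X \<in> ?U" using X by (simp add: cyl_def)
    ultimately show "X \<in> \<Union>?A" by blast
  next
    fix X assume "X \<in> \<Union>?A"
    then show "X \<in> {X \<in> space \<nu>. a < f X}" using cyls_sub pro_nbhds_Pow sp by blast
  qed
  moreover have "\<Union>?A \<in> sets \<nu>"
  proof (rule sets.countable_Union)
    show "countable ?A" using countable_subset[OF _ countable_cyls] by auto
    have "cyls \<subseteq> sets \<nu>" using \<nu> cyls_sub by (auto simp: pro_measure_def intro: sigma_sets.Basic)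
    then show "?A \<subseteq> sets \<nu>" by blast
  qed
  ultimately show "{X \<in> space \<nu>. a < f X} \<in> sets \<nu>" by simp
qed

end

text \<open>Passage from nonnegative to Bochner integrals. A negative left side leaves only
  nonnegativity to show; otherwise a strict inequality with the lower limit holds
  eventually.\<close>

lemma liminf_integral_real:
  fixes \<nu> :: "nat \<Rightarrow> 'b measure" and k :: "'b \<Rightarrow> real"
  assumes lsc: "(\<integral>\<^sup>+ X. ennreal (k X) \<partial>\<nu>') \<le> liminf (\<lambda>t. \<integral>\<^sup>+ X. ennreal (k X) \<partial>\<nu> t)"
    and int: "integrable \<nu>' k" "\<forall>\<^sub>F t in sequentially. integrable (\<nu> t) k"
    and nonneg: "\<And>X. X \<in> space \<nu>' \<Longrightarrow> 0 \<le> k X" "\<forall>\<^sub>F t in sequentially. \<forall>X \<in> space (\<nu> t). 0 \<le> k X"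
    and e: "0 < \<epsilon>"
  shows "\<forall>\<^sub>F t in sequentially. integral\<^sup>L \<nu>' k - \<epsilon> < integral\<^sup>L (\<nu> t) k"
proof (cases "integral\<^sup>L \<nu>' k - \<epsilon> < 0")
  case True
  show ?thesis
    using nonneg(2)
  proof eventually_elim
    case (elim t)
    have "0 \<le> integral\<^sup>L (\<nu> t) k" using elim by (intro integral_nonneg_AE AE_I2) auto
    then show ?case using True by linarith
  qed
next
  case False
  have "ennreal (integral\<^sup>L \<nu>' k - \<epsilon>) < ennreal (integral\<^sup>L \<nu>' k)"
    using False e by (intro ennreal_lessI) auto
  also have "\<dots> = (\<integral>\<^sup>+ X. ennreal (k X) \<partial>\<nu>')"
    using int(1) nonneg(1) by (intro nn_integral_eq_integral[symmetric] AE_I2) auto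
  also note lsc
  finally have "\<forall>\<^sub>F t in sequentially. ennreal (integral\<^sup>L \<nu>' k - \<epsilon>) < (\<integral>\<^sup>+ X. ennreal (k X) \<partial>\<nu> t)"
    by (rule less_LiminfD)
  then show ?thesis
    using int(2) nonneg(2)
  proof eventually_elim
    case (elim t)
    have "(\<integral>\<^sup>+ X. ennreal (k X) \<partial>\<nu> t) = ennreal (integral\<^sup>L (\<nu> t) k)"
      using elim by (intro nn_integral_eq_integral AE_I2) auto
    then show ?case using elim(1) False by (simp add: ennreal_less_iff)
  qed
qed

text \<open>What weak convergence takes from the moments: convergence on every cylinder to a finite
  mass. The sequence starts at \<open>t = 1\<close>, so \<open>\<nu> 0\<close> is arbitrary and
  facts about \<open>\<nu> t\<close> are stated eventually.\<close>

locale cyl_convergence = countable_diamond_category C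
  for C :: "('a, 'b) cat" +
  fixes \<nu> :: "nat \<Rightarrow> ('a set \<Rightarrow> 'a set) measure" and \<nu>' :: "('a set \<Rightarrow> 'a set) measure"
  assumes pm: "1 \<le> t \<Longrightarrow> pro_measure C (\<nu> t)" and pm': "pro_measure C \<nu>'"
    and cyl_finite: "\<lbrakk>level C L; c \<in> L // iso_rel C\<rbrakk> \<Longrightarrow> emeasure \<nu>' (cyl L c) < \<infinity>"
    and cyl_lim: "\<lbrakk>level C L; c \<in> L // iso_rel C\<rbrakk> \<Longrightarrow>
      (\<lambda>t. emeasure (\<nu> t) (cyl L c)) \<longlonglongrightarrow> emeasure \<nu>' (cyl L c)"
begin

lemma space_pm: "1 \<le> t \<Longrightarrow> space (\<nu> t) = pro_classes C" "space \<nu>' = pro_classes C"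
  using pm pm' by (auto simp: pro_measure_def)

lemma ev_pm: "\<forall>\<^sub>F t in sequentially. pro_measure C (\<nu> t)"
  using pm by (auto simp: eventually_sequentially)

text \<open>Approximate \<open>g\<close> from below by its infima over cylinders and apply Fatou's lemma to the sums
  over the cylinders of each level.\<close>

lemma lower_semicontinuous_integral:
  assumes g: "locally_near_constant g" and nonneg: "\<And>X. X \<in> pro_classes C \<Longrightarrow> 0 \<le> g X"
  shows "(\<integral>\<^sup>+ X. ennreal (g X) \<partial>\<nu>') \<le> liminf (\<lambda>t. \<integral>\<^sup>+ X. ennreal (g X) \<partial>\<nu> t)"
proof -
  define G where "G n c = (INF Y \<in> cyl (nth_level n) c. ennreal (g Y))" for n c
  have G_le: "G n (X (nth_level n)) \<le> ennreal (g X)" if "X \<in> pro_classes C" for n X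
    unfolding G_def using that by (intro INF_lower) (simp add: cyl_def)
  have G_sup: "ennreal (g X) = (SUP n. G n (X (nth_level n)))" if X: "X \<in> pro_classes C" for X
  proof (rule antisym)
    show "(SUP n. G n (X (nth_level n))) \<le> ennreal (g X)" using G_le[OF X] by (intro SUP_least)
    show "ennreal (g X) \<le> (SUP n. G n (X (nth_level n)))"
    proof (rule ennreal_le_epsilon)
      fix \<epsilon> :: real assume e: "0 < \<epsilon>"
      obtain n where n: "\<And>Y. \<lbrakk>Y \<in> pro_classes C; Y (nth_level n) = X (nth_level n)\<rbrakk> \<Longrightarrow> \<bar>g Y - g X\<bar> < \<epsilon>"
        using g X e unfolding locally_near_constant_def by blast
      \<comment> \<open>The maximum with 0 keeps the arguments in the range where
        \<open>ennreal\<close> is additive.\<close>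
      have "ennreal (g X) \<le> ennreal (max 0 (g X - \<epsilon>)) + ennreal \<epsilon>"
      proof -
        have "ennreal (g X) \<le> ennreal (max 0 (g X - \<epsilon>) + \<epsilon>)" by (intro ennreal_leI) linarith
        also have "\<dots> = ennreal (max 0 (g X - \<epsilon>)) + ennreal \<epsilon>" using e by (intro ennreal_plus) auto
        finally show ?thesis .
      qed
      also have "ennreal (max 0 (g X - \<epsilon>)) \<le> G n (X (nth_level n))"
        unfolding G_def
      proof (rule INF_greatest)
        fix Y assume "Y \<in> cyl (nth_level n) (X (nth_level n))"
        then have Y: "Y \<in> pro_classes C" "Y (nth_level n) = X (nth_level n)" by (auto simp: cyl_def)
        show "ennreal (max 0 (g X - \<epsilon>)) \<le> ennreal (g Y)"
          using n[OF Y] nonneg[OF Y(1)] by (intro ennreal_leI) auto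
      qed
      also have "G n (X (nth_level n)) \<le> (SUP n. G n (X (nth_level n)))" by (rule SUP_upper) simp
      finally show "ennreal (g X) \<le> (SUP n. G n (X (nth_level n))) + ennreal \<epsilon>"
        by (simp add: add_right_mono)
    qed
  qed
  have G_mono: "G n (X (nth_level n)) \<le> G (Suc n) (X (nth_level (Suc n)))" if X: "X \<in> pro_classes C" for n X
    unfolding G_def
  proof (rule INF_superset_mono)
    show "cyl (nth_level (Suc n)) (X (nth_level (Suc n))) \<subseteq> cyl (nth_level n) (X (nth_level n))"
      using nth_agree_mono[OF _ X level_nth nth_level_mono[of n "Suc n"]] by (auto simp: cyl_def)
  qed simp
  have "(\<integral>\<^sup>+ X. ennreal (g X) \<partial>\<nu>') = (\<integral>\<^sup>+ X. (SUP n. G n (X (nth_level n))) \<partial>\<nu>')"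
    using G_sup space_pm(2) by (intro nn_integral_cong) auto
  also have "\<dots> = (SUP n. \<integral>\<^sup>+ X. G n (X (nth_level n)) \<partial>\<nu>')"
  proof (rule nn_integral_monotone_convergence_SUP_AE)
    show "AE X in \<nu>'. G n (X (nth_level n)) \<le> G (Suc n) (X (nth_level (Suc n)))" for n
      using G_mono space_pm(2) by (intro AE_I2) auto
    show "(\<lambda>X. G n (X (nth_level n))) \<in> borel_measurable \<nu>'" for n
      using level_measurable[OF pm' level_nth] .
  qed
  also have "\<dots> \<le> liminf (\<lambda>t. \<integral>\<^sup>+ X. ennreal (g X) \<partial>\<nu> t)"
  proof (rule SUP_least)
    fix n
    let ?A = "nth_level n // iso_rel C"
    have lim: "(\<lambda>t. G n c * emeasure (\<nu> t) (cyl (nth_level n) c)) \<longlonglongrightarrow> G n c * emeasure \<nu>' (cyl (nth_level n) c)"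
      if c: "c \<in> ?A" for c
    \<comment> \<open>Over an empty cylinder the infimum is \<infinity>; its product with the mass 0
      is 0 by convention, so the term is constant.\<close>
    proof (cases "cyl (nth_level n) c = {}")
      case False
      then obtain Y where "Y \<in> cyl (nth_level n) c" by blast
      then have "G n c \<le> ennreal (g Y)" unfolding G_def by (rule INF_lower)
      then have "G n c < \<infinity>" by (rule le_less_trans) simp
      then show ?thesis using cyl_lim[OF level_nth c] by (intro ennreal_tendsto_cmult) simp_all
    qed simp
    have "(\<integral>\<^sup>+ X. G n (X (nth_level n)) \<partial>\<nu>') = (\<integral>\<^sup>+ c. G n c * emeasure \<nu>' (cyl (nth_level n) c) \<partial>count_space ?A)"
      by (rule nn_integral_level[OF pm' level_nth])
    also have "\<dots> = (\<integral>\<^sup>+ c. liminf (\<lambda>t. G n c * emeasure (\<nu> t) (cyl (nth_level n) c)) \<partial>count_space ?A)"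
      using lim_imp_Liminf[OF _ lim] by (intro nn_integral_cong) simp
    also have "\<dots> \<le> liminf (\<lambda>t. \<integral>\<^sup>+ c. G n c * emeasure (\<nu> t) (cyl (nth_level n) c) \<partial>count_space ?A)"
      by (rule nn_integral_liminf) auto
    also have "\<dots> \<le> liminf (\<lambda>t. \<integral>\<^sup>+ X. ennreal (g X) \<partial>\<nu> t)"
    proof (rule Liminf_mono)
      show "\<forall>\<^sub>F t in sequentially. (\<integral>\<^sup>+ c. G n c * emeasure (\<nu> t) (cyl (nth_level n) c) \<partial>count_space ?A) \<le>
          (\<integral>\<^sup>+ X. ennreal (g X) \<partial>\<nu> t)"
        using ev_pm
      proof eventually_elim
        case (elim t)
        have "(\<integral>\<^sup>+ c. G n c * emeasure (\<nu> t) (cyl (nth_level n) c) \<partial>count_space ?A) =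
            (\<integral>\<^sup>+ X. G n (X (nth_level n)) \<partial>\<nu> t)"
          by (rule nn_integral_level[OF elim level_nth, symmetric])
        also have "\<dots> \<le> (\<integral>\<^sup>+ X. ennreal (g X) \<partial>\<nu> t)"
          using elim G_le by (intro nn_integral_mono) (auto simp: pro_measure_def)
        finally show ?case .
      qed
    qed
    finally show "(\<integral>\<^sup>+ X. G n (X (nth_level n)) \<partial>\<nu>') \<le> liminf (\<lambda>t. \<integral>\<^sup>+ X. ennreal (g X) \<partial>\<nu> t)" .
  qed
  finally show ?thesis .
qed

text \<open>Lower semicontinuity is applied to the nonnegative functions \<open>h + f\<close> and
  \<open>h - f\<close>. As the integrals of \<open>h\<close> converge, this bounds the integrals of
  \<open>f\<close> from both sides.\<close>

lemma dominated_integrals_converge: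
  assumes f: "locally_near_constant f" and h: "locally_near_constant h"
    and fh: "\<And>X. X \<in> pro_classes C \<Longrightarrow> \<bar>f X\<bar> \<le> h X"
    and h_fin: "(\<integral>\<^sup>+ X. ennreal (h X) \<partial>\<nu>') < \<infinity>"
    and h_lim: "(\<lambda>t. \<integral>\<^sup>+ X. ennreal (h X) \<partial>\<nu> t) \<longlonglongrightarrow> (\<integral>\<^sup>+ X. ennreal (h X) \<partial>\<nu>')"
  shows "integrals_converge \<nu> \<nu>' f"
proof -
  have h0: "0 \<le> h X" if "X \<in> pro_classes C" for X using fh[OF that] by linarith
  have int: "integrable \<mu> h \<and> integrable \<mu> f"
    if \<mu>: "pro_measure C \<mu>" "(\<integral>\<^sup>+ X. ennreal (h X) \<partial>\<mu>) < \<infinity>" for \<mu>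
  proof
    have sp: "space \<mu> = pro_classes C" using \<mu> by (simp add: pro_measure_def)
    show ih: "integrable \<mu> h"
      using \<mu> h0 sp by (intro integrableI_nonneg locally_near_constant_measurable[OF h] AE_I2) auto
    show "integrable \<mu> f"
    proof (rule Bochner_Integration.integrable_bound[OF ih])
      show "f \<in> borel_measurable \<mu>" using locally_near_constant_measurable[OF f \<mu>(1)] .
      show "AE X in \<mu>. norm (f X) \<le> norm (h X)"
      proof (rule AE_I2)
        fix X assume "X \<in> space \<mu>"
        then show "norm (f X) \<le> norm (h X)" using fh[of X] h0[of X] sp by simp
      qed
    qed
  qed
  have int': "integrable \<nu>' h" "integrable \<nu>' f" using int[OF pm' h_fin] by auto
  have "\<forall>\<^sub>F t in sequentially. (\<integral>\<^sup>+ X. ennreal (h X) \<partial>\<nu> t) < \<infinity>"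
    using order_tendstoD(2)[OF h_lim h_fin] .
  then have ev: "\<forall>\<^sub>F t in sequentially. integrable (\<nu> t) h \<and> integrable (\<nu> t) f"
    using ev_pm by eventually_elim (rule int)
  have ih: "integral\<^sup>L \<mu> h = enn2real (\<integral>\<^sup>+ X. ennreal (h X) \<partial>\<mu>)" if "pro_measure C \<mu>" for \<mu>
    using that h0 locally_near_constant_measurable[OF h that]
    by (intro integral_eq_nn_integral AE_I2) (auto simp: pro_measure_def)
  have "(\<lambda>t. enn2real (\<integral>\<^sup>+ X. ennreal (h X) \<partial>\<nu> t)) \<longlonglongrightarrow> enn2real (\<integral>\<^sup>+ X. ennreal (h X) \<partial>\<nu>')"
    using h_lim h_fin by (intro tendsto_enn2real[of _ "enn2real (\<integral>\<^sup>+ X. ennreal (h X) \<partial>\<nu>')"]) (auto simp: less_top[symmetric])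
  then have H: "(\<lambda>t. integral\<^sup>L (\<nu> t) h) \<longlonglongrightarrow> integral\<^sup>L \<nu>' h"
    unfolding ih[OF pm'] by (rule Lim_transform_eventually) (use ev_pm in eventually_elim, simp add: ih)
  have lower: "\<forall>\<^sub>F t in sequentially. integral\<^sup>L \<nu>' (\<lambda>X. h X + k X) - \<epsilon> < integral\<^sup>L (\<nu> t) (\<lambda>X. h X + k X)"
    if k: "locally_near_constant k" "\<And>X. X \<in> pro_classes C \<Longrightarrow> \<bar>k X\<bar> \<le> h X"
      "integrable \<nu>' k" "\<forall>\<^sub>F t in sequentially. integrable (\<nu> t) h \<and> integrable (\<nu> t) k" and e: "0 < \<epsilon>" for k \<epsilon>
  proof (rule liminf_integral_real[OF _ _ _ _ _ e])
    have nn: "0 \<le> h X + k X" if "X \<in> pro_classes C" for X using k(2)[OF that] by linarith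
    show "(\<integral>\<^sup>+ X. ennreal (h X + k X) \<partial>\<nu>') \<le> liminf (\<lambda>t. \<integral>\<^sup>+ X. ennreal (h X + k X) \<partial>\<nu> t)"
      using lower_semicontinuous_integral[OF locally_near_constant_add[OF h k(1)] nn] .
    show "integrable \<nu>' (\<lambda>X. h X + k X)" using int'(1) k(3) by (rule Bochner_Integration.integrable_add)
    show "\<forall>\<^sub>F t in sequentially. integrable (\<nu> t) (\<lambda>X. h X + k X)"
      using k(4) by eventually_elim auto
    show "0 \<le> h X + k X" if "X \<in> space \<nu>'" for X using nn that space_pm(2) by simp
    show "\<forall>\<^sub>F t in sequentially. \<forall>X \<in> space (\<nu> t). 0 \<le> h X + k X"
      using ev_pm by eventually_elim (auto simp: pro_measure_def nn)
  qed
  have "(\<lambda>t. integral\<^sup>L (\<nu> t) f) \<longlonglongrightarrow> integral\<^sup>L \<nu>' f"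
  proof (rule tendstoI)
    fix \<epsilon> :: real assume e: "0 < \<epsilon>"
    then have e2: "0 < \<epsilon> / 2" by simp
    have 1: "\<forall>\<^sub>F t in sequentially. integral\<^sup>L \<nu>' (\<lambda>X. h X + f X) - \<epsilon> / 2 < integral\<^sup>L (\<nu> t) (\<lambda>X. h X + f X)"
      by (rule lower[OF f fh int'(2) ev e2])
    have 2: "\<forall>\<^sub>F t in sequentially. integral\<^sup>L \<nu>' (\<lambda>X. h X + - f X) - \<epsilon> / 2 < integral\<^sup>L (\<nu> t) (\<lambda>X. h X + - f X)"
    proof (rule lower[OF locally_near_constant_uminus[OF f] _ _ _ e2])
      show "integrable \<nu>' (\<lambda>X. - f X)" using int'(2) by simp
      show "\<forall>\<^sub>F t in sequentially. integrable (\<nu> t) h \<and> integrable (\<nu> t) (\<lambda>X. - f X)"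
        using ev by eventually_elim simp
    qed (use fh in simp)
    have 3: "\<forall>\<^sub>F t in sequentially. dist (integral\<^sup>L (\<nu> t) h) (integral\<^sup>L \<nu>' h) < \<epsilon> / 2"
      using tendstoD[OF H e2] .
    show "\<forall>\<^sub>F t in sequentially. dist (integral\<^sup>L (\<nu> t) f) (integral\<^sup>L \<nu>' f) < \<epsilon>"
      using 1 2 3 ev
    proof eventually_elim
      case (elim t)
      then have "integral\<^sup>L \<nu>' h + integral\<^sup>L \<nu>' f - \<epsilon> / 2 < integral\<^sup>L (\<nu> t) h + integral\<^sup>L (\<nu> t) f"
        "integral\<^sup>L \<nu>' h - integral\<^sup>L \<nu>' f - \<epsilon> / 2 < integral\<^sup>L (\<nu> t) h - integral\<^sup>L (\<nu> t) f"
        using int' by auto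
      moreover have "\<bar>integral\<^sup>L (\<nu> t) h - integral\<^sup>L \<nu>' h\<bar> < \<epsilon> / 2" using elim by (simp add: dist_real_def)
      ultimately have "\<bar>integral\<^sup>L (\<nu> t) f - integral\<^sup>L \<nu>' f\<bar> < \<epsilon>" by linarith
      then show ?case by (simp add: dist_real_def)
    qed
  qed
  then show ?thesis
    unfolding integrals_converge_def using int'(2) ev by (auto elim: eventually_mono)
qed

text \<open>A bounded \<open>f\<close> is dominated by a function with convergent integrals: a
  multiple of the sum of the indicators of the basic open sets off which \<open>f\<close> vanishes,
  or the constant bound when the total masses converge.\<close>

lemma weakly_converges: "weakly_converges C \<nu> \<nu>'"
  unfolding weakly_converges_def
proof (intro allI impI)
  fix f
  assume "continuous_map (pro_topology C) euclideanreal f \<and> bounded (f ` pro_classes C) \<and>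
    ((\<exists>A. finite A \<and> A \<subseteq> pro_nbhds C \<and> (\<forall>X \<in> pro_classes C - \<Union>A. f X = 0)) \<or>
     (emeasure \<nu>' (pro_classes C) < \<infinity> \<and> (\<lambda>t. emeasure (\<nu> t) (pro_classes C)) \<longlonglongrightarrow> emeasure \<nu>' (pro_classes C)))"
  then have cont: "continuous_map (pro_topology C) euclideanreal f" and boundary: "bounded (f ` pro_classes C)"
    and cases: "(\<exists>A. finite A \<and> A \<subseteq> pro_nbhds C \<and> (\<forall>X \<in> pro_classes C - \<Union>A. f X = 0)) \<or>
     (emeasure \<nu>' (pro_classes C) < \<infinity> \<and> (\<lambda>t. emeasure (\<nu> t) (pro_classes C)) \<longlonglongrightarrow> emeasure \<nu>' (pro_classes C))"
    by auto
  note f = continuous_imp_locally_near_constant[OF cont]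
  obtain K where K: "0 < K" "\<And>X. X \<in> pro_classes C \<Longrightarrow> \<bar>f X\<bar> \<le> K"
    using boundary unfolding bounded_pos by auto
  from cases show "integrals_converge \<nu> \<nu>' f"
  proof
    assume "\<exists>A. finite A \<and> A \<subseteq> pro_nbhds C \<and> (\<forall>X \<in> pro_classes C - \<Union>A. f X = 0)"
    then obtain A where A: "finite A" "A \<subseteq> pro_nbhds C" "\<And>X. X \<in> pro_classes C - \<Union>A \<Longrightarrow> f X = 0" by blast
    define h where "h X = K * (\<Sum>U \<in> A. indicator U X)" for X
    have int_h: "(\<integral>\<^sup>+ X. ennreal (h X) \<partial>\<mu>) = ennreal K * (\<Sum>U \<in> A. emeasure \<mu> U)" if \<mu>: "pro_measure C \<mu>" for \<mu>
    proof -
      have "U \<in> sets \<mu>" if "U \<in> A" for U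
        using that A(2) cyl_measurable[OF \<mu>] unfolding pro_nbhds_eq by blast
      moreover have "ennreal (h X) = ennreal K * (\<Sum>U \<in> A. indicator U X)" for X
        using K(1) by (simp add: h_def ennreal_mult sum_nonneg sum_ennreal[symmetric] ennreal_indicator)
      ultimately show ?thesis
        by (simp add: nn_integral_cmult nn_integral_sum)
    qed
    have lims: "(\<lambda>t. emeasure (\<nu> t) U) \<longlonglongrightarrow> emeasure \<nu>' U" "emeasure \<nu>' U < \<infinity>" if "U \<in> A" for U
      using that A(2) cyl_lim cyl_finite unfolding pro_nbhds_eq by blast+
    show ?thesis
    proof (rule dominated_integrals_converge[OF f, of h])
      show "locally_near_constant h"
        unfolding locally_near_constant_def
      proof (intro ballI allI impI)
        fix X \<epsilon> assume X: "X \<in> pro_classes C" and e: "(0::real) < \<epsilon>"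
        have "\<forall>U \<in> A. \<exists>n. \<forall>Y \<in> pro_classes C. Y (nth_level n) = X (nth_level n) \<longrightarrow> (Y \<in> U \<longleftrightarrow> X \<in> U)"
        proof
          fix U assume "U \<in> A"
          then obtain L c where L: "level C L" "U = cyl L c" using A(2) unfolding pro_nbhds_eq by blast
          obtain n where n: "L \<subseteq> nth_level n" using level_subset_nth_level[OF countable_classes L(1)] by blast
          have "Y \<in> U \<longleftrightarrow> X \<in> U" if "Y \<in> pro_classes C" "Y (nth_level n) = X (nth_level n)" for Y
            using nth_agree_mono[OF that(1) X L(1) n that(2)] that(1) X L(2) by (simp add: cyl_def)
          then show "\<exists>n. \<forall>Y \<in> pro_classes C. Y (nth_level n) = X (nth_level n) \<longrightarrow> (Y \<in> U \<longleftrightarrow> X \<in> U)" by blast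
        qed
        then obtain N where N: "\<forall>U \<in> A. \<forall>Y \<in> pro_classes C. Y (nth_level (N U)) = X (nth_level (N U)) \<longrightarrow> (Y \<in> U \<longleftrightarrow> X \<in> U)"
          unfolding bchoice_iff by (elim exE)
        show "\<exists>n. \<forall>Y \<in> pro_classes C. Y (nth_level n) = X (nth_level n) \<longrightarrow> \<bar>h Y - h X\<bar> < \<epsilon>"
        \<comment> \<open>Membership in each of the finitely many sets is decided at some level of
          the sequence, and from the largest of these on \<open>h\<close> does not change. The
          inserted 0 covers empty \<open>A\<close>.\<close>
        proof (intro exI[of _ "Max (insert 0 (N ` A))"] ballI impI)
          fix Y assume Y: "Y \<in> pro_classes C"
            "Y (nth_level (Max (insert 0 (N ` A)))) = X (nth_level (Max (insert 0 (N ` A))))"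
          have "indicator U Y = (indicator U X :: real)" if U: "U \<in> A" for U
          proof -
            have "N U \<le> Max (insert 0 (N ` A))" using A(1) U by (intro Max_ge) auto
            then have "Y (nth_level (N U)) = X (nth_level (N U))"
              using nth_agree_mono[OF Y(1) X level_nth nth_level_mono Y(2)] by blast
            then show ?thesis using N U Y(1) by (simp add: indicator_def)
          qed
          then have "h Y = h X" by (simp add: h_def)
          then show "\<bar>h Y - h X\<bar> < \<epsilon>" using e by simp
        qed
      qed
      show "\<bar>f X\<bar> \<le> h X" if X: "X \<in> pro_classes C" for X
      proof (cases "X \<in> \<Union>A")
        case True
        then obtain U where U: "U \<in> A" "X \<in> U" by blast
        have "(\<Sum>U \<in> {U}. indicator U X :: real) \<le> (\<Sum>U \<in> A. indicator U X)"
          using U A(1) by (intro sum_mono2) auto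
        then have "K * 1 \<le> h X" unfolding h_def using U K(1) by (intro mult_left_mono) auto
        then show ?thesis using K(2)[OF X] by simp
      next
        case False
        then show ?thesis using A(3)[of X] X K(1) by (simp add: h_def sum_nonneg)
      qed
      show "(\<integral>\<^sup>+ X. ennreal (h X) \<partial>\<nu>') < \<infinity>"
        unfolding int_h[OF pm'] using lims(2) A(1) by (simp add: ennreal_mult_less_top)
      have "(\<lambda>t. ennreal K * (\<Sum>U \<in> A. emeasure (\<nu> t) U)) \<longlonglongrightarrow> ennreal K * (\<Sum>U \<in> A. emeasure \<nu>' U)"
        using lims(1) by (intro ennreal_tendsto_cmult tendsto_sum) auto
      then show "(\<lambda>t. \<integral>\<^sup>+ X. ennreal (h X) \<partial>\<nu> t) \<longlonglongrightarrow> (\<integral>\<^sup>+ X. ennreal (h X) \<partial>\<nu>')"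
        unfolding int_h[OF pm'] by (rule Lim_transform_eventually) (use ev_pm in eventually_elim, simp add: int_h)
    qed
  next
    assume mass: "emeasure \<nu>' (pro_classes C) < \<infinity> \<and>
      (\<lambda>t. emeasure (\<nu> t) (pro_classes C)) \<longlonglongrightarrow> emeasure \<nu>' (pro_classes C)"
    have int_h: "(\<integral>\<^sup>+ X. ennreal K \<partial>\<mu>) = ennreal K * emeasure \<mu> (pro_classes C)" if "pro_measure C \<mu>" for \<mu>
      using that by (simp add: pro_measure_def)
    show ?thesis
    proof (rule dominated_integrals_converge[OF f, of "\<lambda>_. K"])
      show "locally_near_constant (\<lambda>_. K)" by (simp add: locally_near_constant_def)
      show "(\<integral>\<^sup>+ X. ennreal K \<partial>\<nu>') < \<infinity>"
        unfolding int_h[OF pm'] using mass by (simp add: ennreal_mult_less_top)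
      have "(\<lambda>t. ennreal K * emeasure (\<nu> t) (pro_classes C)) \<longlonglongrightarrow> ennreal K * emeasure \<nu>' (pro_classes C)"
        using mass by (intro ennreal_tendsto_cmult) auto
      then show "(\<lambda>t. \<integral>\<^sup>+ X. ennreal K \<partial>\<nu> t) \<longlonglongrightarrow> (\<integral>\<^sup>+ X. ennreal K \<partial>\<nu>')"
        unfolding int_h[OF pm'] by (rule Lim_transform_eventually) (use ev_pm in eventually_elim, simp add: pro_measure_def)
    qed (use K in auto)
  qed
qed

end

section \<open>Convergent moments\<close>

text \<open>Convergence is stated in the extended reals, where a negative value of \<open>M\<close>
  would not be truncated to 0; nonnegativity of \<open>M\<close> is then a consequence.\<close>

locale convergent_moments = countable_diamond_category C
  for C :: "('a, 'b) cat" +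
  fixes M :: "'a set \<Rightarrow> real" and \<nu> :: "nat \<Rightarrow> ('a set \<Rightarrow> 'a set) measure"
  assumes wb: "well_behaved C M"
    and pm: "1 \<le> t \<Longrightarrow> pro_measure C (\<nu> t)"
    and moment_lim_ereal: "G \<in> Obj C \<Longrightarrow>
      (\<lambda>t. enn2ereal (moment C (\<nu> t) G)) \<longlonglongrightarrow> ereal (M (iso_class C G))"
begin

definition norm_moment :: "'a set \<Rightarrow> real" where "norm_moment c = M c / real (card (Aut C (rep c)))"

text \<open>The sum predicted for the mass of a cylinder, with the division by |Aut(G)| absorbed
  into \<open>norm_moment\<close>.\<close>

definition limit_mass :: "'a set \<Rightarrow> 'a set \<Rightarrow> real" where
  "limit_mass L c = (\<Sum>\<^sub>\<infinity>h \<in> L // iso_rel C. quots.mobius_sum c h * norm_moment h)"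

lemma ev_pm: "\<forall>\<^sub>F t in sequentially. pro_measure C (\<nu> t)"
  using pm by (auto simp: eventually_sequentially)

lemma moment_lim: "G \<in> Obj C \<Longrightarrow> (\<lambda>t. moment C (\<nu> t) G) \<longlonglongrightarrow> ennreal (M (iso_class C G))"
  using tendsto_e2ennrealI[OF moment_lim_ereal] by (simp add: e2ennreal_enn2ereal)

lemma M_nonneg:
  assumes "c \<in> Obj C // iso_rel C"
  shows "0 \<le> M c"
proof -
  have "ereal 0 \<le> ereal (M (iso_class C (rep c)))"
    by (rule tendsto_lowerbound[OF moment_lim_ereal[OF rep_Obj[OF assms]]])
      (auto simp: zero_ereal_def[symmetric])
  then show ?thesis using iso_class_rep[OF assms] by simp
qed

lemma norm_moment_nonneg: "c \<in> Obj C // iso_rel C \<Longrightarrow> 0 \<le> norm_moment c"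
  using M_nonneg by (simp add: norm_moment_def)

text \<open>Division by the order of the automorphism group turns the number of epimorphisms onto
  \<open>rep g\<close> into the number of quotients of type \<open>g\<close>.\<close>

lemma normalized_moments:
  assumes L: "level C L" and g: "g \<in> L // iso_rel C"
  shows "(\<lambda>t. \<integral>\<^sup>+ c. of_nat (quots.cnt c g) * emeasure (\<nu> t) (cyl L c) \<partial>count_space (L // iso_rel C)) \<longlonglongrightarrow> ennreal (norm_moment g)"
proof -
  have gC: "g \<in> Obj C // iso_rel C" using level_classes[OF L] g by blast
  let ?G = "rep g" and ?k = "card (Aut C (rep g))"
  have k: "0 < ?k" using Aut_card_pos[OF rep_Obj[OF gC]] .
  have "(\<lambda>t. ennreal (1 / real ?k) * moment C (\<nu> t) ?G) \<longlonglongrightarrow> ennreal (1 / real ?k) * ennreal (M g)"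
    using moment_lim[OF rep_Obj[OF gC]] iso_class_rep[OF gC] by (intro ennreal_tendsto_cmult) auto
  moreover have "ennreal (1 / real ?k) * ennreal (M g) = ennreal (norm_moment g)"
    using M_nonneg[OF gC] by (simp add: norm_moment_def ennreal_mult'[symmetric])
  moreover have "\<forall>\<^sub>F t in sequentially. ennreal (1 / real ?k) * moment C (\<nu> t) ?G =
      (\<integral>\<^sup>+ c. of_nat (quots.cnt c g) * emeasure (\<nu> t) (cyl L c) \<partial>count_space (L // iso_rel C))"
    using ev_pm
  proof eventually_elim
    case (elim t)
    have "ennreal (1 / real ?k) * of_nat ?k = 1"
      using k by (simp add: ennreal_of_nat_eq_real_of_nat ennreal_mult'[symmetric])
    then show ?case
      using moment_eq[OF elim L level_rep[OF L g]] iso_class_rep[OF gC]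
      by (simp add: mult.assoc[symmetric])
  qed
  ultimately show ?thesis using Lim_transform_eventually by simp
qed

lemma level_moment_limit:
  assumes L: "level C L"
  shows "\<exists>n. moment_limit (Obj C // iso_rel C) (\<lambda>c. quot_poset C (rep c)) (\<lambda>c. qclass C (Ident C (rep c)))
    (\<lambda>q. Cod C ` q) (L // iso_rel C) norm_moment (\<lambda>t c. emeasure (\<nu> t) (cyl L c)) n"
proof -
  obtain n where n: "L \<subseteq> depth_objects n" using level_depth[OF L] by blast
  have "moment_limit (Obj C // iso_rel C) (\<lambda>c. quot_poset C (rep c)) (\<lambda>c. qclass C (Ident C (rep c)))
    (\<lambda>q. Cod C ` q) (L // iso_rel C) norm_moment (\<lambda>t c. emeasure (\<nu> t) (cyl L c)) n"
  proof (rule moment_limit.intro[OF quots.typed_lattices_axioms], rule moment_limit_axioms.intro)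
    show "L // iso_rel C \<subseteq> Obj C // iso_rel C" by (rule level_classes[OF L])
    show "Cod C ` q \<in> L // iso_rel C" if "c \<in> L // iso_rel C" "q \<in> carrier (quot_poset C (rep c))" for c q
      using level_type_down[OF L that] .
    show "finite {h \<in> L // iso_rel C. \<exists>q \<in> carrier (quot_poset C (rep h)). Cod C ` q = g \<and>
        covers (quot_poset C (rep h)) q (qclass C (Ident C (rep h)))}" if "g \<in> L // iso_rel C" for g
      using level_simple_finite[OF L that] .
    show "depth_le (quot_poset C (rep c)) n q (qclass C (Ident C (rep c)))"
      if "c \<in> L // iso_rel C" "q \<in> carrier (quot_poset C (rep c))" for c q
      using level_rep[OF L that(1)] n that(2) by (auto simp: depth_objects_def)
    show "0 \<le> norm_moment g" if "g \<in> L // iso_rel C" for g using norm_moment_nonneg that level_classes[OF L] by blast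
    show "(\<lambda>h. quots.mobius_abs_sum f h * norm_moment h) summable_on L // iso_rel C" if f: "f \<in> L // iso_rel C" for f
    proof -
      have fC: "f \<in> Obj C // iso_rel C" using level_classes[OF L] f by blast
      have "(\<lambda>c. quots.mobius_abs_sum (iso_class C (rep f)) c * (\<bar>M c\<bar> / real (card (Aut C (rep c))))) summable_on (L // iso_rel C)"
        by (rule mobius_abs_sum_summable[OF wb L level_classes[OF L] level_rep[OF L f] rep_Obj[OF fC]])
      then show ?thesis
        using M_nonneg level_classes[OF L] iso_class_rep[OF fC]
        by (subst (asm) summable_on_cong[of _ _ "\<lambda>h. quots.mobius_abs_sum f h * norm_moment h"]) (auto simp: norm_moment_def subset_iff)
    qed
    show "(\<lambda>t. \<integral>\<^sup>+ c. of_nat (quots.cnt c g) * emeasure (\<nu> t) (cyl L c) \<partial>count_space (L // iso_rel C)) \<longlonglongrightarrow> ennreal (norm_moment g)"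
      if "g \<in> L // iso_rel C" for g
      using normalized_moments[OF L that] .
  qed
  then show ?thesis ..
qed

lemma cyl_limit:
  assumes L: "level C L" and c: "c \<in> L // iso_rel C"
  shows "0 \<le> limit_mass L c" "(\<lambda>t. emeasure (\<nu> t) (cyl L c)) \<longlonglongrightarrow> ennreal (limit_mass L c)"
    "(\<lambda>h. quots.mobius_sum c h * norm_moment h) summable_on (L // iso_rel C)"
proof -
  obtain n where "moment_limit (Obj C // iso_rel C) (\<lambda>c. quot_poset C (rep c)) (\<lambda>c. qclass C (Ident C (rep c)))
    (\<lambda>q. Cod C ` q) (L // iso_rel C) norm_moment (\<lambda>t c. emeasure (\<nu> t) (cyl L c)) n"
    using level_moment_limit[OF L] by blast
  then interpret moment_limit "Obj C // iso_rel C" "\<lambda>c. quot_poset C (rep c)" "\<lambda>c. qclass C (Ident C (rep c))"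
    "\<lambda>q. Cod C ` q" "L // iso_rel C" norm_moment "\<lambda>t c. emeasure (\<nu> t) (cyl L c)" n .
  show "0 \<le> limit_mass L c" "(\<lambda>t. emeasure (\<nu> t) (cyl L c)) \<longlonglongrightarrow> ennreal (limit_mass L c)"
    using mass_limit[OF c] by (auto simp: limit_mass_def)
  show "(\<lambda>h. quots.mobius_sum c h * norm_moment h) summable_on (L // iso_rel C)"
    by (rule Infinite_Sum.abs_summable_summable) (use mobius_summable[OF c] in \<open>simp only: real_norm_def\<close>)
qed

text \<open>It is used with two kinds of weights: the counts, for the moments of the limit, and the
  indicators of fibres of \<open>level_quot\<close>, for compatibility between levels.\<close>

lemma limit_mass_sum:
  assumes L: "level C L" and g: "g \<in> L // iso_rel C" and e: "\<And>c. c \<in> L // iso_rel C \<Longrightarrow> e c \<le> quots.cnt c g"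
    and lim: "(\<lambda>t. \<integral>\<^sup>+ c. of_nat (e c) * emeasure (\<nu> t) (cyl L c) \<partial>count_space (L // iso_rel C)) \<longlonglongrightarrow> s"
  shows "(\<integral>\<^sup>+ c. of_nat (e c) * ennreal (limit_mass L c) \<partial>count_space (L // iso_rel C)) = s"
proof -
  obtain n where "moment_limit (Obj C // iso_rel C) (\<lambda>c. quot_poset C (rep c)) (\<lambda>c. qclass C (Ident C (rep c)))
    (\<lambda>q. Cod C ` q) (L // iso_rel C) norm_moment (\<lambda>t c. emeasure (\<nu> t) (cyl L c)) n"
    using level_moment_limit[OF L] by blast
  then interpret moment_limit "Obj C // iso_rel C" "\<lambda>c. quot_poset C (rep c)" "\<lambda>c. qclass C (Ident C (rep c))"
    "\<lambda>q. Cod C ` q" "L // iso_rel C" norm_moment "\<lambda>t c. emeasure (\<nu> t) (cyl L c)" n .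
  show ?thesis using mass_sum[OF g e lim] by (simp add: limit_mass_def)
qed

text \<open>For a measure this identity is additivity. It passes to the limit because the indicator
  of the fibre is at most the number of quotients of type \<open>c\<close>, for which tightness
  holds.\<close>

lemma limit_mass_split:
  assumes L: "level C L" "level C L'" "L \<subseteq> L'" and c: "c \<in> L // iso_rel C"
  shows "(\<integral>\<^sup>+ d. of_nat (of_bool (level_quot C L (rep d) = c)) * ennreal (limit_mass L' d) \<partial>count_space (L' // iso_rel C)) =
    ennreal (limit_mass L c)"
proof (rule limit_mass_sum[OF L(2)])
  show "c \<in> L' // iso_rel C" using c L(3) by (auto simp: quotient_def)
  show "of_bool (level_quot C L (rep d) = c) \<le> quots.cnt d c" if "d \<in> L' // iso_rel C" for d
    using cnt_level_quot_pos[OF L(1), of d] level_classes[OF L(2)] that by (auto simp: of_bool_def)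
  show "(\<lambda>t. \<integral>\<^sup>+ d. of_nat (of_bool (level_quot C L (rep d) = c)) * emeasure (\<nu> t) (cyl L' d) \<partial>count_space (L' // iso_rel C))
      \<longlonglongrightarrow> ennreal (limit_mass L c)"
    using cyl_limit(2)[OF L(1) c]
    by (rule Lim_transform_eventually) (use ev_pm in eventually_elim, rule emeasure_cyl_split[OF _ L])
qed

text \<open>The measure is built along the cofinal sequence; its masses at an arbitrary level follow
  by splitting cylinders at a larger level of the sequence.\<close>

lemma limit_measure_exists:
  "\<exists>\<nu>'. pro_measure C \<nu>' \<and> (\<forall>L c. level C L \<and> c \<in> L // iso_rel C \<longrightarrow> emeasure \<nu>' (cyl L c) = ennreal (limit_mass L c))"
proof -
  have "\<exists>\<nu>'. pro_measure C \<nu>' \<and> (\<forall>n. \<forall>c \<in> nth_level n // iso_rel C.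
      emeasure \<nu>' (cyl (nth_level n) c) = ennreal (limit_mass (nth_level n) c))"
  proof (rule pro_measure_exists)
    fix n c assume c: "c \<in> nth_level n // iso_rel C"
    show "0 \<le> limit_mass (nth_level n) c" using cyl_limit(1)[OF level_nth c] .
    let ?A = "nth_level (Suc n) // iso_rel C"
    let ?B = "{d \<in> ?A. level_quot C (nth_level n) (rep d) = c}"
    show "(limit_mass (nth_level (Suc n)) has_sum limit_mass (nth_level n) c) ?B"
    proof (rule has_sum_of_nn_integral)
      show "0 \<le> limit_mass (nth_level (Suc n)) d" if "d \<in> ?B" for d using cyl_limit(1)[OF level_nth] that by blast
      show "0 \<le> limit_mass (nth_level n) c" by fact
      have "(\<integral>\<^sup>+ d. ennreal (limit_mass (nth_level (Suc n)) d) \<partial>count_space ?B) =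
          (\<integral>\<^sup>+ d. of_nat (of_bool (level_quot C (nth_level n) (rep d) = c)) * ennreal (limit_mass (nth_level (Suc n)) d) \<partial>count_space ?A)"
        by (subst (1 2) nn_integral_count_space_indicator)
          (auto intro!: nn_integral_cong simp: indicator_def)
      then show "(\<integral>\<^sup>+ d. ennreal (limit_mass (nth_level (Suc n)) d) \<partial>count_space ?B) = ennreal (limit_mass (nth_level n) c)"
        using limit_mass_split[OF level_nth level_nth nth_level_mono c, of "Suc n"] by simp
    qed
  qed
  then obtain \<nu>' where nu: "pro_measure C \<nu>'"
    and nu_nth: "\<And>n c. c \<in> nth_level n // iso_rel C \<Longrightarrow> emeasure \<nu>' (cyl (nth_level n) c) = ennreal (limit_mass (nth_level n) c)"
    by blast
  have "emeasure \<nu>' (cyl L c) = ennreal (limit_mass L c)" if L: "level C L" and c: "c \<in> L // iso_rel C" for L c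
  proof -
    obtain n where n: "L \<subseteq> nth_level n" using level_subset_nth_level[OF countable_classes L] by blast
    have "emeasure \<nu>' (cyl L c) = (\<integral>\<^sup>+ d. of_nat (of_bool (level_quot C L (rep d) = c)) *
        ennreal (limit_mass (nth_level n) d) \<partial>count_space (nth_level n // iso_rel C))"
      unfolding emeasure_cyl_split[OF nu L level_nth n] by (intro nn_integral_cong) (simp add: nu_nth)
    also have "\<dots> = ennreal (limit_mass L c)" by (rule limit_mass_split[OF L level_nth n c])
    finally show ?thesis .
  qed
  then show ?thesis using nu by blast
qed

text \<open>At the level generated by \<open>G\<close> the moment is a sum of masses weighted by
  counts, and by tightness no part of it escapes in the limit.\<close>

lemma moment_of_limit:
  assumes nu: "pro_measure C \<nu>'"
    and eq: "\<And>L c. \<lbrakk>level C L; c \<in> L // iso_rel C\<rbrakk> \<Longrightarrow> emeasure \<nu>' (cyl L c) = ennreal (limit_mass L c)"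
    and G: "G \<in> Obj C"
  shows "moment C \<nu>' G = ennreal (M (iso_class C G))"
proof -
  let ?L = "gen_level C {iso_class C G}" and ?g = "iso_class C G"
  note L = level_gen_single[OF G]
  have g: "?g \<in> ?L // iso_rel C" using iso_class_in_quotient[OF L(2)] .
  let ?k = "of_nat (card (Aut C G)) :: ennreal"
  have lim: "(\<lambda>t. ?k * (\<integral>\<^sup>+ c. of_nat (quots.cnt c ?g) * emeasure (\<nu> t) (cyl ?L c) \<partial>count_space (?L // iso_rel C)))
      \<longlonglongrightarrow> ?k * ennreal (norm_moment ?g)"
    using normalized_moments[OF L(1) g] by (intro ennreal_tendsto_cmult) (auto simp: less_top[symmetric])
  have "(\<lambda>t. moment C (\<nu> t) G) \<longlonglongrightarrow> ?k * ennreal (norm_moment ?g)"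
    using lim by (rule Lim_transform_eventually) (use ev_pm in eventually_elim, simp add: moment_eq[OF _ L])
  then have "?k * ennreal (norm_moment ?g) = ennreal (M ?g)"
    using moment_lim[OF G] by (rule LIMSEQ_unique)
  moreover have "(\<integral>\<^sup>+ c. of_nat (quots.cnt c ?g) * ennreal (limit_mass ?L c) \<partial>count_space (?L // iso_rel C)) = ennreal (norm_moment ?g)"
    by (rule limit_mass_sum[OF L(1) g order_refl normalized_moments[OF L(1) g]])
  moreover have "(\<integral>\<^sup>+ c. of_nat (quots.cnt c ?g) * emeasure \<nu>' (cyl ?L c) \<partial>count_space (?L // iso_rel C)) =
      (\<integral>\<^sup>+ c. of_nat (quots.cnt c ?g) * ennreal (limit_mass ?L c) \<partial>count_space (?L // iso_rel C))"
    using eq[OF L(1)] by (intro nn_integral_cong) simp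
  ultimately show ?thesis using moment_eq[OF nu L] by simp
qed

text \<open>Apply the convergence statement to the constant sequence.\<close>

lemma determined_by_moments:
  assumes nu: "pro_measure C \<nu>'" and mom: "\<And>G. G \<in> Obj C \<Longrightarrow> enn2ereal (moment C \<nu>' G) = ereal (M (iso_class C G))"
    and L: "level C L" and c: "c \<in> L // iso_rel C"
  shows "emeasure \<nu>' (cyl L c) = ennreal (limit_mass L c)"
proof -
  interpret const: convergent_moments C M "\<lambda>_. \<nu>'"
    by unfold_locales (use wb nu mom in auto)
  have "(\<lambda>_::nat. emeasure \<nu>' (cyl L c)) \<longlonglongrightarrow> ennreal (const.limit_mass L c)"
    using const.cyl_limit(2)[OF L c] .
  then have "emeasure \<nu>' (cyl L c) = ennreal (const.limit_mass L c)"
    by (rule LIMSEQ_unique[OF tendsto_const])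
  then show ?thesis by (simp add: const.limit_mass_def limit_mass_def const.norm_moment_def norm_moment_def)
qed

end

theorem theorem1p8:
  fixes C :: "('o, 'm) cat"
    and M :: "'o set \<Rightarrow> real"
    and \<nu>\<^sub>s :: "nat \<Rightarrow> ('o set \<Rightarrow> 'o set) measure"
  assumes "diamond_category C"
    and "countable (Obj C // iso_rel C)"
    and "well_behaved C M"
    and "\<And>t. t \<ge> 1 \<Longrightarrow> pro_measure C (\<nu>\<^sub>s t)"
    and "\<And>G. G \<in> Obj C \<Longrightarrow>
           (\<lambda>t. enn2ereal (moment C (\<nu>\<^sub>s t) G)) \<longlonglongrightarrow> ereal (M (iso_class C G))"
  shows "\<exists>\<nu>. pro_measure C \<nu> \<and>
           (\<forall>G \<in> Obj C. enn2ereal (moment C \<nu> G) = ereal (M (iso_class C G))) \<and>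
           (\<forall>\<nu>'. pro_measure C \<nu>' \<and>
                 (\<forall>G \<in> Obj C. enn2ereal (moment C \<nu>' G) = ereal (M (iso_class C G)))
              \<longrightarrow> \<nu>' = \<nu>) \<and>
           (\<forall>L F. level C L \<and> F \<in> L \<longrightarrow>
              (\<lambda>c. mu_hat C F (rep c) / real (card (Aut C (rep c))) * M c)
                summable_on (L // iso_rel C) \<and>
              enn2ereal (emeasure \<nu> (pro_nbhd C L F)) =
                ereal (\<Sum>\<^sub>\<infinity>c \<in> L // iso_rel C.
                         mu_hat C F (rep c) / real (card (Aut C (rep c))) * M c)) \<and>
           weakly_converges C \<nu>\<^sub>s \<nu>"
proof -
  interpret diamond_category C by fact
  interpret convergent_moments C M \<nu>\<^sub>s
    by unfold_locales (use assms in auto)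
  obtain \<nu> where nu: "pro_measure C \<nu>"
    and cyl: "\<And>L c. \<lbrakk>level C L; c \<in> L // iso_rel C\<rbrakk> \<Longrightarrow> emeasure \<nu> (cyl L c) = ennreal (limit_mass L c)"
    using limit_measure_exists by blast
  have moments: "enn2ereal (moment C \<nu> G) = ereal (M (iso_class C G))" if G: "G \<in> Obj C" for G
    using moment_of_limit[OF nu cyl G] M_nonneg[OF iso_class_in[OF G]] by (simp add: enn2ereal_ennreal)
  have unique: "\<nu>' = \<nu>"
    if nu': "pro_measure C \<nu>'" and mom': "\<forall>G \<in> Obj C. enn2ereal (moment C \<nu>' G) = ereal (M (iso_class C G))" for \<nu>'
  proof (rule pro_measure_eqI[OF nu' nu])
    have eq: "emeasure \<nu>' (cyl L c) = ennreal (limit_mass L c)" if "level C L" "c \<in> L // iso_rel C" for L c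
      using determined_by_moments[OF nu' _ that] mom' by blast
    show "emeasure \<nu>' (cyl (nth_level n) c) = emeasure \<nu> (cyl (nth_level n) c)" if "c \<in> nth_level n // iso_rel C" for n c
      using eq[OF level_nth that] cyl[OF level_nth that] by simp
    \<comment> \<open>The total mass may be infinite; finiteness of the cylinders at the initial
      level gives the countable cover by sets of finite measure.\<close>
    show "emeasure \<nu>' (cyl (nth_level 0) c) \<noteq> \<infinity>" if "c \<in> nth_level 0 // iso_rel C" for c
      using eq[OF level_nth that] by simp
  qed
  have formula: "(\<lambda>c. mu_hat C F (rep c) / real (card (Aut C (rep c))) * M c) summable_on (L // iso_rel C) \<and>
      enn2ereal (emeasure \<nu> (pro_nbhd C L F)) =
        ereal (\<Sum>\<^sub>\<infinity>c \<in> L // iso_rel C. mu_hat C F (rep c) / real (card (Aut C (rep c))) * M c)"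
    if L: "level C L" and F: "F \<in> L" for L F
  proof -
    have FO: "F \<in> Obj C" using level_Obj[OF L] F by blast
    have c: "iso_class C F \<in> L // iso_rel C" using iso_class_in_quotient[OF F] .
    have "(\<lambda>c. mu_hat C F (rep c) / real (card (Aut C (rep c))) * M c) = (\<lambda>h. quots.mobius_sum (iso_class C F) h * norm_moment h)"
      by (simp add: mu_hat_eq_mobius_sum[OF FO] norm_moment_def fun_eq_iff)
    then show ?thesis
      using cyl_limit(1,3)[OF L c] cyl[OF L c] by (simp add: pro_nbhd_eq_cyl limit_mass_def enn2ereal_ennreal)
  qed
  interpret cyl_convergence C \<nu>\<^sub>s \<nu>
    by unfold_locales (use nu cyl cyl_limit(2) assms(4) in auto)
  show ?thesis
    using nu moments unique formula weakly_converges by blast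
qed


end
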